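(* Let $T>0$, let $v_0\in H$, and let $v^E$ be a weak solution on $(0,T)$ to the Euler equations on $\mathbb{T}^3$ with initial datum $v_0$. Let $q>2$ and suppose that $$v^E\in L^{r}\big(0,T;W^{1,q}(\mathbb{T}^3)\big)\qquad\text{for some } r>\frac{5q}{5q-6}.$$ Then $v^E$ conserves the energy.
   Context: Notation: $\mathbb{T}^3=(\mathbb{R}/2\pi\mathbb{Z})^3$. $H$ is the closure in $L^2(\mathbb{T}^3)$ of the smooth, periodic, divergence-free vector fields. $W^{1,q}(\mathbb{T}^3)$ is the usual Sobolev space. Euler equations: $\partial_t v^E+(v^E\cdot\nabla)v^E+\nabla p^E=0$ and $\operatorname{div}v^E=0$ in $(0,T)\times\mathbb{T}^3$, with $v^E(0)=v_0$. Weak solution to the Euler equations with datum $v_0\in H$: a measurable $v^E:(0,T)\times\mathbb{T}^3\to\mathbb{R}^3$ with $v^E\in L^\infty(0,T;H)$ such that $$\int_0^T\int_{\mathbb{T}^3}\big[v^E\cdot\partial_t\phi+(v^E\otimes v^E):\nabla\phi\big]\,dx\,dt=-\int_{\mathbb{T}^3}v_0\cdot\phi(0)\,dx$$ for all vector fields $\phi\in C_0^\infty([0,T)\times\mathbb{T}^3)$ (smooth, compactly supported in $[0,T)\times\mathbb{T}^3$) with $\operatorname{div}\phi=0$. Such a $v^E$ is, after modification on a null set of times, weakly continuous from $[0,T]$ into $L^2(\mathbb{T}^3)$ with $v^E(0)=v_0$. "$v^E$ conserves the energy" means that for this representative $\frac12\|v^E(t)\|_{L^2}^2=\frac12\|v_0\|_{L^2}^2$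 for all $t\in[0,T]$. *)

theory Defs
  imports "HOL-Analysis.Analysis"
begin

text \<open>
  Functions on the torus $(R/2\pi Z)^3$ are represented by functions on \<open>real^3\<close> that are
  $2\pi$-periodic in each coordinate, and integrals over the torus by integrals over the cell
  $[0,2\pi]^3$ (Lebesgue measure, not normalised).  Elements of function spaces are
  representatives; equality of classes is equality almost everywhere.
\<close>

definition torus_periodic :: "(real^3 \<Rightarrow> 'b) \<Rightarrow> bool" where
  "torus_periodic f \<longleftrightarrow> (\<forall>x i. f (x + axis i (2 * pi)) = f x)"

definition torus_cell :: "(real^3) set" where
  "torus_cell = cbox 0 (\<chi> i. 2 * pi)"

definition torus :: "(real^3) measure" where
  "torus = lebesgue_on torus_cell"

text \<open>
  On a set \<open>S\<close> with a boundary, derivatives are taken within \<open>S\<close>, hence one-sided at the boundary.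
  For \<open>S = {0..<T} \<times> UNIV\<close> they are unique, so that the existential quantifier is harmless.
\<close>

primrec Ck_on :: "nat \<Rightarrow> 'a::euclidean_space set \<Rightarrow> ('a \<Rightarrow> 'b::real_normed_vector) \<Rightarrow> bool" where
  "Ck_on 0 S f \<longleftrightarrow> continuous_on S f"
| "Ck_on (Suc k) S f \<longleftrightarrow>
     (\<exists>f'. (\<forall>x\<in>S. (f has_derivative f' x) (at x within S)) \<and>
           (\<forall>b\<in>Basis. Ck_on k S (\<lambda>x. f' x b)))"

definition smooth_on :: "'a::euclidean_space set \<Rightarrow> ('a \<Rightarrow> 'b::real_normed_vector) \<Rightarrow> bool" where
  "smooth_on S f \<longleftrightarrow> (\<forall>k. Ck_on k S f)"

definition partial_d :: "3 \<Rightarrow> (real^3 \<Rightarrow> 'b::real_normed_vector) \<Rightarrow> real^3 \<Rightarrow> 'b" where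
  "partial_d j f x = frechet_derivative f (at x) (axis j 1)"

definition divergence :: "(real^3 \<Rightarrow> real^3) \<Rightarrow> real^3 \<Rightarrow> real" where
  "divergence f x = (\<Sum>i\<in>UNIV. partial_d i f x $ i)"

definition Lp_torus :: "real \<Rightarrow> (real^3 \<Rightarrow> 'b::euclidean_space) set" where
  "Lp_torus q = {f. torus_periodic f \<and> f \<in> borel_measurable torus \<and>
                    integrable torus (\<lambda>x. norm (f x) powr q)}"

definition Lp_norm :: "real \<Rightarrow> (real^3 \<Rightarrow> 'b::euclidean_space) \<Rightarrow> real" where
  "Lp_norm q f = (LINT x|torus. norm (f x) powr q) powr (1 / q)"

definition space_H :: "(real^3 \<Rightarrow> real^3) set" where
  "space_H = {f \<in> Lp_torus 2. \<forall>e>0. \<exists>g. smooth_on UNIV g \<and> torus_periodic g \<and>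
                (\<forall>x. divergence g x = 0) \<and> Lp_norm 2 (\<lambda>x. f x - g x) < e}"

text \<open>\<open>G x $ i $ j\<close> is the weak derivative of the \<open>i\<close>-th component in direction \<open>j\<close>.\<close>

definition has_weak_grad :: "(real^3 \<Rightarrow> real^3) \<Rightarrow> (real^3 \<Rightarrow> real^3^3) \<Rightarrow> bool" where
  "has_weak_grad u G \<longleftrightarrow>
     G \<in> Lp_torus 1 \<and>
     (\<forall>(\<psi>::real^3 \<Rightarrow> real) i j. smooth_on UNIV \<psi> \<longrightarrow> torus_periodic \<psi> \<longrightarrow>
        (LINT x|torus. u x $ i * partial_d j \<psi> x) = - (LINT x|torus. G x $ i $ j * \<psi> x))"

text \<open>A weak gradient is unique up to a null set; \<open>weak_grad\<close> picks a representative.\<close>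

definition weak_grad :: "(real^3 \<Rightarrow> real^3) \<Rightarrow> real^3 \<Rightarrow> real^3^3" where
  "weak_grad u = (SOME G. has_weak_grad u G)"

definition W1_torus :: "real \<Rightarrow> (real^3 \<Rightarrow> real^3) set" where
  "W1_torus q = {u \<in> Lp_torus q. \<exists>G. has_weak_grad u G \<and> G \<in> Lp_torus q}"

definition W1_norm :: "real \<Rightarrow> (real^3 \<Rightarrow> real^3) \<Rightarrow> real" where
  "W1_norm q u = (Lp_norm q u powr q + Lp_norm q (weak_grad u) powr q) powr (1 / q)"

text \<open>
  Bochner spaces over \<open>(0,T)\<close> with values in a space of functions, given by its set \<open>X\<close> of
  representatives and its norm \<open>N\<close>.  Measurability is strong measurability: \<open>u\<close> is almost
  everywhere the limit in norm of \<open>X\<close>-valued simple functions.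
\<close>

definition bochner_measurable ::
  "real \<Rightarrow> (real^3 \<Rightarrow> real^3) set \<Rightarrow> ((real^3 \<Rightarrow> real^3) \<Rightarrow> real) \<Rightarrow> (real \<Rightarrow> real^3 \<Rightarrow> real^3) \<Rightarrow> bool" where
  "bochner_measurable T X N u \<longleftrightarrow>
     (AE t in lebesgue_on {0<..<T}. u t \<in> X) \<and>
     (\<exists>s :: nat \<Rightarrow> real \<Rightarrow> real^3 \<Rightarrow> real^3.
        (\<forall>n. simple_function (lebesgue_on {0<..<T}) (s n) \<and> (\<forall>t\<in>{0<..<T}. s n t \<in> X)) \<and>
        (AE t in lebesgue_on {0<..<T}. (\<lambda>n. N (\<lambda>x. s n t x - u t x)) \<longlonglongrightarrow> 0))"

definition bochner_Lp ::
  "real \<Rightarrow> real \<Rightarrow> (real^3 \<Rightarrow> real^3) set \<Rightarrow> ((real^3 \<Rightarrow> real^3) \<Rightarrow> real) \<Rightarrow>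
    (real \<Rightarrow> real^3 \<Rightarrow> real^3) set" where
  "bochner_Lp r T X N = {u. bochner_measurable T X N u \<and>
                            integrable (lebesgue_on {0<..<T}) (\<lambda>t. N (u t) powr r)}"

definition bochner_Linf ::
  "real \<Rightarrow> (real^3 \<Rightarrow> real^3) set \<Rightarrow> ((real^3 \<Rightarrow> real^3) \<Rightarrow> real) \<Rightarrow>
    (real \<Rightarrow> real^3 \<Rightarrow> real^3) set" where
  "bochner_Linf T X N = {u. bochner_measurable T X N u \<and>
                            (\<exists>M. AE t in lebesgue_on {0<..<T}. N (u t) \<le> M)}"

text \<open>
  Smooth solenoidal fields compactly supported in \<open>[0,T) \<times> torus\<close>: as the torus is compact, the
  support is compact there iff its projection to the time axis lies in a compact subset of \<open>[0,T)\<close>.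
\<close>

definition test_field :: "real \<Rightarrow> (real \<Rightarrow> real^3 \<Rightarrow> real^3) \<Rightarrow> bool" where
  "test_field T \<phi> \<longleftrightarrow>
     smooth_on ({0..<T} \<times> UNIV) (\<lambda>(t, x). \<phi> t x) \<and>
     (\<forall>t\<in>{0..<T}. torus_periodic (\<phi> t)) \<and>
     (\<exists>K. compact K \<and> K \<subseteq> {0..<T} \<and> (\<forall>t\<in>{0..<T} - K. \<forall>x. \<phi> t x = 0)) \<and>
     (\<forall>t\<in>{0..<T}. \<forall>x. divergence (\<phi> t) x = 0)"

definition euler_weak_solution ::
  "real \<Rightarrow> (real^3 \<Rightarrow> real^3) \<Rightarrow> (real \<Rightarrow> real^3 \<Rightarrow> real^3) \<Rightarrow> bool" where
  "euler_weak_solution T v0 v \<longleftrightarrow>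
     (\<forall>t\<in>{0<..<T}. torus_periodic (v t)) \<and>
     (\<lambda>(t, x). v t x) \<in> borel_measurable (lebesgue_on ({0<..<T} \<times> torus_cell)) \<and>
     v \<in> bochner_Linf T space_H (Lp_norm 2) \<and>
     (\<forall>\<phi>. test_field T \<phi> \<longrightarrow>
        (LINT t|lebesgue_on {0<..<T}. LINT x|torus.
            v t x \<bullet> vector_derivative (\<lambda>s. \<phi> s x) (at t) +
            (\<Sum>i\<in>UNIV. \<Sum>j\<in>UNIV. v t x $ i * v t x $ j * partial_d j (\<phi> t) x $ i))
        = - (LINT x|torus. v0 x \<bullet> \<phi> 0 x))"

definition weakly_cont_rep ::
  "real \<Rightarrow> (real^3 \<Rightarrow> real^3) \<Rightarrow> (real \<Rightarrow> real^3 \<Rightarrow> real^3) \<Rightarrow> (real \<Rightarrow> real^3 \<Rightarrow> real^3) \<Rightarrow> bool" where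
  "weakly_cont_rep T v0 v w \<longleftrightarrow>
     (\<forall>t\<in>{0..T}. w t \<in> Lp_torus 2) \<and>
     (AE t in lebesgue_on {0<..<T}. AE x in torus. w t x = v t x) \<and>
     (\<forall>\<psi>\<in>Lp_torus 2. continuous_on {0..T} (\<lambda>t. LINT x|torus. w t x \<bullet> \<psi> x)) \<and>
     (AE x in torus. w 0 x = v0 x)"

definition energy :: "(real^3 \<Rightarrow> real^3) \<Rightarrow> real" where
  "energy u = 1 / 2 * (Lp_norm 2 u)\<^sup>2"

text \<open>
  The weakly continuous representative is unique up to null sets of the torus at each time, so the
  definite description is rendered by existence together with a statement on all representatives.
\<close>

definition conserves_energy ::
  "real \<Rightarrow> (real^3 \<Rightarrow> real^3) \<Rightarrow> (real \<Rightarrow> real^3 \<Rightarrow> real^3) \<Rightarrow> bool" where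
  "conserves_energy T v0 v \<longleftrightarrow>
     (\<exists>w. weakly_cont_rep T v0 v w) \<and>
     (\<forall>w. weakly_cont_rep T v0 v w \<longrightarrow> (\<forall>t\<in>{0..T}. energy (w t) = energy v0))"

end

theory Submission
  imports Defs
begin

text \<open>
  The energy of an Euler solution can only change through the flux of energy to small scales, and the
  integrability of the gradient makes that flux vanish.  Let \<open>mol n\<close> be mollification at scale
  \<open>\<epsilon> = 1 / sqrt (n + 1)\<close>.  It is symmetric and preserves solenoidal fields, so that the equation may be
  tested with the twice mollified solution; this gives the balance \<open>mollified_energy_balance\<close>, in which
  the square of the norm of \<open>mol n (w t)\<close> changes by twice the time integral of the flux
  \<open>\<integral> u \<otimes> u : \<nabla> (mol n (mol n u))\<close>.

  Following Constantin, E and Titi, the flux is rewritten with the commutator of mollification and the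
  product \<open>u \<otimes> u\<close>, which is quadratic in the increments \<open>u (x + z) - u x\<close> over distances of order
  \<open>\<epsilon>\<close> (\<open>commutator_bound\<close>).  The increments are bounded in \<open>L2\<close> by the energy and in \<open>Lq\<close> by \<open>\<epsilon>\<close> times the
  gradient; the remaining factor, the mollified gradient, is bounded in \<open>Lq\<close> and, at the price of
  \<open>\<epsilon> powr (- 3 / q)\<close>, in the supremum norm.  Young's inequality with a parameter \<open>\<theta>\<close> interpolates between
  these bounds and yields \<open>flux_estimate\<close>: the flux is at most a constant times
  \<open>\<epsilon> powr c * A powr (1 + 2 * \<theta>)\<close>, where \<open>A\<close> bounds the norm in \<open>W1q\<close>, and \<open>c > 0\<close> exactly if
  \<open>\<theta> > 3 / (5 * q - 6)\<close>.  As \<open>\<theta>\<close> tends to this bound, the power of \<open>A\<close> tends to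
  \<open>1 + 6 / (5 * q - 6) = 5 * q / (5 * q - 6)\<close>.  The assumption on \<open>r\<close> leaves room to choose
  \<open>\<theta>\<close> with \<open>1 + 2 * \<theta> \<le> r\<close>; the flux is then dominated by an integrable function of time multiplied by a null
  sequence.

  The mollifier is the de la Vallee-Poussin kernel, a trigonometric polynomial.  Its convolution
  operators have finite rank, hence Fubini's theorem, the symmetry of mollification and differentiation
  under the integral sign reduce to finite sums, and fields that are merely square integrable become
  smooth.  The estimates are proved for smooth solenoidal fields and extended by continuity of the
  flux in \<open>L2\<close> (\<open>flux_tendsto\<close>).

  The weakly continuous representative comes from Riesz' theorem in the closure of the smooth
  solenoidal fields: the equation prescribes the pairing of the solution with each of them as a Lipschitz
  function of time.  For any such representative \<open>w\<close>, the energy of \<open>mol n (w t)\<close> tends to that of the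
  datum at every time.  Thus the norm of \<open>w t\<close> is at least that of the datum, because mollification is a
  contraction; it equals the norm of the datum at almost every time, where \<open>w t\<close> is a limit of its
  mollifications, and weak continuity extends the upper bound to every time.
\<close>

section \<open>Calculus of smooth functions\<close>

lemma Ck_on_imp_continuous_on: "Ck_on k S f \<Longrightarrow> continuous_on S f"
proof (cases k)
  case (Suc m)
  assume "Ck_on k S f"
  with Suc obtain f' where "\<forall>x\<in>S. (f has_derivative f' x) (at x within S)" by auto
  then show ?thesis
    by (meson continuous_on_eq_continuous_within has_derivative_continuous)
qed simp

lemma Ck_on_SucI:
  assumes "\<And>x. x \<in> S \<Longrightarrow> (f has_derivative f' x) (at x within S)"
    and "\<And>b. b \<in> Basis \<Longrightarrow> Ck_on k S (\<lambda>x. f' x b)"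
  shows "Ck_on (Suc k) S f"
  using assms by auto

lemma Ck_on_SucD: "Ck_on (Suc k) S f \<Longrightarrow> Ck_on k S f"
proof (induction k arbitrary: f)
  case 0
  then show ?case using Ck_on_imp_continuous_on by fastforce
next
  case (Suc k)
  then obtain f' where "\<forall>x\<in>S. (f has_derivative f' x) (at x within S)"
    and "\<forall>b\<in>Basis. Ck_on (Suc k) S (\<lambda>x. f' x b)" by auto
  then show ?case using Suc.IH by (auto intro!: exI[of _ f'])
qed

lemma Ck_on_const: "Ck_on k S (\<lambda>x. c)"
proof (induction k arbitrary: c)
  case (Suc k)
  show ?case by (rule Ck_on_SucI[of S _ "\<lambda>x h. 0"]) (rule has_derivative_const Suc.IH)+
qed simp

lemma Ck_on_linear: assumes "bounded_linear L" shows "Ck_on k S L"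
proof (cases k)
  case 0
  then show ?thesis using assms linear_continuous_on by auto
next
  case (Suc m)
  show ?thesis unfolding Suc
    by (rule Ck_on_SucI[of S _ "\<lambda>x. L"]) (rule bounded_linear_imp_has_derivative[OF assms] Ck_on_const)+
qed

lemma Ck_on_bounded_linear:
  assumes "bounded_linear L"
  shows "Ck_on k S f \<Longrightarrow> Ck_on k S (\<lambda>x. L (f x))"
proof (induction k arbitrary: f)
  case 0
  then show ?case using assms by (auto intro: bounded_linear.continuous_on)
next
  case (Suc k)
  then obtain f' where "\<forall>x\<in>S. (f has_derivative f' x) (at x within S)"
    and "\<forall>b\<in>Basis. Ck_on k S (\<lambda>x. f' x b)" by auto
  then show ?case using Suc.IH
    by (intro Ck_on_SucI[of S _ "\<lambda>x h. L (f' x h)"]) (simp_all add: bounded_linear.has_derivative[OF assms])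
qed

lemma Ck_on_add:
  "Ck_on k S f \<Longrightarrow> Ck_on k S g \<Longrightarrow> Ck_on k S (\<lambda>x. f x + g x)"
proof (induction k arbitrary: f g)
  case 0
  then show ?case by (auto intro: continuous_intros)
next
  case (Suc k)
  then obtain f' g' where "\<forall>x\<in>S. (f has_derivative f' x) (at x within S)"
    and "\<forall>b\<in>Basis. Ck_on k S (\<lambda>x. f' x b)"
    "\<forall>x\<in>S. (g has_derivative g' x) (at x within S)"
    and "\<forall>b\<in>Basis. Ck_on k S (\<lambda>x. g' x b)" by (auto)
  then show ?case using Suc.IH
    by (intro Ck_on_SucI[of S _ "\<lambda>x h. f' x h + g' x h"]) (simp_all add: has_derivative_add)
qed

lemma Ck_on_scaleR:
  fixes f :: "'a::euclidean_space \<Rightarrow> real" and g :: "'a \<Rightarrow> 'b::real_normed_vector"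
  shows "Ck_on k S f \<Longrightarrow> Ck_on k S g \<Longrightarrow> Ck_on k S (\<lambda>x. f x *\<^sub>R g x)"
proof (induction k arbitrary: f g)
  case 0
  then show ?case by (auto intro: continuous_intros)
next
  case (Suc k)
  then obtain f' g' where f': "\<forall>x\<in>S. (f has_derivative f' x) (at x within S)"
    "\<forall>b\<in>Basis. Ck_on k S (\<lambda>x. f' x b)"
    and g': "\<forall>x\<in>S. (g has_derivative g' x) (at x within S)"
    "\<forall>b\<in>Basis. Ck_on k S (\<lambda>x. g' x b)" by (auto)
  have fg: "Ck_on k S f" "Ck_on k S g" using Suc.prems Ck_on_SucD by blast+
  have "\<forall>x\<in>S. ((\<lambda>x. f x *\<^sub>R g x) has_derivative (\<lambda>h. f x *\<^sub>R g' x h + f' x h *\<^sub>R g x)) (at x within S)"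
    using f'(1) g'(1) by (auto intro!: has_derivative_scaleR)
  moreover have "\<forall>b\<in>Basis. Ck_on k S (\<lambda>x. f x *\<^sub>R g' x b + f' x b *\<^sub>R g x)"
    using f'(2) g'(2) fg Suc.IH by (auto intro!: Ck_on_add)
  ultimately show ?case
    by (intro Ck_on_SucI[of S _ "\<lambda>x h. f x *\<^sub>R g' x h + f' x h *\<^sub>R g x"]) blast+
qed

lemma Ck_on_cong: "Ck_on k S f \<Longrightarrow> (\<And>x. x \<in> S \<Longrightarrow> g x = f x) \<Longrightarrow> Ck_on k S g"
proof (cases k)
  case (Suc m)
  assume f: "Ck_on k S f" and eq: "\<And>x. x \<in> S \<Longrightarrow> g x = f x"
  obtain f' where f': "\<forall>x\<in>S. (f has_derivative f' x) (at x within S)"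
    "\<forall>b\<in>Basis. Ck_on m S (\<lambda>x. f' x b)" using f Suc by auto
  have "\<forall>x\<in>S. (g has_derivative f' x) (at x within S)"
    using f'(1) eq by (metis has_derivative_transform)
  then show ?thesis using f'(2) Suc by auto
qed (simp cong: continuous_on_cong)

text \<open>
  The derivatives of a product of a function of time and a function of space in the coordinate
  directions are again such products, so that smoothness in space-time needs no joint estimate.
\<close>

lemma Ck_on_product:
  fixes f :: "'a::euclidean_space \<Rightarrow> real" and g :: "'c::euclidean_space \<Rightarrow> 'b::real_normed_vector"
  shows "Ck_on k S f \<Longrightarrow> Ck_on k R g \<Longrightarrow> Ck_on k (S \<times> R) (\<lambda>(t, x). f t *\<^sub>R g x)"
proof (induction k arbitrary: f g)
  case 0
  then show ?case
    by (auto simp: case_prod_beta intro!: continuous_intros continuous_on_compose2[of S f _ fst]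
        continuous_on_compose2[of R g _ snd])
next
  case (Suc k)
  then obtain f' g' where f': "\<forall>x\<in>S. (f has_derivative f' x) (at x within S)"
    "\<forall>b\<in>Basis. Ck_on k S (\<lambda>x. f' x b)"
    and g': "\<forall>x\<in>R. (g has_derivative g' x) (at x within R)"
    "\<forall>b\<in>Basis. Ck_on k R (\<lambda>x. g' x b)" by (auto)
  have fg: "Ck_on k S f" "Ck_on k R g" using Suc.prems Ck_on_SucD by blast+
  define D where "D = (\<lambda>(z::'a \<times> 'c) h. f (fst z) *\<^sub>R g' (snd z) (snd h) + f' (fst z) (fst h) *\<^sub>R g (snd z))"
  have "\<forall>z\<in>S\<times>R. ((\<lambda>z. f (fst z) *\<^sub>R g (snd z)) has_derivative D z) (at z within S\<times>R)"
  proof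
    fix z assume z: "z \<in> S \<times> R"
    have "((\<lambda>z. f (fst z)) has_derivative (\<lambda>h. f' (fst z) (fst h))) (at z within S \<times> R)"
      by (rule has_derivative_in_compose2[where t = S and g' = f']) 
         (use z f' in \<open>auto intro!: derivative_eq_intros\<close>)
    moreover have "((\<lambda>z. g (snd z)) has_derivative (\<lambda>h. g' (snd z) (snd h))) (at z within S \<times> R)"
      by (rule has_derivative_in_compose2[where t = R and g' = g']) 
         (use z g' in \<open>auto intro!: derivative_eq_intros\<close>)
    ultimately show "((\<lambda>z. f (fst z) *\<^sub>R g (snd z)) has_derivative D z) (at z within S\<times>R)"
      unfolding D_def by (rule has_derivative_scaleR)
  qed
  moreover have "Ck_on k (S\<times>R) (\<lambda>z. D z b)" if "b \<in> Basis" for b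
  proof -
    consider (l) u where "u \<in> Basis" "b = (u, 0)" | (r) u where "u \<in> Basis" "b = (0, u)"
      using \<open>b \<in> Basis\<close> by (auto simp: Basis_prod_def)
    then show ?thesis
    proof cases
      case l
      have "Ck_on k R (\<lambda>x. g x)" "Ck_on k S (\<lambda>x. f' x u)" using fg f' l by auto
      from Suc.IH[OF this(2,1)] have H: "Ck_on k (S\<times>R) (\<lambda>z. f' (fst z) u *\<^sub>R g (snd z))"
        by (simp add: case_prod_beta)
      have g0: "x \<in> R \<Longrightarrow> g' x 0 = 0" for x
        using g'(1) has_derivative_bounded_linear linear_simps(3) by blast
      show ?thesis
        by (rule Ck_on_cong[OF H]) (auto simp: D_def l g0)
    next
      case r
      have "Ck_on k R (\<lambda>x. g' x u)" using g' r by auto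
      from Suc.IH[OF fg(1) this] have H: "Ck_on k (S\<times>R) (\<lambda>z. f (fst z) *\<^sub>R g' (snd z) u)"
        by (simp add: case_prod_beta)
      have f0: "x \<in> S \<Longrightarrow> f' x 0 = 0" for x
        using f'(1) has_derivative_bounded_linear linear_simps(3) by blast
      show ?thesis
        by (rule Ck_on_cong[OF H]) (auto simp: D_def r f0)
    qed
  qed
  ultimately have "\<exists>D. (\<forall>z\<in>S\<times>R. ((\<lambda>z. f (fst z) *\<^sub>R g (snd z)) has_derivative D z) (at z within S\<times>R))
      \<and> (\<forall>b\<in>Basis. Ck_on k (S\<times>R) (\<lambda>z. D z b))" by blast
  then show ?case by (simp add: case_prod_beta)
qed

text \<open>
  Smoothness of a composition \<open>g \<circ> h\<close> is proved for all members \<open>g\<close> of a family of functions on the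
  line that is closed under differentiation, such as the sines and cosines.
\<close>

lemma Ck_on_compose_family:
  fixes h :: "'a::euclidean_space \<Rightarrow> real" and F :: "(real \<Rightarrow> real) set"
  assumes F: "\<And>g. g \<in> F \<Longrightarrow> \<exists>g'\<in>F. \<forall>x. (g has_real_derivative g' x) (at x)"
  shows "g \<in> F \<Longrightarrow> Ck_on k S h \<Longrightarrow> Ck_on k S (\<lambda>x. g (h x))"
proof (induction k arbitrary: g)
  case 0
  have "continuous_on UNIV g" using F[OF 0(1)] by (metis DERIV_continuous_on has_field_derivative_at_within)
  then show ?case using 0 by (auto intro: continuous_on_compose2)
next
  case (Suc k)
  obtain g' where g': "g' \<in> F" "\<forall>x. (g has_real_derivative g' x) (at x)" using F[OF Suc.prems(1)] by auto
  obtain h' where h': "\<forall>x\<in>S. (h has_derivative h' x) (at x within S)"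
    "\<forall>b\<in>Basis. Ck_on k S (\<lambda>x. h' x b)" using Suc.prems by auto
  have hk: "Ck_on k S h" using Suc.prems Ck_on_SucD by blast
  have "((\<lambda>x. g (h x)) has_derivative (\<lambda>b. g' (h x) *\<^sub>R h' x b)) (at x within S)" if "x \<in> S" for x
    using has_derivative_compose[OF h'(1)[rule_format, OF that], of g "\<lambda>y. g' (h x) * y"]
      g'(2)[rule_format, of "h x"] by (simp add: has_field_derivative_def)
  moreover have "\<forall>b\<in>Basis. Ck_on k S (\<lambda>x. g' (h x) *\<^sub>R h' x b)"
    using Suc.IH[OF g'(1) hk] h'(2) Ck_on_scaleR by blast
  ultimately show ?case by (intro Ck_on_SucI[of S _ "\<lambda>x b. g' (h x) *\<^sub>R h' x b"]) blast+
qed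

lemma smooth_on_const: "smooth_on S (\<lambda>x. c)" by (simp add: smooth_on_def Ck_on_const)
lemma smooth_on_linear: "bounded_linear L \<Longrightarrow> smooth_on S L" by (simp add: smooth_on_def Ck_on_linear)
lemma smooth_on_bounded_linear: "bounded_linear L \<Longrightarrow> smooth_on S f \<Longrightarrow> smooth_on S (\<lambda>x. L (f x))"
  by (simp add: smooth_on_def Ck_on_bounded_linear)
lemma smooth_on_add: "smooth_on S f \<Longrightarrow> smooth_on S g \<Longrightarrow> smooth_on S (\<lambda>x. f x + g x)"
  by (simp add: smooth_on_def Ck_on_add)
lemma smooth_on_scaleR:
  fixes f :: "'a::euclidean_space \<Rightarrow> real"
  shows "smooth_on S f \<Longrightarrow> smooth_on S g \<Longrightarrow> smooth_on S (\<lambda>x. f x *\<^sub>R g x)"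
  by (simp add: smooth_on_def Ck_on_scaleR)
lemma smooth_on_mult:
  fixes f :: "'a::euclidean_space \<Rightarrow> real"
  shows "smooth_on S f \<Longrightarrow> smooth_on S g \<Longrightarrow> smooth_on S (\<lambda>x. f x * g x)"
  using smooth_on_scaleR[of S f g] by simp
lemma smooth_on_minus: "smooth_on S f \<Longrightarrow> smooth_on S (\<lambda>x. - f x)"
  by (rule smooth_on_bounded_linear[OF bounded_linear_minus[OF bounded_linear_ident]])
lemma smooth_on_diff: "smooth_on S f \<Longrightarrow> smooth_on S g \<Longrightarrow> smooth_on S (\<lambda>x. f x - g x)"
  using smooth_on_add[of S f "\<lambda>x. - g x"] smooth_on_minus[of S g] by simp
lemma smooth_on_sum: "(\<And>i. i \<in> I \<Longrightarrow> smooth_on S (f i)) \<Longrightarrow> smooth_on S (\<lambda>x. \<Sum>i\<in>I. f i x)"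
  by (induction I rule: infinite_finite_induct) (simp_all add: smooth_on_add smooth_on_const)
lemma smooth_on_prod:
  fixes f :: "'i \<Rightarrow> 'a::euclidean_space \<Rightarrow> real"
  shows "(\<And>i. i \<in> I \<Longrightarrow> smooth_on S (f i)) \<Longrightarrow> smooth_on S (\<lambda>x. \<Prod>i\<in>I. f i x)"
  by (induction I rule: infinite_finite_induct) (simp_all add: smooth_on_mult smooth_on_const)
lemma smooth_on_continuous: "smooth_on S f \<Longrightarrow> continuous_on S f"
  using Ck_on_imp_continuous_on smooth_on_def by blast

lemma smooth_on_trig:
  fixes h :: "'a::euclidean_space \<Rightarrow> real"
  assumes "smooth_on S h"
  shows "smooth_on S (\<lambda>x. cos (h x))" "smooth_on S (\<lambda>x. sin (h x))"
proof -
  let ?F = "{cos, sin, \<lambda>x. - cos x, \<lambda>x::real. - sin x}"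
  have F: "\<exists>g'\<in>?F. \<forall>x. (g has_real_derivative g' x) (at x)" if "g \<in> ?F" for g
  proof -
    have "(cos has_real_derivative - sin x) (at x)" "(sin has_real_derivative cos x) (at x)"
      "((\<lambda>x. - cos x) has_real_derivative sin x) (at x)"
      "((\<lambda>x. - sin x) has_real_derivative - cos x) (at x)" for x :: real
      by (auto intro!: derivative_eq_intros)
    then show ?thesis using that by (elim insertE emptyE; simp)
  qed
  have *: "smooth_on S (\<lambda>x. g (h x))" if "g \<in> ?F" for g
    unfolding smooth_on_def
    by (intro allI Ck_on_compose_family[of ?F, OF F that]) (use assms in \<open>auto simp: smooth_on_def\<close>)
  show "smooth_on S (\<lambda>x. cos (h x))" "smooth_on S (\<lambda>x. sin (h x))"
    by (rule *[of cos], simp) (rule *[of sin], simp)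
qed

text \<open>
  \<open>flat 1\<close> is the function \<open>exp (- 1 / x)\<close>, extended by zero; the polynomial factor in \<open>1 / x\<close> makes
  the family closed under differentiation.
\<close>

definition flat :: "real poly \<Rightarrow> real \<Rightarrow> real" where
  "flat p x = (if x > 0 then poly p (1 / x) * exp (- (1 / x)) else 0)"

lemma flat_nonpos: "x \<le> 0 \<Longrightarrow> flat p x = 0" by (simp add: flat_def)

lemma poly_times_exp_tendsto_0: "((\<lambda>y::real. poly p y * exp (- y)) \<longlongrightarrow> 0) at_top"
proof -
  have "((\<lambda>y. \<Sum>i\<le>degree p. coeff p i * (y ^ i / exp y)) \<longlongrightarrow> (\<Sum>i\<le>degree p. coeff p i * 0)) at_top"
    by (intro tendsto_intros tendsto_power_div_exp_0)
  then show ?thesis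
    by (simp add: poly_altdef sum_distrib_right exp_minus divide_inverse mult.assoc)
qed

lemma flat_has_derivative:
  "(flat p has_real_derivative flat ((p - pderiv p) * [:0, 0, 1:]) x) (at x)"
proof -
  consider "x > 0" | "x < 0" | "x = 0" by linarith
  then show ?thesis
  proof cases
    case 1
    have "((\<lambda>x. poly p (1 / x) * exp (- (1 / x))) has_real_derivative
        flat ((p - pderiv p) * [:0, 0, 1:]) x) (at x)"
    proof -
      have i: "((\<lambda>x. 1 / x) has_real_derivative - (1 / x\<^sup>2)) (at x)"
        using 1 by (auto intro!: derivative_eq_intros simp: power2_eq_square field_simps)
      have "((\<lambda>x. poly p (1 / x)) has_real_derivative poly (pderiv p) (1 / x) * - (1 / x\<^sup>2)) (at x)"
        by (rule DERIV_chain2[OF poly_DERIV i])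
      moreover have "((\<lambda>x. exp (- (1 / x))) has_real_derivative exp (- (1 / x)) * - (- (1 / x\<^sup>2))) (at x)"
        by (rule DERIV_chain2[OF DERIV_exp DERIV_minus[OF i]])
      ultimately have "((\<lambda>x. poly p (1 / x) * exp (- (1 / x))) has_real_derivative
          poly (pderiv p) (1 / x) * - (1 / x\<^sup>2) * exp (- (1 / x)) +
          exp (- (1 / x)) * - (- (1 / x\<^sup>2)) * poly p (1 / x)) (at x)"
        by (rule DERIV_mult)
      then show ?thesis using 1 by (simp add: flat_def algebra_simps power2_eq_square)
    qed
    then show ?thesis
      by (rule has_field_derivative_transform_within_open[of _ _ _ "{0<..}"]) (use 1 in \<open>auto simp: flat_def\<close>)
  next
    case 2
    have "((\<lambda>x. 0) has_real_derivative 0) (at x)" by (rule DERIV_const)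
    moreover have "flat ((p - pderiv p) * [:0, 0, 1:]) x = 0" using 2 by (simp add: flat_nonpos)
    ultimately show ?thesis
      using has_field_derivative_transform_within_open[of "\<lambda>x. 0" 0 x "{..<0}" "flat p"] 2
      by (simp add: flat_nonpos)
  next
    case 3
    have "((\<lambda>h. poly (pCons 0 p) (inverse h) * exp (- inverse h)) \<longlongrightarrow> 0) (at_right 0)"
      by (rule filterlim_compose[OF poly_times_exp_tendsto_0 filterlim_inverse_at_top_right])
    moreover have "\<forall>\<^sub>F h in at_right 0. poly (pCons 0 p) (inverse h) * exp (- inverse h) = flat p h / h"
      unfolding eventually_at_right_field
      by (intro exI[of _ 1]) (simp add: flat_def divide_inverse)
    ultimately have "((\<lambda>h. flat p h / h) \<longlongrightarrow> 0) (at_right 0)"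
      by (rule Lim_transform_eventually)
    moreover have "\<forall>\<^sub>F h in at_left 0. 0 = flat p h / h"
      unfolding eventually_at_left_field by (intro exI[of _ "-1"]) (simp add: flat_def)
    then have "((\<lambda>h. flat p h / h) \<longlongrightarrow> 0) (at_left 0)"
      by (rule Lim_transform_eventually[OF tendsto_const])
    ultimately have "((\<lambda>h. flat p h / h) \<longlongrightarrow> 0) (at 0)" by (intro filterlim_split_at)
    then show ?thesis using 3 by (simp add: has_field_derivative_iff flat_def)
  qed
qed

text \<open>
  The profile \<open>bump\<close> is positive exactly on the positive numbers, and \<open>bump (n * x)\<close> increases to the
  indicator of \<open>x > 0\<close>: composed with a function that is positive exactly on a given set, it gives smooth
  approximations of the indicator of that set.
\<close>

definition bump :: "real \<Rightarrow> real" where "bump = flat 1"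

lemma smooth_on_bump:
  fixes h :: "'a::euclidean_space \<Rightarrow> real"
  assumes "smooth_on S h" shows "smooth_on S (\<lambda>x. bump (h x))"
proof -
  have F: "\<exists>g'\<in>range flat. \<forall>x. (g has_real_derivative g' x) (at x)" if "g \<in> range flat" for g
  proof -
    from that obtain p where "g = flat p" by (rule rangeE)
    then show ?thesis
      by (intro bexI[of _ "flat ((p - pderiv p) * [:0, 0, 1:])"]) (simp_all only: flat_has_derivative rangeI simp_thms)
  qed
  show ?thesis unfolding smooth_on_def bump_def
    by (rule allI, rule Ck_on_compose_family[of "range flat" "flat 1", OF F])
       (use assms in \<open>auto simp: smooth_on_def\<close>)
qed

lemma bump_bounds: "0 \<le> bump x" "bump x \<le> 1" "x \<le> 0 \<Longrightarrow> bump x = 0"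
  by (auto simp: bump_def flat_def)

lemma bump_scaled_tendsto: "(\<lambda>n. bump (real n * x)) \<longlonglongrightarrow> (if x > 0 then 1 else 0)"
proof (cases "x > 0")
  case True
  have "(\<lambda>n. exp (- (inverse x * inverse (real n)))) \<longlonglongrightarrow> exp (- (inverse x * 0))"
    by (intro tendsto_intros lim_inverse_n)
  moreover have "\<forall>\<^sub>F n in sequentially. exp (- (inverse x * inverse (real n))) = bump (real n * x)"
    using eventually_gt_at_top[of 0] by eventually_elim (use True in \<open>auto simp: bump_def flat_def field_simps\<close>)
  ultimately show ?thesis using True by (simp add: Lim_transform_eventually)
next
  case False
  then have "bump (real n * x) = 0" for n by (intro bump_bounds) (simp add: mult_nonneg_nonpos)
  then show ?thesis using False by simp
qed

section \<open>Periodic functions and integration over the torus\<close>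

lemma space_torus [simp]: "space torus = torus_cell" by (simp add: torus_def)

lemma torus_cell_lmeasurable [simp]: "torus_cell \<in> lmeasurable" by (simp add: torus_cell_def)

lemma torus_cell_sets [simp]: "torus_cell \<in> sets lebesgue"
  by (rule fmeasurableD[OF torus_cell_lmeasurable])

lemma finite_measure_torus: "finite_measure torus"
  by (simp add: torus_def finite_measure_lebesgue_on)

lemma integrable_torus_const [simp]: "integrable torus (\<lambda>x. c :: 'b::euclidean_space)"
  by (rule finite_measure.integrable_const[OF finite_measure_torus])

lemma integrable_torus_continuous:
  fixes f :: "real^3 \<Rightarrow> 'b::euclidean_space"
  shows "continuous_on UNIV f \<Longrightarrow> integrable torus f"
  unfolding torus_def torus_cell_def
  by (rule continuous_imp_integrable) (erule continuous_on_subset, rule subset_UNIV)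

lemma LINT_torus_eq_integral:
  fixes f :: "real^3 \<Rightarrow> 'b::euclidean_space"
  shows "integrable torus f \<Longrightarrow> (LINT x|torus. f x) = integral torus_cell f"
  unfolding torus_def by (rule lebesgue_integral_eq_integral[OF _ torus_cell_sets])

lemma vec3_sum_axis: "(z::real^3) = axis 1 (z$1) + axis 2 (z$2) + axis 3 (z$3)"
  by (simp add: vec_eq_iff axis_def forall_3)

lemma periodic_axis_int:
  assumes "torus_periodic f"
  shows "f (x + axis i (2 * pi * of_int k)) = f x"
proof (induction k arbitrary: x rule: int_induct[of _ 0])
  case base
  have "x + axis i (2 * pi * of_int 0) = x" by (simp add: vec_eq_iff axis_def)
  then show ?case by (simp only:)
next
  case (step1 k)
  have "x + axis i (2 * pi * of_int (k + 1)) = (x + axis i (2 * pi * of_int k)) + axis i (2 * pi)"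
    by (simp add: vec_eq_iff axis_def algebra_simps)
  then show ?case using assms step1(2) unfolding torus_periodic_def by metis
next
  case (step2 k)
  have "x + axis i (2 * pi * of_int (k - 1)) + axis i (2 * pi) = (x + axis i (2 * pi * of_int k))"
    by (simp add: vec_eq_iff axis_def algebra_simps)
  then show ?case using assms step2(2) unfolding torus_periodic_def by metis
qed

lemma periodic_lattice:
  assumes "torus_periodic f"
  shows "f (x + (\<chi> i. 2 * pi * of_int (k i))) = f x"
proof -
  have "x + (\<chi> i. 2 * pi * of_int (k i)) =
      x + axis 1 (2 * pi * of_int (k 1)) + axis 2 (2 * pi * of_int (k 2)) + axis 3 (2 * pi * of_int (k 3))"
    by (simp add: vec_eq_iff axis_def forall_3)
  then show ?thesis by (simp only: periodic_axis_int[OF assms])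
qed

lemma periodic_bounded:
  fixes f :: "real^3 \<Rightarrow> 'b::real_normed_vector"
  assumes "torus_periodic f" "continuous_on UNIV f"
  obtains B where "B > 0" "\<And>x. norm (f x) \<le> B"
proof -
  have "compact (f ` torus_cell)"
    unfolding torus_cell_def
    by (rule compact_continuous_image[OF continuous_on_subset[OF assms(2)] compact_cbox]) simp
  then have "bounded (f ` torus_cell)" by (rule compact_imp_bounded)
  then obtain B where B: "B > 0" "\<And>x. x \<in> torus_cell \<Longrightarrow> norm (f x) \<le> B"
    unfolding bounded_pos by auto
  have "norm (f x) \<le> B" for x
  proof -
    define k where "k i = - \<lfloor>x $ i / (2 * pi)\<rfloor>" for i
    define y where "y = x + (\<chi> i. 2 * pi * of_int (k i))"
    have "0 \<le> y $ i \<and> y $ i \<le> 2 * pi" for i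
    proof -
      have "y $ i = 2 * pi * frac (x $ i / (2 * pi))"
        by (simp add: y_def k_def frac_def algebra_simps)
      then show ?thesis using frac_ge_0[of "x $ i / (2 * pi)"] frac_lt_1[of "x $ i / (2 * pi)"]
        by (simp add: mult_left_le less_imp_le)
    qed
    then have "y \<in> torus_cell" by (simp add: torus_cell_def mem_box_cart)
    then show ?thesis using B periodic_lattice[OF assms(1), of x k] by (metis y_def)
  qed
  then show ?thesis using that B by blast
qed

text \<open>
  The shifted cell is cut along the face \<open>x $ i = 2 * pi\<close>; the part beyond the face is moved back
  by one period, where it fills the gap left by the shift.
\<close>

lemma integral_torus_axis_shift:
  fixes f :: "real^3 \<Rightarrow> real"
  assumes "torus_periodic f" and c: "continuous_on UNIV f" and s: "0 \<le> s" "s \<le> 2 * pi"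
  shows "integral torus_cell (\<lambda>x. f (x + axis i s)) = integral torus_cell f"
proof -
  define e :: "real^3" where "e = axis i 1"
  define w :: "real^3" where "w = (\<chi> i. 2 * pi)"
  have e: "e \<in> Basis" by (simp add: e_def)
  have xe: "x \<bullet> e = x $ i" for x by (simp add: e_def inner_axis)
  define C1 where "C1 = cbox 0 w \<inter> {x. x \<bullet> e \<le> s}"
  define C2 where "C2 = cbox 0 w \<inter> {x. x \<bullet> e \<ge> s}"
  define D1 where "D1 = cbox 0 w \<inter> {x. x \<bullet> e \<le> 2 * pi - s}"
  define D2 where "D2 = cbox 0 w \<inter> {x. x \<bullet> e \<ge> 2 * pi - s}"
  have w: "w $ j = 2 * pi" for j by (simp add: w_def)
  have "cbox 0 w \<inter> {x. x $ i \<le> c} = cbox 0 (w - axis i (2 * pi - c))" if "c \<le> 2 * pi" for c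
  proof -
    have "(\<chi> j. if j = i then min (w $ i) c else w $ j) = w - axis i (2 * pi - c)"
      using that by (simp add: vec_eq_iff w axis_def)
    then show ?thesis using interval_split_cart(1)[of 0 w i c] by (simp add: interval_cbox_cart)
  qed
  from this[of s] this[of "2 * pi - s"]
  have C1: "C1 = cbox 0 (w - axis i (2 * pi - s))"
    and D1: "D1 = cbox (axis i s - axis i s) (w - axis i s)"
    using s by (simp_all add: C1_def D1_def xe)
  have "cbox 0 w \<inter> {x. x $ i \<ge> c} = cbox (axis i c) w" if "0 \<le> c" for c
  proof -
    have "(\<chi> j. if j = i then max ((0::real^3) $ i) c else (0::real^3) $ j) = axis i c"
      using that by (simp add: vec_eq_iff axis_def)
    then show ?thesis using interval_split_cart(2)[where a = 0 and b = w and k = i and c = c] by (simp add: interval_cbox_cart)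
  qed
  from this[of s] this[of "2 * pi - s"]
  have C2: "C2 = cbox (axis i s) w"
    and D2: "D2 = cbox (0 + axis i (2 * pi - s)) ((w - axis i (2 * pi - s)) + axis i (2 * pi - s))"
    using s by (simp_all add: C2_def D2_def xe)
  have int: "(f has_integral (integral (cbox a b) f)) (cbox a b)" for a b
    by (rule integrable_integral[OF integrable_continuous[OF continuous_on_subset[OF c]]]) simp
  have whole: "(f has_integral (integral C1 f + integral C2 f)) (cbox 0 w)"
    by (rule has_integral_split[OF _ _ e, of _ _ _ _ s]) (use int C1 C2 in \<open>simp_all add: C1_def C2_def\<close>)
  have "((f \<circ> (+) (axis i s)) has_integral integral C2 f) D1"
  proof -
    have "(f has_integral integral C2 f) (cbox ((axis i s - axis i s) + axis i s) ((w - axis i s) + axis i s))"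
      using int[of "axis i s" w] C2 by simp
    then show ?thesis unfolding D1 by (simp only: has_integral_shift_cbox_iff)
  qed
  then have h1: "((\<lambda>x. f (x + axis i s)) has_integral integral C2 f) D1"
    by (simp add: o_def add.commute)
  have h2: "((\<lambda>x. f (x + axis i s)) has_integral integral C1 f) D2"
  proof -
    have eq: "f (axis i (2 * pi - s) + x + axis i s) = f x" for x
    proof -
      have "axis i (2 * pi - s) + x + axis i s = x + axis i (2 * pi)"
        by (simp add: vec_eq_iff axis_def)
      then show ?thesis using assms(1) unfolding torus_periodic_def by metis
    qed
    have "(((\<lambda>x. f (x + axis i s)) \<circ> (+) (axis i (2 * pi - s))) has_integral integral C1 f)
        (cbox 0 (w - axis i (2 * pi - s)))"
      using int[of 0 "w - axis i (2 * pi - s)"] C1 by (simp add: o_def eq)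
    then show ?thesis unfolding D2 by (simp only: has_integral_shift_cbox_iff)
  qed
  have "((\<lambda>x. f (x + axis i s)) has_integral (integral C2 f + integral C1 f)) (cbox 0 w)"
    by (rule has_integral_split[OF _ _ e, of _ _ _ _ "2 * pi - s"])
       (use h1 h2 in \<open>simp_all add: D1_def D2_def\<close>)
  then show ?thesis using whole
    unfolding torus_cell_def w_def[symmetric] by (simp add: integral_unique add.commute)
qed

lemma periodic_shift: "torus_periodic f \<Longrightarrow> torus_periodic (\<lambda>x. f (x + a))"
proof -
  have "x + axis i (2 * pi) + a = (x + a) + axis i (2 * pi)" for x i by (simp add: add_ac)
  then show "torus_periodic f \<Longrightarrow> torus_periodic (\<lambda>x. f (x + a))" by (simp only: torus_periodic_def) blast
qed

lemma continuous_shift: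
  fixes f :: "real^3 \<Rightarrow> 'b::topological_space"
  shows "continuous_on UNIV f \<Longrightarrow> continuous_on UNIV (\<lambda>x. f (x + a))"
  by (rule continuous_on_compose2[of UNIV f]) (auto intro: continuous_intros)

text \<open>Periodicity reduces an arbitrary shift to one by less than a period.\<close>

lemma integral_torus_axis_shift_any:
  fixes f :: "real^3 \<Rightarrow> real"
  assumes p: "torus_periodic f" and c: "continuous_on UNIV f"
  shows "integral torus_cell (\<lambda>x. f (x + axis i s)) = integral torus_cell f"
proof -
  define t where "t = 2 * pi * frac (s / (2 * pi))"
  have t: "0 \<le> t" "t \<le> 2 * pi"
    using frac_ge_0[of "s / (2 * pi)"] frac_lt_1[of "s / (2 * pi)"]
    by (simp_all add: t_def mult_left_le less_imp_le)
  have "axis i s = axis i t + axis i (2 * pi * of_int \<lfloor>s / (2 * pi)\<rfloor>)"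
    by (simp add: vec_eq_iff axis_def t_def frac_def algebra_simps)
  then have "f (x + axis i s) = f (x + axis i t)" for x
    using periodic_axis_int[OF p, of "x + axis i t" i] by (simp add: add.assoc)
  then show ?thesis using integral_torus_axis_shift[OF p c t] by simp
qed

lemma LINT_torus_shift:
  fixes f :: "real^3 \<Rightarrow> real"
  assumes p: "torus_periodic f" and c: "continuous_on UNIV f"
  shows "(LINT x|torus. f (x + a)) = (LINT x|torus. f x)"
proof -
  have "integral torus_cell (\<lambda>x. f (x + axis 1 (a$1) + axis 2 (a$2) + axis 3 (a$3))) = integral torus_cell f"
  proof -
    have c1: "continuous_on UNIV (\<lambda>x. f (x + axis 3 (a$3)))" by (rule continuous_shift[OF c])
    have p1: "torus_periodic (\<lambda>x. f (x + axis 3 (a$3)))" by (rule periodic_shift[OF p])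
    have c2: "continuous_on UNIV (\<lambda>x. f (x + axis 2 (a$2) + axis 3 (a$3)))" by (rule continuous_shift[OF c1])
    have p2: "torus_periodic (\<lambda>x. f (x + axis 2 (a$2) + axis 3 (a$3)))" by (rule periodic_shift[OF p1])
    show ?thesis
      by (simp only: integral_torus_axis_shift_any[OF p2 c2] integral_torus_axis_shift_any[OF p1 c1]
          integral_torus_axis_shift_any[OF p c])
  qed
  then have "integral torus_cell (\<lambda>x. f (x + a)) = integral torus_cell f"
    by (subst vec3_sum_axis[of a]) (simp add: add.assoc)
  then show ?thesis
    by (simp add: LINT_torus_eq_integral integrable_torus_continuous c continuous_shift)
qed

section \<open>Smooth periodic functions\<close>

definition smooth_periodic :: "(real^3 \<Rightarrow> 'b::real_normed_vector) \<Rightarrow> bool" where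
  "smooth_periodic f \<longleftrightarrow> smooth_on UNIV f \<and> torus_periodic f"

lemma smooth_periodicD:
  assumes "smooth_periodic f"
  shows "smooth_on UNIV f" "torus_periodic f" "continuous_on UNIV f"
  using assms smooth_on_continuous by (auto simp: smooth_periodic_def)

lemma smooth_periodic_const: "smooth_periodic (\<lambda>x. c)"
  by (simp add: smooth_periodic_def smooth_on_const torus_periodic_def)

lemma smooth_periodic_add:
  "smooth_periodic f \<Longrightarrow> smooth_periodic g \<Longrightarrow> smooth_periodic (\<lambda>x. f x + g x)"
  by (simp add: smooth_periodic_def smooth_on_add torus_periodic_def)

lemma smooth_periodic_diff:
  "smooth_periodic f \<Longrightarrow> smooth_periodic g \<Longrightarrow> smooth_periodic (\<lambda>x. f x - g x)"
  by (simp add: smooth_periodic_def smooth_on_diff torus_periodic_def)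

lemma smooth_periodic_scaleR:
  fixes f :: "real^3 \<Rightarrow> real"
  shows "smooth_periodic f \<Longrightarrow> smooth_periodic g \<Longrightarrow> smooth_periodic (\<lambda>x. f x *\<^sub>R g x)"
  by (simp add: smooth_periodic_def smooth_on_scaleR torus_periodic_def)

lemma smooth_periodic_mult:
  fixes f :: "real^3 \<Rightarrow> real"
  shows "smooth_periodic f \<Longrightarrow> smooth_periodic g \<Longrightarrow> smooth_periodic (\<lambda>x. f x * g x)"
  by (simp add: smooth_periodic_def smooth_on_mult torus_periodic_def)

lemma smooth_periodic_bounded_linear:
  "bounded_linear L \<Longrightarrow> smooth_periodic f \<Longrightarrow> smooth_periodic (\<lambda>x. L (f x))"
  by (simp add: smooth_periodic_def smooth_on_bounded_linear torus_periodic_def)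

lemma smooth_periodic_component:
  fixes f :: "real^3 \<Rightarrow> real^'n"
  shows "smooth_periodic f \<Longrightarrow> smooth_periodic (\<lambda>x. f x $ i)"
  by (rule smooth_periodic_bounded_linear[OF bounded_linear_vec_nth])

lemma smooth_periodic_sum:
  "(\<And>i. i \<in> I \<Longrightarrow> smooth_periodic (f i)) \<Longrightarrow> smooth_periodic (\<lambda>x. \<Sum>i\<in>I. f i x)"
  by (simp add: smooth_periodic_def smooth_on_sum torus_periodic_def)

lemma smooth_periodic_prod:
  fixes f :: "'i \<Rightarrow> real^3 \<Rightarrow> real"
  shows "(\<And>i. i \<in> I \<Longrightarrow> smooth_periodic (f i)) \<Longrightarrow> smooth_periodic (\<lambda>x. \<Prod>i\<in>I. f i x)"
  by (simp add: smooth_periodic_def smooth_on_prod torus_periodic_def)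

lemma smooth_periodic_coordinate_trig:
  "smooth_periodic (\<lambda>x::real^3. cos (x $ i))" "smooth_periodic (\<lambda>x::real^3. sin (x $ i))"
  unfolding smooth_periodic_def torus_periodic_def
  by (auto simp: smooth_on_trig smooth_on_linear bounded_linear_vec_nth axis_def)

text \<open>A vector field is the sum of its components times the coordinate vectors.\<close>

lemma smooth_periodic_vecI:
  fixes f :: "real^3 \<Rightarrow> real^3"
  assumes "\<And>i. smooth_periodic (\<lambda>x. f x $ i)"
  shows "smooth_periodic f"
proof -
  have "f = (\<lambda>x. \<Sum>i\<in>UNIV. (f x $ i) *\<^sub>R axis i 1)"
    by (simp add: fun_eq_iff vec_eq_iff axis_def if_distrib cong: if_cong)
  moreover have "smooth_periodic (\<lambda>x. \<Sum>i\<in>UNIV. (f x $ i) *\<^sub>R axis i (1::real) :: real^3)"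
    by (intro smooth_periodic_sum smooth_periodic_scaleR assms smooth_periodic_const)
  ultimately show ?thesis by simp
qed

lemma partial_d_eqI:
  "(f has_derivative D) (at x) \<Longrightarrow> partial_d j f x = D (axis j 1)"
  unfolding partial_d_def using frechet_derivative_at by metis

lemma smooth_periodic_derivative:
  fixes f :: "real^3 \<Rightarrow> 'b::real_normed_vector"
  assumes "smooth_periodic f"
  shows "(f has_derivative (\<lambda>h. \<Sum>j\<in>UNIV. (h $ j) *\<^sub>R partial_d j f x)) (at x)"
    and "smooth_periodic (partial_d j f)"
proof -
  have D: "\<exists>f'. (\<forall>x. (f has_derivative f' x) (at x)) \<and> (\<forall>b\<in>Basis. Ck_on k UNIV (\<lambda>x. f' x b))" for k
    using assms unfolding smooth_periodic_def smooth_on_def by (metis Ck_on.simps(2) UNIV_I)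
  then obtain f' where f': "\<And>x. (f has_derivative f' x) (at x)" by blast
  have pd: "partial_d j f x = f' x (axis j 1)" for x j
    by (rule partial_d_eqI[OF f'])
  have "f' x h = (\<Sum>j\<in>UNIV. (h $ j) *\<^sub>R partial_d j f x)" for h x
  proof -
    interpret bounded_linear "f' x" using f' by (rule has_derivative_bounded_linear)
    have "h = (\<Sum>j\<in>UNIV. (h $ j) *\<^sub>R axis j 1)"
      by (simp add: vec_eq_iff axis_def if_distrib cong: if_cong)
    then have "f' x h = f' x (\<Sum>j\<in>UNIV. (h $ j) *\<^sub>R axis j 1)" by simp
    then show ?thesis by (simp add: sum scaleR pd)
  qed
  then have "f' x = (\<lambda>h. \<Sum>j\<in>UNIV. (h $ j) *\<^sub>R partial_d j f x)" for x by blast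
  then show "(f has_derivative (\<lambda>h. \<Sum>j\<in>UNIV. (h $ j) *\<^sub>R partial_d j f x)) (at x)"
    using f'[of x] by simp
  have "Ck_on k UNIV (partial_d j f)" for k
  proof -
    obtain g' where g': "\<And>x. (f has_derivative g' x) (at x)" "\<And>b. b \<in> Basis \<Longrightarrow> Ck_on k UNIV (\<lambda>x. g' x b)"
      using D by blast
    have "partial_d j f = (\<lambda>x. g' x (axis j 1))" using partial_d_eqI[OF g'(1)] by blast
    then show ?thesis using g'(2) by simp
  qed
  moreover have "partial_d j f (x + axis i (2 * pi)) = partial_d j f x" for x i
  proof -
    have "((\<lambda>y. f (y + axis i (2 * pi))) has_derivative f' (x + axis i (2 * pi))) (at x)"
      by (rule has_derivative_compose[where f = "\<lambda>y. y + axis i (2 * pi)" and f' = "\<lambda>h. h", OF _ f'])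
         (auto intro!: derivative_eq_intros)
    then have "(f has_derivative f' (x + axis i (2 * pi))) (at x)"
      using assms by (simp add: smooth_periodic_def torus_periodic_def)
    then show ?thesis using partial_d_eqI pd by metis
  qed
  ultimately show "smooth_periodic (partial_d j f)"
    by (simp add: smooth_periodic_def smooth_on_def torus_periodic_def)
qed

lemma sum_axis_scaleR: "(\<Sum>i\<in>UNIV. (axis j 1 $ i) *\<^sub>R g i) = (g (j::3) :: 'b::real_normed_vector)"
proof -
  have "(axis j 1 $ i) *\<^sub>R g i = (if i = j then g i else 0)" for i by (simp add: axis_def)
  then show ?thesis by simp
qed

lemma partial_d_simps:
  fixes f g :: "real^3 \<Rightarrow> 'b::real_normed_vector" and a b :: "real^3 \<Rightarrow> real"
  shows "smooth_periodic f \<Longrightarrow> smooth_periodic g \<Longrightarrow>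
      partial_d j (\<lambda>x. f x + g x) x = partial_d j f x + partial_d j g x"
    and "smooth_periodic f \<Longrightarrow> smooth_periodic g \<Longrightarrow>
      partial_d j (\<lambda>x. f x - g x) x = partial_d j f x - partial_d j g x"
    and "smooth_periodic a \<Longrightarrow> smooth_periodic f \<Longrightarrow>
      partial_d j (\<lambda>x. a x *\<^sub>R f x) x = a x *\<^sub>R partial_d j f x + partial_d j a x *\<^sub>R f x"
    and "smooth_periodic a \<Longrightarrow> smooth_periodic b \<Longrightarrow>
      partial_d j (\<lambda>x. a x * b x) x = a x * partial_d j b x + partial_d j a x * b x"
    and "partial_d j (\<lambda>x. c) x = 0"
    and "bounded_linear L \<Longrightarrow> smooth_periodic f \<Longrightarrow> partial_d j (\<lambda>x. L (f x)) x = L (partial_d j f x)"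
proof -
  note ax = sum_axis_scaleR
  note d = smooth_periodic_derivative(1)
  show "smooth_periodic f \<Longrightarrow> smooth_periodic g \<Longrightarrow>
      partial_d j (\<lambda>x. f x + g x) x = partial_d j f x + partial_d j g x"
    using partial_d_eqI[OF has_derivative_add[OF d d], of f g j x] by (simp only: ax)
  show "smooth_periodic f \<Longrightarrow> smooth_periodic g \<Longrightarrow>
      partial_d j (\<lambda>x. f x - g x) x = partial_d j f x - partial_d j g x"
    using partial_d_eqI[OF has_derivative_diff[OF d d], of f g j x] by (simp only: ax)
  show "smooth_periodic a \<Longrightarrow> smooth_periodic f \<Longrightarrow>
      partial_d j (\<lambda>x. a x *\<^sub>R f x) x = a x *\<^sub>R partial_d j f x + partial_d j a x *\<^sub>R f x"
    using partial_d_eqI[OF has_derivative_scaleR[OF d d], of a f j x] by (simp only: ax)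
  show "smooth_periodic a \<Longrightarrow> smooth_periodic b \<Longrightarrow>
      partial_d j (\<lambda>x. a x * b x) x = a x * partial_d j b x + partial_d j a x * b x"
    using partial_d_eqI[OF has_derivative_mult[OF d d], of a b j x] by (simp only: ax)
  show "partial_d j (\<lambda>x. c) x = 0"
    using partial_d_eqI[OF has_derivative_const] .
  show "bounded_linear L \<Longrightarrow> smooth_periodic f \<Longrightarrow> partial_d j (\<lambda>x. L (f x)) x = L (partial_d j f x)"
    using partial_d_eqI[OF bounded_linear.has_derivative[OF _ d], of L f j x] by (simp only: ax)
qed

lemma partial_d_component:
  fixes f :: "real^3 \<Rightarrow> real^'n"
  shows "smooth_periodic f \<Longrightarrow> partial_d j (\<lambda>x. f x $ i) x = partial_d j f x $ i"
  by (rule partial_d_simps(6)[OF bounded_linear_vec_nth])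

lemma partial_d_sum:
  fixes f :: "'i \<Rightarrow> real^3 \<Rightarrow> 'b::real_normed_vector"
  assumes "\<And>i. i \<in> I \<Longrightarrow> smooth_periodic (f i)"
  shows "partial_d j (\<lambda>x. \<Sum>i\<in>I. f i x) x = (\<Sum>i\<in>I. partial_d j (f i) x)"
  using assms
proof (induction I rule: infinite_finite_induct)
  case (insert i I)
  then show ?case
    using partial_d_simps(1)[of "f i" "\<lambda>x. \<Sum>i\<in>I. f i x" j x] smooth_periodic_sum[of I f] by simp
qed (simp_all add: partial_d_simps(5))

lemma smooth_periodic_line_derivative:
  fixes f :: "real^3 \<Rightarrow> real"
  assumes "smooth_periodic f"
  shows "((\<lambda>s. f (x + s *\<^sub>R z)) has_real_derivative (\<Sum>j\<in>UNIV. z $ j * partial_d j f (x + s *\<^sub>R z))) (at s within A)"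
proof -
  have "((\<lambda>s. f (x + s *\<^sub>R z)) has_derivative (\<lambda>h. \<Sum>j\<in>UNIV. ((h *\<^sub>R z) $ j) *\<^sub>R partial_d j f (x + s *\<^sub>R z))) (at s within A)"
    by (rule has_derivative_compose[where f = "\<lambda>s. x + s *\<^sub>R z" and f' = "\<lambda>h. h *\<^sub>R z",
          OF _ smooth_periodic_derivative(1)[OF assms]])
       (auto intro!: derivative_eq_intros)
  moreover have "(\<lambda>h. \<Sum>j\<in>UNIV. ((h *\<^sub>R z) $ j) *\<^sub>R partial_d j f (x + s *\<^sub>R z)) =
      (*) (\<Sum>j\<in>UNIV. z $ j * partial_d j f (x + s *\<^sub>R z))"
    by (simp add: fun_eq_iff sum_distrib_left sum_distrib_right mult_ac)
  ultimately show ?thesis by (simp add: has_field_derivative_def)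
qed

text \<open>
  By translation invariance the integral of \<open>f (x + s *\<^sub>R axis j 1)\<close> over the torus does not depend
  on \<open>s\<close>; its derivative at \<open>s = 0\<close> is the integral of the partial derivative.
\<close>

lemma LINT_torus_partial_d:
  fixes f :: "real^3 \<Rightarrow> real"
  assumes f: "smooth_periodic f"
  shows "(LINT x|torus. partial_d j f x) = 0"
proof -
  note pd = smooth_periodic_derivative(2)[OF f, of j]
  have ax: "(\<Sum>i\<in>UNIV. axis j 1 $ i * g i) = g j" for g :: "3 \<Rightarrow> real"
    by (simp add: axis_def if_distrib[of "\<lambda>c. c * _"] cong: if_cong)
  have "((\<lambda>s. integral (cbox 0 (\<chi> i. 2 * pi)) (\<lambda>x. f (x + s *\<^sub>R axis j 1))) has_field_derivative
      integral (cbox 0 (\<chi> i. 2 * pi)) (\<lambda>x. partial_d j f (x + 0 *\<^sub>R axis j 1))) (at 0 within UNIV)"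
  proof (rule leibniz_rule_field_derivative[where fx = "\<lambda>s x. partial_d j f (x + s *\<^sub>R axis j 1)"])
    show "((\<lambda>s. f (x + s *\<^sub>R axis j 1)) has_real_derivative partial_d j f (x + s *\<^sub>R axis j 1)) (at s within UNIV)" for s x
      using smooth_periodic_line_derivative[OF f, of x "axis j 1" s UNIV] by (simp only: ax)
    show "(\<lambda>x. f (x + s *\<^sub>R axis j 1)) integrable_on cbox 0 (\<chi> i. 2 * pi)" for s
      by (rule integrable_continuous, rule continuous_on_subset[OF continuous_shift[OF smooth_periodicD(3)[OF f]]]) simp
    show "continuous_on (UNIV \<times> cbox 0 (\<chi> i. 2 * pi)) (\<lambda>(s, x). partial_d j f (x + s *\<^sub>R axis j 1))"
      unfolding case_prod_beta
      by (rule continuous_on_compose2[OF smooth_periodicD(3)[OF pd]]) (auto intro!: continuous_intros)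
  qed auto
  moreover have "integral (cbox 0 (\<chi> i. 2 * pi)) (\<lambda>x. f (x + s *\<^sub>R axis j 1)) = integral torus_cell f" for s
  proof -
    have "s *\<^sub>R axis j 1 = (axis j s :: real^3)" by (simp add: vec_eq_iff axis_def)
    then show ?thesis using integral_torus_axis_shift_any[OF smooth_periodicD(2,3)[OF f], of j s]
      by (simp add: torus_cell_def)
  qed
  ultimately have "((\<lambda>s::real. integral torus_cell f) has_field_derivative integral torus_cell (partial_d j f)) (at 0)"
    by (simp add: torus_cell_def)
  then have "integral torus_cell (partial_d j f) = 0" using DERIV_const DERIV_unique by blast
  then show ?thesis
    by (simp add: LINT_torus_eq_integral integrable_torus_continuous smooth_periodicD(3)[OF pd])
qed

lemma integrable_smooth_periodic:
  fixes f :: "real^3 \<Rightarrow> 'b::euclidean_space"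
  shows "smooth_periodic f \<Longrightarrow> integrable torus f"
  by (rule integrable_torus_continuous[OF smooth_periodicD(3)])

lemma torus_integration_by_parts:
  fixes f g :: "real^3 \<Rightarrow> real"
  assumes f: "smooth_periodic f" and g: "smooth_periodic g"
  shows "(LINT x|torus. f x * partial_d j g x) = - (LINT x|torus. partial_d j f x * g x)"
proof -
  note d = smooth_periodic_derivative(2)
  have "0 = (LINT x|torus. f x * partial_d j g x + partial_d j f x * g x)"
    using LINT_torus_partial_d[OF smooth_periodic_mult[OF f g], of j] by (simp add: partial_d_simps(4) f g)
  also have "\<dots> = (LINT x|torus. f x * partial_d j g x) + (LINT x|torus. partial_d j f x * g x)"
    by (rule Bochner_Integration.integral_add)
       (rule integrable_smooth_periodic smooth_periodic_mult f g d)+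
  finally show ?thesis by simp
qed

section \<open>The Hilbert space of square integrable fields\<close>

text \<open>The inner product of \<open>L2\<close>, on representatives; it is only semidefinite.\<close>

definition ip :: "(real^3 \<Rightarrow> 'b::euclidean_space) \<Rightarrow> (real^3 \<Rightarrow> 'b) \<Rightarrow> real" where
  "ip f g = (LINT x|torus. f x \<bullet> g x)"

abbreviation L2 :: "(real^3 \<Rightarrow> 'b::euclidean_space) set" where "L2 \<equiv> Lp_torus 2"

lemma norm_powr_two: "norm (y::'b::real_normed_vector) powr 2 = (norm y)\<^sup>2"
  by (cases "norm y = 0") simp_all

lemma L2_iff:
  "f \<in> L2 \<longleftrightarrow> torus_periodic f \<and> f \<in> borel_measurable torus \<and> integrable torus (\<lambda>x. (norm (f x))\<^sup>2)"
  by (simp only: Lp_torus_def norm_powr_two mem_Collect_eq)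

lemma ip_self_eq: "ip f f = (LINT x|torus. (norm (f x))\<^sup>2)"
  by (simp add: ip_def power2_norm_eq_inner)

lemma ip_self_nonneg: "0 \<le> ip f f" by (simp add: ip_def)

lemma Lp_norm_2: "Lp_norm 2 f = sqrt (ip f f)"
  unfolding Lp_norm_def norm_powr_two ip_self_eq by (rule powr_half_sqrt) simp

lemma Lp_norm_2_squared: "(Lp_norm 2 f)\<^sup>2 = ip f f"
  by (simp add: Lp_norm_2 ip_self_nonneg)

lemma Lp_norm_2_nonneg: "0 \<le> Lp_norm 2 f"
  by (simp add: Lp_norm_2 ip_self_nonneg)

lemma smooth_periodic_L2: "smooth_periodic (f :: real^3 \<Rightarrow> 'b::euclidean_space) \<Longrightarrow> f \<in> L2"
  unfolding L2_iff
  by (intro conjI integrable_torus_continuous continuous_intros smooth_periodicD(3))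
     (auto dest: smooth_periodicD(2) borel_measurable_integrable[OF integrable_smooth_periodic])

lemma L2D:
  assumes "f \<in> L2"
  shows "torus_periodic f" "f \<in> borel_measurable torus" "integrable torus (\<lambda>x. (norm (f x))\<^sup>2)"
  using assms by (auto simp: L2_iff)

lemma L2_inner_integrable:
  assumes "f \<in> L2" "g \<in> L2"
  shows "integrable torus (\<lambda>x. f x \<bullet> g x)"
proof (rule Bochner_Integration.integrable_bound)
  show "integrable torus (\<lambda>x. (norm (f x))\<^sup>2 + (norm (g x))\<^sup>2)"
    by (rule Bochner_Integration.integrable_add) (rule L2D(3) assms)+
  show "(\<lambda>x. f x \<bullet> g x) \<in> borel_measurable torus"
    by (rule borel_measurable_inner) (rule L2D(2) assms)+
  show "AE x in torus. norm (f x \<bullet> g x) \<le> norm ((norm (f x))\<^sup>2 + (norm (g x))\<^sup>2)"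
  proof (rule AE_I2)
    fix x
    have "\<bar>f x \<bullet> g x\<bar> \<le> norm (f x) * norm (g x)" by (rule Cauchy_Schwarz_ineq2)
    also have "\<dots> \<le> (norm (f x))\<^sup>2 + (norm (g x))\<^sup>2"
      using sum_squares_bound[of "norm (f x)" "norm (g x)"]
        mult_nonneg_nonneg[OF norm_ge_zero norm_ge_zero, of "f x" "g x"] by linarith
    finally show "norm (f x \<bullet> g x) \<le> norm ((norm (f x))\<^sup>2 + (norm (g x))\<^sup>2)" by simp
  qed
qed

lemma L2_linear:
  assumes "f \<in> L2" "g \<in> L2"
  shows "(\<lambda>x. a *\<^sub>R f x + b *\<^sub>R g x) \<in> L2"
  unfolding L2_iff
proof (intro conjI)
  note [measurable] = L2D(2)[OF assms(1)] L2D(2)[OF assms(2)]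
  show "torus_periodic (\<lambda>x. a *\<^sub>R f x + b *\<^sub>R g x)"
    using L2D(1)[OF assms(1)] L2D(1)[OF assms(2)] by (simp add: torus_periodic_def)
  show "(\<lambda>x. a *\<^sub>R f x + b *\<^sub>R g x) \<in> borel_measurable torus" by measurable
  have "integrable torus (\<lambda>x. a\<^sup>2 * (norm (f x))\<^sup>2 + b\<^sup>2 * (norm (g x))\<^sup>2 + 2 * a * b * (f x \<bullet> g x))"
    by (intro Bochner_Integration.integrable_add integrable_mult_right L2D(3) assms L2_inner_integrable)
  moreover have "(norm (a *\<^sub>R f x + b *\<^sub>R g x))\<^sup>2 =
      a\<^sup>2 * (norm (f x))\<^sup>2 + b\<^sup>2 * (norm (g x))\<^sup>2 + 2 * a * b * (f x \<bullet> g x)" for x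
    unfolding power2_norm_eq_inner
    by (simp add: inner_add_left inner_add_right inner_commute[of "g x" "f x"] power2_eq_square algebra_simps)
  ultimately show "integrable torus (\<lambda>x. (norm (a *\<^sub>R f x + b *\<^sub>R g x))\<^sup>2)" by simp
qed

lemma L2_add: "f \<in> L2 \<Longrightarrow> g \<in> L2 \<Longrightarrow> (\<lambda>x. f x + g x) \<in> L2"
  using L2_linear[of f g 1 1] by simp

lemma L2_diff: "f \<in> L2 \<Longrightarrow> g \<in> L2 \<Longrightarrow> (\<lambda>x. f x - g x) \<in> L2"
  using L2_linear[of f g 1 "-1"] by simp

lemma ip_commute: "ip f g = ip g f" by (simp add: ip_def inner_commute)

lemma ip_linear_left:
  assumes "f \<in> L2" "g \<in> L2" "h \<in> L2"
  shows "ip (\<lambda>x. a *\<^sub>R f x + b *\<^sub>R g x) h = a * ip f h + b * ip g h"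
  using assms by (simp add: ip_def inner_add_left L2_inner_integrable)

lemma ip_diff_left:
  "f \<in> L2 \<Longrightarrow> g \<in> L2 \<Longrightarrow> h \<in> L2 \<Longrightarrow> ip (\<lambda>x. f x - g x) h = ip f h - ip g h"
  using ip_linear_left[of f g h 1 "-1"] by simp

lemma ip_linear_right:
  assumes "f \<in> L2" "g \<in> L2" "h \<in> L2"
  shows "ip h (\<lambda>x. a *\<^sub>R f x + b *\<^sub>R g x) = a * ip h f + b * ip h g"
  using ip_linear_left[OF assms] by (simp add: ip_commute)

lemma ip_diff_right:
  "f \<in> L2 \<Longrightarrow> g \<in> L2 \<Longrightarrow> h \<in> L2 \<Longrightarrow> ip h (\<lambda>x. f x - g x) = ip h f - ip h g"
  using ip_diff_left[of f g h] by (simp add: ip_commute)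

lemma ip_self_linear:
  assumes "f \<in> L2" "g \<in> L2"
  shows "ip (\<lambda>x. a *\<^sub>R f x + b *\<^sub>R g x) (\<lambda>x. a *\<^sub>R f x + b *\<^sub>R g x) =
    a\<^sup>2 * ip f f + 2 * a * b * ip f g + b\<^sup>2 * ip g g"
  using assms ip_commute[of g f]
  by (simp add: ip_linear_left ip_linear_right L2_linear power2_eq_square algebra_simps)

lemma nonneg_quadratic_imp_discriminant:
  fixes a b c :: real
  assumes q: "\<And>s. 0 \<le> a + 2 * b * s + c * s\<^sup>2" and "0 \<le> c"
  shows "b\<^sup>2 \<le> a * c"
proof (cases "c = 0")
  case True
  have "b = 0"
  proof (rule ccontr)
    assume "b \<noteq> 0"
    then have "a + 2 * b * (- (a + 1) / (2 * b)) = -1" by (simp add: field_simps)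
    with q[of "- (a + 1) / (2 * b)"] True show False by simp
  qed
  then show ?thesis using True by simp
next
  case False
  then have c: "c > 0" using assms(2) by simp
  have "a + 2 * b * (- b / c) + c * (- b / c)\<^sup>2 = a - b\<^sup>2 / c"
    using c by (simp add: field_simps power2_eq_square)
  with q[of "- b / c"] have "b\<^sup>2 / c \<le> a" by simp
  then show ?thesis using c by (simp add: field_simps)
qed

lemma ip_Cauchy_Schwarz:
  assumes "f \<in> L2" "g \<in> L2"
  shows "\<bar>ip f g\<bar> \<le> Lp_norm 2 f * Lp_norm 2 g"
proof -
  have "0 \<le> ip f f + 2 * ip f g * s + ip g g * s\<^sup>2" for s
    using ip_self_nonneg[of "\<lambda>x. 1 *\<^sub>R f x + s *\<^sub>R g x"] ip_self_linear[OF assms, of 1 s]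
    by (simp add: mult_ac)
  then have "(ip f g)\<^sup>2 \<le> ip f f * ip g g"
    using ip_self_nonneg by (rule nonneg_quadratic_imp_discriminant)
  then show ?thesis
    unfolding Lp_norm_2 real_sqrt_mult[symmetric] by (metis real_sqrt_abs real_sqrt_le_mono)
qed

lemma Lp_norm_2_triangle:
  assumes "f \<in> L2" "g \<in> L2"
  shows "Lp_norm 2 (\<lambda>x. f x + g x) \<le> Lp_norm 2 f + Lp_norm 2 g"
proof (rule power2_le_imp_le)
  have "(Lp_norm 2 (\<lambda>x. f x + g x))\<^sup>2 = ip f f + 2 * ip f g + ip g g"
    using ip_self_linear[OF assms, of 1 1] by (simp add: Lp_norm_2_squared)
  also have "\<dots> \<le> (Lp_norm 2 f + Lp_norm 2 g)\<^sup>2"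
    using ip_Cauchy_Schwarz[OF assms] by (simp add: power2_sum Lp_norm_2_squared)
  finally show "(Lp_norm 2 (\<lambda>x. f x + g x))\<^sup>2 \<le> (Lp_norm 2 f + Lp_norm 2 g)\<^sup>2" .
qed (simp add: Lp_norm_2_nonneg)

lemma Lp_norm_minus_commute: "Lp_norm p (\<lambda>x. f x - g x) = Lp_norm p (\<lambda>x. g x - f x)"
  by (simp add: Lp_norm_def norm_minus_commute)

lemma Lp_norm_2_triangle_diff:
  assumes "f \<in> L2" "g \<in> L2"
  shows "\<bar>Lp_norm 2 f - Lp_norm 2 g\<bar> \<le> Lp_norm 2 (\<lambda>x. f x - g x)"
  using Lp_norm_2_triangle[OF L2_diff[OF assms] assms(2)]
    Lp_norm_2_triangle[OF L2_diff[OF assms(2,1)] assms(1)] Lp_norm_minus_commute[of 2 f g]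
  by simp

definition L2_lim :: "(nat \<Rightarrow> real^3 \<Rightarrow> 'b::euclidean_space) \<Rightarrow> (real^3 \<Rightarrow> 'b) \<Rightarrow> bool" where
  "L2_lim F f \<longleftrightarrow> (\<forall>n. F n \<in> L2) \<and> f \<in> L2 \<and> (\<lambda>n. Lp_norm 2 (\<lambda>x. F n x - f x)) \<longlonglongrightarrow> 0"

lemma L2_lim_ip:
  assumes "L2_lim F f" "g \<in> L2"
  shows "(\<lambda>n. ip (F n) g) \<longlonglongrightarrow> ip f g"
proof -
  have "(\<lambda>n. ip (F n) g - ip f g) \<longlonglongrightarrow> 0"
  proof (rule Lim_null_comparison)
    show "\<forall>\<^sub>F n in sequentially. norm (ip (F n) g - ip f g) \<le> Lp_norm 2 (\<lambda>x. F n x - f x) * Lp_norm 2 g"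
      using assms ip_Cauchy_Schwarz[OF L2_diff assms(2)]
      by (simp add: L2_lim_def flip: ip_diff_left)
    show "(\<lambda>n. Lp_norm 2 (\<lambda>x. F n x - f x) * Lp_norm 2 g) \<longlonglongrightarrow> 0"
      using assms by (auto simp: L2_lim_def intro: tendsto_mult_left_zero)
  qed
  then show ?thesis by (simp add: LIM_zero_iff)
qed

lemma L2_lim_norm:
  assumes "L2_lim F f"
  shows "(\<lambda>n. Lp_norm 2 (F n)) \<longlonglongrightarrow> Lp_norm 2 f"
proof -
  have "(\<lambda>n. Lp_norm 2 (F n) - Lp_norm 2 f) \<longlonglongrightarrow> 0"
    by (rule Lim_null_comparison[of _ "\<lambda>n. Lp_norm 2 (\<lambda>x. F n x - f x)"])
       (use assms Lp_norm_2_triangle_diff[of "F _" f] in \<open>simp_all add: L2_lim_def always_eventually\<close>)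
  then show ?thesis by (simp add: LIM_zero_iff)
qed

lemma L2_integrable:
  assumes "f \<in> L2" shows "integrable torus f"
proof (rule Bochner_Integration.integrable_bound)
  show "integrable torus (\<lambda>x. 1 + (norm (f x))\<^sup>2)"
    by (rule Bochner_Integration.integrable_add[OF integrable_torus_const L2D(3)[OF assms]])
  show "f \<in> borel_measurable torus" using assms by (rule L2D(2))
  show "AE x in torus. norm (f x) \<le> norm (1 + (norm (f x))\<^sup>2)"
  proof (rule AE_I2)
    fix x
    have "norm (f x) * 2 \<le> 1 + (norm (f x))\<^sup>2" using sum_squares_bound[of 1 "norm (f x)"] by simp
    then have "norm (f x) \<le> 1 + (norm (f x))\<^sup>2" using norm_ge_zero[of "f x"] by linarith
    then show "norm (f x) \<le> norm (1 + (norm (f x))\<^sup>2)" by simp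
  qed
qed

lemma L2_norm: "f \<in> L2 \<Longrightarrow> (\<lambda>x. norm (f x)) \<in> L2"
  by (auto simp: L2_iff torus_periodic_def)

lemma Lp_norm_2_norm: "Lp_norm p (\<lambda>x. norm (f x)) = Lp_norm p f"
  by (simp add: Lp_norm_def)

lemma LINT_norm_le_Lp_norm_2:
  assumes "f \<in> L2"
  shows "(LINT x|torus. norm (f x)) \<le> Lp_norm 2 (\<lambda>x::real^3. 1::real) * Lp_norm 2 f"
proof -
  have "(\<lambda>x. 1::real) \<in> L2" by (rule smooth_periodic_L2[OF smooth_periodic_const])
  from ip_Cauchy_Schwarz[OF this L2_norm[OF assms]] show ?thesis
    by (simp add: ip_def Lp_norm_2_norm)
qed

text \<open>
  On a set of finite measure a Cauchy sequence in the mean square is one in the mean, so that a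
  subsequence converges almost everywhere; Fatou's lemma shows that its limit is the limit in the
  mean square.
\<close>

lemma L2_complete:
  fixes s :: "nat \<Rightarrow> real^3 \<Rightarrow> 'b::euclidean_space"
  assumes s: "\<And>n. s n \<in> L2"
    and C: "\<And>e. e > 0 \<Longrightarrow> \<exists>N. \<forall>m\<ge>N. \<forall>n\<ge>N. Lp_norm 2 (\<lambda>x. s m x - s n x) < e"
  shows "\<exists>f. L2_lim s f"
proof -
  define c where "c = Lp_norm 2 (\<lambda>x::real^3. 1::real)"
  have c: "c \<ge> 0" by (simp add: c_def Lp_norm_2_nonneg)
  have L1: "\<exists>N. \<forall>m\<ge>N. \<forall>n\<ge>N. LINT x|torus. norm (s m x - s n x) < e" if "e > 0" for e
  proof -
    obtain N where N: "\<forall>m\<ge>N. \<forall>n\<ge>N. Lp_norm 2 (\<lambda>x. s m x - s n x) < e / (c + 1)"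
      using C[of "e / (c + 1)"] c \<open>e > 0\<close> by auto
    have "LINT x|torus. norm (s m x - s n x) < e" if mn: "m \<ge> N" "n \<ge> N" for m n
    proof -
      have "(LINT x|torus. norm (s m x - s n x)) \<le> c * Lp_norm 2 (\<lambda>x. s m x - s n x)"
        unfolding c_def by (rule LINT_norm_le_Lp_norm_2[OF L2_diff[OF s s]])
      also have "\<dots> \<le> c * (e / (c + 1))"
        using N mn c by (intro mult_left_mono) (auto simp: less_imp_le)
      also have "\<dots> < e" using c \<open>e > 0\<close> by (simp add: field_simps)
      finally show ?thesis .
    qed
    then show ?thesis by blast
  qed
  obtain r where r: "strict_mono r" "AE x in torus. Cauchy (\<lambda>i. s (r i) x)"
    by (rule cauchy_L1_AE_cauchy_subseq[of torus s, OF L2_integrable[OF s] L1])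
  \<comment> \<open>Where the sequence diverges, \<open>lim\<close> still is a function of the sequence, so that \<open>f\<close> is periodic everywhere.\<close>
  define f where "f x = lim (\<lambda>i. s (r i) x)" for x
  have f_meas [measurable]: "f \<in> borel_measurable torus"
    unfolding f_def by (rule borel_measurable_lim_metric) (rule L2D(2)[OF s])
  have s_meas [measurable]: "s n \<in> borel_measurable torus" for n by (rule L2D(2)[OF s])
  have f_per: "torus_periodic f"
    using L2D(1)[OF s] by (simp add: f_def torus_periodic_def)
  have f_lim: "AE x in torus. (\<lambda>i. s (r i) x) \<longlonglongrightarrow> f x"
    using r(2)
  proof eventually_elim
    case (elim x)
    from Cauchy_convergent[OF this] show ?case unfolding f_def convergent_LIMSEQ_iff .
  qed
  have est: "\<exists>N. \<forall>m\<ge>N. (\<lambda>x. f x - s m x) \<in> L2 \<and> Lp_norm 2 (\<lambda>x. f x - s m x) \<le> e" if "e > 0" for e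
  proof -
    obtain N where N: "\<forall>m\<ge>N. \<forall>n\<ge>N. Lp_norm 2 (\<lambda>x. s m x - s n x) < e"
      using C[OF \<open>e > 0\<close>] by blast
    have "(\<lambda>x. f x - s m x) \<in> L2 \<and> Lp_norm 2 (\<lambda>x. f x - s m x) \<le> e" if "m \<ge> N" for m
    proof -
      have bd: "(\<integral>\<^sup>+ x. ennreal ((norm (s (r i) x - s m x))\<^sup>2) \<partial>torus) \<le> ennreal (e\<^sup>2)" if "i \<ge> N" for i
      proof -
        have "r i \<ge> N" using seq_suble[OF r(1), of i] that by linarith
        then have "(Lp_norm 2 (\<lambda>x. s (r i) x - s m x))\<^sup>2 \<le> e\<^sup>2"
          using N \<open>m \<ge> N\<close> by (intro power_mono Lp_norm_2_nonneg) (auto simp: less_imp_le)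
        moreover have "(\<integral>\<^sup>+ x. ennreal ((norm (s (r i) x - s m x))\<^sup>2) \<partial>torus) =
            ennreal ((Lp_norm 2 (\<lambda>x. s (r i) x - s m x))\<^sup>2)"
          unfolding Lp_norm_2_squared ip_self_eq
          by (rule nn_integral_eq_integral[OF L2D(3)[OF L2_diff[OF s s]]]) simp
        ultimately show ?thesis by (simp add: ennreal_leI)
      qed
      have "(\<integral>\<^sup>+ x. ennreal ((norm (f x - s m x))\<^sup>2) \<partial>torus) =
          (\<integral>\<^sup>+ x. liminf (\<lambda>i. ennreal ((norm (s (r i) x - s m x))\<^sup>2)) \<partial>torus)"
      proof (rule nn_integral_cong_AE, use f_lim in eventually_elim)
        fix x assume "(\<lambda>i. s (r i) x) \<longlonglongrightarrow> f x"
        then have "(\<lambda>i. ennreal ((norm (s (r i) x - s m x))\<^sup>2)) \<longlonglongrightarrow> ennreal ((norm (f x - s m x))\<^sup>2)"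
          by (rule tendsto_ennrealI[OF tendsto_power[OF tendsto_norm[OF tendsto_diff[OF _ tendsto_const]]]])
        then show "ennreal ((norm (f x - s m x))\<^sup>2) = liminf (\<lambda>i. ennreal ((norm (s (r i) x - s m x))\<^sup>2))"
          by (intro lim_imp_Liminf[symmetric]) simp_all
      qed
      also have "\<dots> \<le> liminf (\<lambda>i. \<integral>\<^sup>+ x. ennreal ((norm (s (r i) x - s m x))\<^sup>2) \<partial>torus)"
        by (rule nn_integral_liminf) measurable
      also have "\<dots> \<le> ennreal (e\<^sup>2)"
      proof (rule Liminf_le)
        show "\<forall>\<^sub>F i in sequentially. (\<integral>\<^sup>+ x. ennreal ((norm (s (r i) x - s m x))\<^sup>2) \<partial>torus) \<le> ennreal (e\<^sup>2)"
          using eventually_ge_at_top[of N] by eventually_elim (rule bd)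
      qed simp
      finally have le: "(\<integral>\<^sup>+ x. ennreal ((norm (f x - s m x))\<^sup>2) \<partial>torus) \<le> ennreal (e\<^sup>2)" .
      then have "(\<integral>\<^sup>+ x. ennreal ((norm (f x - s m x))\<^sup>2) \<partial>torus) < \<infinity>"
        by (rule order_le_less_trans) simp
      then have i: "integrable torus (\<lambda>x. (norm (f x - s m x))\<^sup>2)"
      proof (rule integrableI_nonneg[rotated 2])
        show "(\<lambda>x. (norm (f x - s m x))\<^sup>2) \<in> borel_measurable torus" by measurable
      qed simp
      have "ennreal (ip (\<lambda>x. f x - s m x) (\<lambda>x. f x - s m x)) \<le> ennreal (e\<^sup>2)"
        unfolding ip_self_eq using nn_integral_eq_integral[OF i] le by simp
      then have "(Lp_norm 2 (\<lambda>x. f x - s m x))\<^sup>2 \<le> e\<^sup>2"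
        unfolding Lp_norm_2_squared by (subst (asm) ennreal_le_iff) auto
      then have "Lp_norm 2 (\<lambda>x. f x - s m x) \<le> e"
        by (rule power2_le_imp_le[OF _ less_imp_le[OF \<open>e > 0\<close>]])
      moreover have "torus_periodic (\<lambda>x. f x - s m x)"
        using f_per L2D(1)[OF s] by (simp add: torus_periodic_def)
      moreover have "(\<lambda>x. f x - s m x) \<in> borel_measurable torus" by measurable
      ultimately show ?thesis using i unfolding L2_iff by blast
    qed
    then show ?thesis by blast
  qed
  obtain m where "(\<lambda>x. f x - s m x) \<in> L2" using est[of 1] by auto
  from L2_add[OF this s[of m]] have f: "f \<in> L2" by simp
  have "(\<lambda>n. Lp_norm 2 (\<lambda>x. s n x - f x)) \<longlonglongrightarrow> 0"
  proof (rule LIMSEQ_I)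
    fix e :: real assume "e > 0"
    then obtain N where N: "Lp_norm 2 (\<lambda>x. f x - s m x) \<le> e / 2" if "m \<ge> N" for m
      using est[of "e / 2"] half_gt_zero[OF \<open>e > 0\<close>] by blast
    have "norm (Lp_norm 2 (\<lambda>x. s n x - f x) - 0) < e" if "n \<ge> N" for n
    proof -
      have "Lp_norm 2 (\<lambda>x. s n x - f x) \<le> e / 2" by (subst Lp_norm_minus_commute) (rule N[OF that])
      then show ?thesis using \<open>e > 0\<close> Lp_norm_2_nonneg[of "\<lambda>x. s n x - f x"] by simp
    qed
    then show "\<exists>N. \<forall>n\<ge>N. norm (Lp_norm 2 (\<lambda>x. s n x - f x) - 0) < e" by blast
  qed
  then show ?thesis using s f by (auto simp: L2_lim_def)
qed

text \<open>
  The representing field is the limit of a minimising sequence of \<open>\<lambda>\<phi>. ip \<phi> \<phi> - 2 * l \<phi>\<close>, which is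
  Cauchy by the parallelogram identity.
\<close>

lemma Riesz_representation:
  fixes V :: "(real^3 \<Rightarrow> 'b::euclidean_space) set"
  assumes V: "V \<subseteq> L2" "V \<noteq> {}"
    and lin: "\<And>f g a b. f \<in> V \<Longrightarrow> g \<in> V \<Longrightarrow> (\<lambda>x. a *\<^sub>R f x + b *\<^sub>R g x) \<in> V"
    and l: "\<And>f g a b. f \<in> V \<Longrightarrow> g \<in> V \<Longrightarrow> l (\<lambda>x. a *\<^sub>R f x + b *\<^sub>R g x) = a * l f + b * l g"
    and M: "\<And>f. f \<in> V \<Longrightarrow> \<bar>l f\<bar> \<le> M * Lp_norm 2 f"
  shows "\<exists>w F. L2_lim F w \<and> (\<forall>n. F n \<in> V) \<and> (\<forall>f\<in>V. ip w f = l f)"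
proof -
  define J where "J f = ip f f - 2 * l f" for f
  have J_lower: "- M\<^sup>2 \<le> J f" if "f \<in> V" for f
  proof -
    have "0 \<le> (Lp_norm 2 f - M)\<^sup>2" by simp
    then have "2 * (M * Lp_norm 2 f) \<le> ip f f + M\<^sup>2"
      by (simp add: power2_diff Lp_norm_2_squared mult_ac)
    then show ?thesis using M[OF that] by (simp add: J_def)
  qed
  have bdd: "bdd_below (J ` V)" by (rule bdd_belowI2[of V "- M\<^sup>2" J]) (rule J_lower)
  define m where "m = Inf (J ` V)"
  have m: "m \<le> J f" if "f \<in> V" for f
    unfolding m_def by (rule cINF_lower[OF bdd that])
  have "\<exists>f\<in>V. J f < m + 1 / real (Suc n)" for n
    using cINF_less_iff[OF V(2) bdd, of "m + 1 / real (Suc n)"] by (simp add: m_def)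
  then obtain F where F: "\<And>n. F n \<in> V" "\<And>n. J (F n) < m + 1 / real (Suc n)"
    using choice[of "\<lambda>n f. f \<in> V \<and> J f < m + 1 / real (Suc n)"] by blast
  have FL: "F n \<in> L2" for n using F(1) V(1) by blast
  have par: "(Lp_norm 2 (\<lambda>x. F i x - F k x))\<^sup>2 \<le> 2 / real (Suc i) + 2 / real (Suc k)" for i k
  proof -
    let ?h = "\<lambda>x. (1/2) *\<^sub>R F i x + (1/2) *\<^sub>R F k x"
    have arith: "X \<le> 2 * a + 2 * b" if "X = p - 2 * t + r" "h = (p + 2 * t + r) / 4 - (u + v)" "m \<le> h"
      "p - 2 * u < m + a" "r - 2 * v < m + b" for X p t r h u v a b :: real
      using that by (simp add: field_simps)
    have 1: "(Lp_norm 2 (\<lambda>x. F i x - F k x))\<^sup>2 = ip (F i) (F i) - 2 * ip (F i) (F k) + ip (F k) (F k)"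
      using ip_self_linear[OF FL FL, of 1 i "-1" k] by (simp add: Lp_norm_2_squared)
    have 2: "J ?h = (ip (F i) (F i) + 2 * ip (F i) (F k) + ip (F k) (F k)) / 4 - (l (F i) + l (F k))"
      using ip_self_linear[OF FL FL, of "1/2" i "1/2" k] l[OF F(1) F(1), of "1/2" i "1/2" k]
      by (simp add: J_def power2_eq_square field_simps)
    have 3: "m \<le> J ?h" by (rule m[OF lin[OF F(1) F(1)]])
    from arith[OF 1 2 3 F(2)[of i, unfolded J_def] F(2)[of k, unfolded J_def]] show ?thesis by simp
  qed
  have "\<exists>N. \<forall>i\<ge>N. \<forall>k\<ge>N. Lp_norm 2 (\<lambda>x. F i x - F k x) < e" if "e > 0" for e
  proof -
    obtain N where N: "4 / e\<^sup>2 < real N" using reals_Archimedean2 by blast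
    have "Lp_norm 2 (\<lambda>x. F i x - F k x) < e" if "i \<ge> N" "k \<ge> N" for i k
    proof -
      have "4 / e\<^sup>2 < real (Suc N)" using N by simp
      then have "4 / real (Suc N) < e\<^sup>2" using \<open>e > 0\<close> by (simp add: field_simps)
      moreover have "2 / real (Suc i) \<le> 2 / real (Suc N)" "2 / real (Suc k) \<le> 2 / real (Suc N)"
        using that by (auto intro!: divide_left_mono)
      ultimately have "(Lp_norm 2 (\<lambda>x. F i x - F k x))\<^sup>2 < e\<^sup>2" using par[of i k] by simp
      then show ?thesis using \<open>e > 0\<close> by (simp add: power2_less_imp_less)
    qed
    then show ?thesis by blast
  qed
  from L2_complete[of F, OF FL this] obtain w where w: "L2_lim F w" by (rule exE)
  have "ip w f = l f" if f: "f \<in> V" for f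
  proof -
    have fL: "f \<in> L2" using f V(1) by blast
    have "0 \<le> 0 + 2 * (ip w f - l f) * t + ip f f * t\<^sup>2" for t
    proof (rule LIMSEQ_le_const)
      have lim: "(\<lambda>n. ip (F n) f) \<longlonglongrightarrow> ip w f" by (rule L2_lim_ip[OF w fL])
      have "(\<lambda>n. inverse (real (Suc n)) + 2 * (ip (F n) f - l f) * t + ip f f * t\<^sup>2)
          \<longlonglongrightarrow> 0 + 2 * (ip w f - l f) * t + ip f f * t\<^sup>2"
        by (rule tendsto_add[OF tendsto_add[OF LIMSEQ_inverse_real_of_nat
              tendsto_mult[OF tendsto_mult[OF tendsto_const tendsto_diff[OF lim tendsto_const]] tendsto_const]] tendsto_const])
      then show "(\<lambda>n. 1 / real (Suc n) + 2 * (ip (F n) f - l f) * t + ip f f * t\<^sup>2)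
          \<longlonglongrightarrow> 0 + 2 * (ip w f - l f) * t + ip f f * t\<^sup>2" by (simp add: inverse_eq_divide)
      have "0 \<le> 1 / real (Suc n) + 2 * (ip (F n) f - l f) * t + ip f f * t\<^sup>2" for n
      proof -
        have "m \<le> J (\<lambda>x. 1 *\<^sub>R F n x + t *\<^sub>R f x)" by (rule m[OF lin[OF F(1) f]])
        then show ?thesis
          using F(2)[of n] unfolding J_def ip_self_linear[OF FL fL] l[OF F(1) f]
          by (simp add: algebra_simps)
      qed
      then show "\<exists>N. \<forall>n\<ge>N. 0 \<le> 1 / real (Suc n) + 2 * (ip (F n) f - l f) * t + ip f f * t\<^sup>2" by blast
    qed
    from nonneg_quadratic_imp_discriminant[OF this ip_self_nonneg] show ?thesis by simp
  qed
  then show ?thesis using w F(1) by blast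
qed

section \<open>Integral operators with kernels of finite rank\<close>

text \<open>
  All mollifiers below have kernels of this form.  Smoothness of the image, differentiation under
  the integral sign and the exchange of integrations are then statements about finite sums and are
  proved by rule induction.
\<close>

inductive finite_rank :: "(real^3 \<Rightarrow> real^3 \<Rightarrow> real) \<Rightarrow> bool" where
  finite_rank_product:
    "smooth_periodic a \<Longrightarrow> smooth_periodic b \<Longrightarrow> finite_rank (\<lambda>x y. a x * b y)"
| finite_rank_add: "finite_rank k \<Longrightarrow> finite_rank l \<Longrightarrow> finite_rank (\<lambda>x y. k x y + l x y)"

lemma finite_rank_mult:
  assumes "finite_rank k" "finite_rank l"
  shows "finite_rank (\<lambda>x y. k x y * l x y)"
  using assms(1)
proof induction
  case (finite_rank_product a b)
  note ab = this
  show ?case using assms(2)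
  proof induction
    case (finite_rank_product c d)
    have "finite_rank (\<lambda>x y. (a x * c x) * (b y * d y))"
      by (rule finite_rank.finite_rank_product[OF smooth_periodic_mult smooth_periodic_mult])
         (rule ab finite_rank_product)+
    then show ?case by (simp add: mult_ac)
  next
    case (finite_rank_add k l)
    from finite_rank.finite_rank_add[OF finite_rank_add.IH] show ?case by (simp add: algebra_simps)
  qed
next
  case (finite_rank_add k l')
  from finite_rank.finite_rank_add[OF finite_rank_add.IH] show ?case by (simp add: algebra_simps)
qed

lemma finite_rank_const: "finite_rank (\<lambda>x y. c)"
  using finite_rank_product[OF smooth_periodic_const[of c] smooth_periodic_const[of 1]] by simp

lemma finite_rank_power: "finite_rank k \<Longrightarrow> finite_rank (\<lambda>x y. k x y ^ n)"
  by (induction n) (simp_all add: finite_rank_const finite_rank_mult)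

lemma finite_rank_prod:
  "(\<And>i. i \<in> I \<Longrightarrow> finite_rank (k i)) \<Longrightarrow> finite_rank (\<lambda>x y. \<Prod>i\<in>I. k i x y)"
  by (induction I rule: infinite_finite_induct) (simp_all add: finite_rank_const finite_rank_mult)

lemma finite_rank_smooth:
  assumes "finite_rank k"
  shows "smooth_periodic (\<lambda>x. k x y)" "smooth_periodic (\<lambda>y. k x y)"
  using assms
proof (induction arbitrary: x y)
  case (finite_rank_product a b)
  {
    case 1
    show ?case by (rule smooth_periodic_mult[OF finite_rank_product(1) smooth_periodic_const])
  next
    case 2
    show ?case by (rule smooth_periodic_mult[OF smooth_periodic_const finite_rank_product(2)])
  }
qed (simp_all add: smooth_periodic_add)

lemma smooth_periodic_times_integrable:
  fixes f :: "real^3 \<Rightarrow> 'b::euclidean_space"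
  assumes b: "smooth_periodic b" and f: "integrable torus f"
  shows "integrable torus (\<lambda>y. b y *\<^sub>R f y)"
proof -
  obtain B where B: "\<And>y. norm (b y) \<le> B"
    using periodic_bounded[OF smooth_periodicD(2,3)[OF b]] by blast
  show ?thesis
  proof (rule Bochner_Integration.integrable_bound)
    show "integrable torus (\<lambda>y. B * norm (f y))"
      by (rule integrable_mult_right[OF integrable_norm[OF f]])
    show "(\<lambda>y. b y *\<^sub>R f y) \<in> borel_measurable torus"
      by (rule borel_measurable_scaleR) (rule borel_measurable_integrable integrable_smooth_periodic b f)+
    have "norm (b y *\<^sub>R f y) \<le> norm (B * norm (f y))" for y
      using mult_right_mono[OF B[of y] norm_ge_zero[of "f y"]]
      by (simp only: norm_scaleR real_norm_def)
    then show "AE y in torus. norm (b y *\<^sub>R f y) \<le> norm (B * norm (f y))" by (rule AE_I2)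
  qed
qed

lemma finite_rank_integrable:
  fixes f :: "real^3 \<Rightarrow> 'b::euclidean_space"
  shows "finite_rank k \<Longrightarrow> integrable torus f \<Longrightarrow> integrable torus (\<lambda>y. k x y *\<^sub>R f y)"
  by (rule smooth_periodic_times_integrable[OF finite_rank_smooth(2)])

lemma finite_rank_operator:
  fixes f :: "real^3 \<Rightarrow> 'b::euclidean_space"
  assumes k: "finite_rank k" and f: "integrable torus f"
  shows "smooth_periodic (\<lambda>x. LINT y|torus. k x y *\<^sub>R f y)"
    and "integrable torus (\<lambda>y. partial_d j (\<lambda>x. k x y) x *\<^sub>R f y)"
    and "partial_d j (\<lambda>x. LINT y|torus. k x y *\<^sub>R f y) x = (LINT y|torus. partial_d j (\<lambda>x. k x y) x *\<^sub>R f y)"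
  using k
proof (induction arbitrary: x)
  case (finite_rank_product a b)
  note bf = smooth_periodic_times_integrable[OF finite_rank_product(2) f]
  have op: "(LINT y|torus. (a x * b y) *\<^sub>R f y) = a x *\<^sub>R (LINT y|torus. b y *\<^sub>R f y)" for x
    by (simp flip: scaleR_scaleR)
  have pd: "partial_d j (\<lambda>x. a x * b y) x = partial_d j a x * b y" for x y
    by (simp add: partial_d_simps(4)[OF finite_rank_product(1) smooth_periodic_const] partial_d_simps(5))
  have pd': "partial_d j (\<lambda>x. a x *\<^sub>R c) x = partial_d j a x *\<^sub>R c" for x and c :: 'b
    using partial_d_simps(3)[OF finite_rank_product(1) smooth_periodic_const, of j c x]
      partial_d_simps(5)[of j c x] by simp
  {
    case 1
    show ?case unfolding op by (rule smooth_periodic_scaleR[OF finite_rank_product(1) smooth_periodic_const])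
  next
    case 2
    show ?case unfolding pd scaleR_scaleR[symmetric] by (rule integrable_scaleR_right[OF bf])
  next
    case 3
    show ?case unfolding op pd' pd by (simp flip: scaleR_scaleR)
  }
next
  case (finite_rank_add k l)
  note kl = finite_rank_add.hyps
  note intk = finite_rank_integrable[OF kl(1) f] finite_rank_integrable[OF kl(2) f]
  have op: "(LINT y|torus. (k x y + l x y) *\<^sub>R f y) = (LINT y|torus. k x y *\<^sub>R f y) + (LINT y|torus. l x y *\<^sub>R f y)" for x
    unfolding scaleR_add_left by (rule Bochner_Integration.integral_add[OF intk])
  have pd: "partial_d j (\<lambda>x. k x y + l x y) x = partial_d j (\<lambda>x. k x y) x + partial_d j (\<lambda>x. l x y) x" for x y
    by (rule partial_d_simps(1)[OF finite_rank_smooth(1) finite_rank_smooth(1)]) (rule kl)+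
  {
    case 1
    show ?case unfolding op by (rule smooth_periodic_add) (rule finite_rank_add.IH)+
  next
    case 2
    show ?case unfolding pd scaleR_add_left
      by (rule Bochner_Integration.integrable_add) (rule finite_rank_add.IH)+
  next
    case 3
    have "partial_d j (\<lambda>x. LINT y|torus. (k x y + l x y) *\<^sub>R f y) x =
        partial_d j (\<lambda>x. LINT y|torus. k x y *\<^sub>R f y) x + partial_d j (\<lambda>x. LINT y|torus. l x y *\<^sub>R f y) x"
      unfolding op by (rule partial_d_simps(1)) (rule finite_rank_add.IH)+
    also have "\<dots> = (LINT y|torus. partial_d j (\<lambda>x. k x y) x *\<^sub>R f y + partial_d j (\<lambda>x. l x y) x *\<^sub>R f y)"
      unfolding finite_rank_add.IH
      by (rule Bochner_Integration.integral_add[symmetric]) (rule finite_rank_add.IH)+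
    finally show ?case unfolding pd scaleR_add_left .
  }
qed

lemma finite_rank_Fubini:
  fixes f g :: "real^3 \<Rightarrow> 'b::euclidean_space"
  assumes k: "finite_rank k" and f: "integrable torus f" and g: "integrable torus g"
  shows "integrable torus (\<lambda>x. (LINT y|torus. k x y *\<^sub>R f y) \<bullet> g x)"
    and "(LINT x|torus. (LINT y|torus. k x y *\<^sub>R f y) \<bullet> g x) =
      (LINT y|torus. f y \<bullet> (LINT x|torus. k x y *\<^sub>R g x))"
    and "integrable torus (\<lambda>y. f y \<bullet> (LINT x|torus. k x y *\<^sub>R g x))"
  using k
proof induction
  case (finite_rank_product a b)
  note bf = smooth_periodic_times_integrable[OF finite_rank_product(2) f]
  note ag = smooth_periodic_times_integrable[OF finite_rank_product(1) g]
  have op: "(LINT y|torus. (a x * b y) *\<^sub>R f y) = a x *\<^sub>R (LINT y|torus. b y *\<^sub>R f y)" for x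
    by (simp flip: scaleR_scaleR)
  have op': "(LINT x|torus. (a x * b y) *\<^sub>R g x) = b y *\<^sub>R (LINT x|torus. a x *\<^sub>R g x)" for y
  proof -
    have "(a x * b y) *\<^sub>R g x = b y *\<^sub>R (a x *\<^sub>R g x)" for x by (simp add: mult.commute)
    then show ?thesis by (simp only: integral_scaleR_right)
  qed
  have l: "(\<lambda>x. (LINT y|torus. (a x * b y) *\<^sub>R f y) \<bullet> g x) = (\<lambda>x. (LINT y|torus. b y *\<^sub>R f y) \<bullet> (a x *\<^sub>R g x))"
    unfolding op by (simp add: fun_eq_iff)
  have r: "(\<lambda>y. f y \<bullet> (LINT x|torus. (a x * b y) *\<^sub>R g x)) = (\<lambda>y. (b y *\<^sub>R f y) \<bullet> (LINT x|torus. a x *\<^sub>R g x))"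
    unfolding op' by (simp add: fun_eq_iff)
  {
    case 1
    show ?case unfolding l by (rule integrable_inner_right[OF ag])
  next
    case 2
    show ?case unfolding l r integral_inner_right[OF ag] integral_inner_left[OF bf] ..
  next
    case 3
    show ?case unfolding r by (rule integrable_inner_left[OF bf])
  }
next
  case (finite_rank_add k l)
  note kl = finite_rank_add.hyps
  note intk = finite_rank_integrable[OF kl(1) f] finite_rank_integrable[OF kl(2) f]
  have intg: "integrable torus (\<lambda>x. k x y *\<^sub>R g x)" "integrable torus (\<lambda>x. l x y *\<^sub>R g x)" for y
    by (rule smooth_periodic_times_integrable[OF finite_rank_smooth(1)[OF kl(1)] g]
        smooth_periodic_times_integrable[OF finite_rank_smooth(1)[OF kl(2)] g])+
  have op: "(LINT y|torus. (k x y + l x y) *\<^sub>R f y) = (LINT y|torus. k x y *\<^sub>R f y) + (LINT y|torus. l x y *\<^sub>R f y)" for x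
    unfolding scaleR_add_left by (rule Bochner_Integration.integral_add[OF intk])
  have op': "(LINT x|torus. (k x y + l x y) *\<^sub>R g x) = (LINT x|torus. k x y *\<^sub>R g x) + (LINT x|torus. l x y *\<^sub>R g x)" for y
    unfolding scaleR_add_left by (rule Bochner_Integration.integral_add[OF intg])
  {
    case 1
    show ?case unfolding op inner_add_left
      by (rule Bochner_Integration.integrable_add) (rule finite_rank_add.IH)+
  next
    case 2
    show ?case unfolding op op' inner_add_left inner_add_right
      by (subst (1 2) Bochner_Integration.integral_add) (simp_all add: finite_rank_add.IH)
  next
    case 3
    show ?case unfolding op' inner_add_right
      by (rule Bochner_Integration.integrable_add) (rule finite_rank_add.IH)+
  }
qed

section \<open>The de la Vallee-Poussin kernel\<close>

text \<open>
  The unnormalised kernel is a power of \<open>2 * (cos (t / 2))\<^sup>2\<close> in each coordinate, nonnegative and peaked at the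
  period lattice with width of order \<open>1 / sqrt n\<close>.
\<close>

definition vp :: "nat \<Rightarrow> real^3 \<Rightarrow> real" where
  "vp n z = (\<Prod>i\<in>UNIV. (1 + cos (z $ i)) ^ n)"

definition eta :: "nat \<Rightarrow> real^3 \<Rightarrow> real" where
  "eta n z = vp n z / (LINT z|torus. vp n z)"

definition mol :: "nat \<Rightarrow> (real^3 \<Rightarrow> 'b::euclidean_space) \<Rightarrow> real^3 \<Rightarrow> 'b" where
  "mol n f x = (LINT y|torus. eta n (x - y) *\<^sub>R f y)"

lemma one_plus_cos_nonneg: "0 \<le> 1 + cos (t::real)"
  using cos_ge_minus_one[of t] by linarith

lemma vp_nonneg: "0 \<le> vp n z"
  unfolding vp_def by (intro prod_nonneg zero_le_power one_plus_cos_nonneg ballI)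

lemma eight_power: "((2::real) ^ n) ^ 3 = 8 ^ n"
proof -
  have "((2::real) ^ n) ^ 3 = (2 ^ 3) ^ n" by (simp only: power_mult[symmetric] mult.commute)
  then show ?thesis by simp
qed

lemma vp_le: "vp n z \<le> 8 ^ n"
proof -
  have "vp n z \<le> (\<Prod>i\<in>(UNIV::3 set). 2 ^ n)"
    unfolding vp_def
  proof (rule prod_mono)
    fix i :: 3
    have "1 + cos (z $ i) \<le> 2" using cos_le_one[of "z $ i"] by linarith
    then show "0 \<le> (1 + cos (z $ i)) ^ n \<and> (1 + cos (z $ i)) ^ n \<le> 2 ^ n"
      by (intro conjI zero_le_power power_mono one_plus_cos_nonneg)
  qed
  also have "\<dots> = 8 ^ n" by (simp add: eight_power)
  finally show ?thesis .
qed

lemma vp_smooth: "smooth_periodic (vp n)"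
proof -
  have "smooth_periodic (\<lambda>z. \<Prod>i\<in>(UNIV::3 set). \<Prod>k<n. 1 + cos (z $ i))"
    by (intro smooth_periodic_prod smooth_periodic_add smooth_periodic_const smooth_periodic_coordinate_trig)
  then show ?thesis by (simp add: vp_def[abs_def])
qed

lemma one_minus_cos_le: "1 - cos (t::real) \<le> t\<^sup>2 / 2"
proof -
  have "1 - cos t = 2 * (sin (t / 2))\<^sup>2" using cos_double_sin[of "t / 2"] by simp
  also have "\<dots> = 2 * \<bar>sin (t / 2)\<bar>\<^sup>2" by simp
  also have "\<dots> \<le> 2 * \<bar>t / 2\<bar>\<^sup>2"
    by (intro mult_left_mono power_mono abs_sin_x_le_abs_x) auto
  finally show ?thesis by (simp add: power2_eq_square)
qed

text \<open>On the cube with edges \<open>1 / sqrt (n + 1)\<close> the kernel is comparable to its maximum.\<close>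

lemma vp_integral_lower: "27 / 64 * 8 ^ n / sqrt (real (Suc n)) ^ 3 \<le> (LINT z|torus. vp n z)"
proof -
  define h where "h = 1 / sqrt (real (Suc n))"
  have "1 \<le> sqrt (real (Suc n))" by (simp add: real_le_rsqrt)
  then have h: "0 < h" "h \<le> 1" by (simp_all add: h_def)
  have h2: "h\<^sup>2 = 1 / real (Suc n)" by (simp add: h_def power_divide)
  define B :: "(real^3) set" where "B = cbox 0 (\<chi> i. h)"
  have "h \<le> 2 * pi" using h pi_gt3 by linarith
  then have BC: "B \<subseteq> torus_cell"
    by (auto simp: B_def torus_cell_def mem_box_cart) (meson order_trans)
  have lower: "27 / 64 * 8 ^ n \<le> vp n z" if "z \<in> B" for z
  proof -
    have one: "3 / 4 * 2 ^ n \<le> (1 + cos (z $ i)) ^ n" for i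
    proof -
      have zi: "0 \<le> z $ i" "z $ i \<le> h" using that by (auto simp: B_def mem_box_cart)
      have "(z $ i)\<^sup>2 \<le> h\<^sup>2" using zi by (intro power_mono)
      then have "1 + cos (z $ i) \<ge> 2 * (1 + - h\<^sup>2 / 4)" using one_minus_cos_le[of "z $ i"] by simp
      moreover have h4: "h\<^sup>2 \<le> 1" using h by (simp add: power_le_one)
      ultimately have "(2 * (1 + - h\<^sup>2 / 4)) ^ n \<le> (1 + cos (z $ i)) ^ n" by (intro power_mono) auto
      moreover have "1 + real n * (- h\<^sup>2 / 4) \<le> (1 + - h\<^sup>2 / 4) ^ n"
        using h4 by (intro Bernoulli_inequality) simp
      moreover have "real n * h\<^sup>2 \<le> 1" by (simp add: h2)
      ultimately have "(3 / 4) * 2 ^ n \<le> (1 + - h\<^sup>2 / 4) ^ n * 2 ^ n"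
        by (intro mult_right_mono) simp_all
      also have "\<dots> = (2 * (1 + - h\<^sup>2 / 4)) ^ n" by (simp only: power_mult_distrib mult.commute)
      also have "\<dots> \<le> (1 + cos (z $ i)) ^ n" by fact
      finally show ?thesis .
    qed
    have "(\<Prod>i\<in>(UNIV::3 set). 3 / 4 * 2 ^ n) \<le> vp n z"
      unfolding vp_def using one by (intro prod_mono) simp
    moreover have "(\<Prod>i\<in>(UNIV::3 set). 3 / 4 * (2::real) ^ n) = 27 / 64 * 8 ^ n"
      by (simp add: power_mult_distrib power_divide eight_power)
    ultimately show ?thesis by simp
  qed
  have cont: "continuous_on S (vp n)" for S
    by (rule continuous_on_subset[OF smooth_periodicD(3)[OF vp_smooth]]) simp
  have "0 \<in> B" using h by (simp add: B_def mem_box_cart)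
  then have "cbox 0 (\<chi> i. h) \<noteq> ({} :: (real^3) set)" unfolding B_def by blast
  then have "Henstock_Kurzweil_Integration.content B = h ^ 3" unfolding B_def by (simp add: content_cbox_cart)
  then have "27 / 64 * 8 ^ n * h ^ 3 = integral B (\<lambda>z. 27 / 64 * 8 ^ n)"
    unfolding B_def by simp
  also have "\<dots> \<le> integral B (vp n)"
    by (rule integral_le) (use lower in \<open>auto simp: B_def intro: integrable_continuous cont\<close>)
  also have "\<dots> \<le> integral torus_cell (vp n)"
    by (rule integral_subset_le[OF BC]) (auto simp: B_def torus_cell_def vp_nonneg intro: integrable_continuous cont)
  also have "\<dots> = (LINT z|torus. vp n z)"
    by (rule LINT_torus_eq_integral[OF integrable_smooth_periodic[OF vp_smooth], symmetric])
  finally show ?thesis by (simp add: h_def power_divide)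
qed

lemma vp_integral_pos: "0 < (LINT z|torus. vp n z)"
  by (rule less_le_trans[OF _ vp_integral_lower]) simp

lemma eta_nonneg: "0 \<le> eta n z"
  unfolding eta_def using vp_nonneg vp_integral_pos by (intro divide_nonneg_pos)

lemma eta_le: "eta n z \<le> 3 * sqrt (real (Suc n)) ^ 3"
proof -
  have "eta n z \<le> 8 ^ n / (27 / 64 * 8 ^ n / sqrt (real (Suc n)) ^ 3)"
    unfolding eta_def by (rule frac_le) (use vp_le vp_integral_lower in auto)
  also have "\<dots> = 64 / 27 * sqrt (real (Suc n)) ^ 3" by simp
  also have "\<dots> \<le> 3 * sqrt (real (Suc n)) ^ 3" by (intro mult_right_mono) simp_all
  finally show ?thesis .
qed

lemma eta_smooth: "smooth_periodic (eta n)"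
  using smooth_periodic_mult[OF vp_smooth[of n] smooth_periodic_const[of "inverse (LINT z|torus. vp n z)"]]
  by (simp add: eta_def[abs_def] divide_inverse)

lemma eta_minus: "eta n (- z) = eta n z" by (simp add: eta_def vp_def)

lemma eta_diff_commute: "eta n (x - y) = eta n (y - x)"
  using eta_minus[of n "y - x"] by simp

lemma eta_finite_rank: "finite_rank (\<lambda>x y. eta n (x - y))"
proof -
  have "finite_rank (\<lambda>x y. 1 + (cos (x $ i) * cos (y $ i) + sin (x $ i) * sin (y $ i)))" for i
    by (intro finite_rank_add finite_rank_const finite_rank_product smooth_periodic_coordinate_trig)
  then have "finite_rank (\<lambda>x y. 1 + cos ((x - y) $ i))" for i by (simp add: cos_diff)
  then have "finite_rank (\<lambda>x y. (\<Prod>i\<in>UNIV. (1 + cos ((x - y) $ i)) ^ n) * inverse (LINT z|torus. vp n z))"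
    by (intro finite_rank_mult finite_rank_prod finite_rank_power finite_rank_const)
  then show ?thesis by (simp only: eta_def vp_def divide_inverse)
qed

lemma eta_integral: "(LINT z|torus. eta n z) = 1"
  unfolding eta_def[abs_def] using vp_integral_pos[of n] by simp

lemma eta_integral_diff: "(LINT y|torus. eta n (x - y)) = 1"
proof -
  have "(LINT y|torus. eta n (x - y)) = (LINT y|torus. eta n (y + - x))"
    by (simp add: eta_diff_commute[of n x])
  also have "\<dots> = (LINT y|torus. eta n y)"
    by (rule LINT_torus_shift) (rule smooth_periodicD[OF eta_smooth])+
  finally show ?thesis by (simp add: eta_integral)
qed

lemma partial_d_line:
  fixes f :: "real^3 \<Rightarrow> real"
  assumes "smooth_periodic f" "((\<lambda>s. f (x + s *\<^sub>R axis j 1)) has_real_derivative D) (at 0)"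
  shows "partial_d j f x = D"
proof -
  have "(\<Sum>i\<in>UNIV. axis j 1 $ i * g i) = g j" for g :: "3 \<Rightarrow> real"
    using sum_axis_scaleR[of j g] by simp
  with smooth_periodic_line_derivative[OF assms(1), of x "axis j 1" 0 UNIV]
  have "((\<lambda>s. f (x + s *\<^sub>R axis j 1)) has_real_derivative partial_d j f x) (at 0)" by simp
  with assms(2) show ?thesis by (rule DERIV_unique[symmetric])
qed

text \<open>
  The second moment comes from integrating the partial derivative of \<open>sin (z $ i) * vp n z\<close>, which is
  \<open>(1 - (n + 1) * (1 - cos (z $ i))) * vp n z\<close> because \<open>sin\<^sup>2 = (1 - cos) * (1 + cos)\<close>.
\<close>

lemma eta_second_moment: "(LINT z|torus. (1 - cos (z $ i)) * eta n z) = 1 / real (Suc n)"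
proof -
  have sm: "smooth_periodic (\<lambda>z. sin (z $ i) * vp n z)"
    by (rule smooth_periodic_mult[OF smooth_periodic_coordinate_trig(2) vp_smooth])
  have pd: "partial_d i (\<lambda>z. sin (z $ i) * vp n z) z = vp n z - real (Suc n) * ((1 - cos (z $ i)) * vp n z)" for z
  proof (rule partial_d_line[OF sm])
    define R where "R = (\<Prod>j\<in>UNIV - {i}. (1 + cos (z $ j)) ^ n)"
    define c s where "c = cos (z $ i)" and "s = sin (z $ i)"
    have vpR: "vp n (z + t *\<^sub>R axis i 1) = (1 + cos (z $ i + t)) ^ n * R" for t
    proof -
      have "vp n (z + t *\<^sub>R axis i 1) = (1 + cos ((z + t *\<^sub>R axis i 1) $ i)) ^ n *
          (\<Prod>j\<in>UNIV - {i}. (1 + cos ((z + t *\<^sub>R axis i 1) $ j)) ^ n)"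
        unfolding vp_def by (rule prod.remove) simp_all
      moreover have "(\<Prod>j\<in>UNIV - {i}. (1 + cos ((z + t *\<^sub>R axis i 1) $ j)) ^ n) = R"
        unfolding R_def by (rule prod.cong) (auto simp: axis_def)
      ultimately show ?thesis by (simp add: axis_def)
    qed
    have "((\<lambda>t. sin (z $ i + t) * ((1 + cos (z $ i + t)) ^ n * R)) has_real_derivative
        c * ((1 + c) ^ n * R) + s * (real n * (1 + c) ^ (n - 1) * - s * R)) (at 0)"
      by (auto intro!: derivative_eq_intros simp: c_def s_def)
    moreover have "c * ((1 + c) ^ n * R) + s * (real n * (1 + c) ^ (n - 1) * - s * R) =
        vp n z - real (Suc n) * ((1 - c) * vp n z)"
    proof -
      have "s * s = (1 - c) * (1 + c)"
        using sin_squared_eq[of "z $ i"] by (simp add: c_def s_def power2_eq_square algebra_simps)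
      then have "s * (real n * (1 + c) ^ (n - 1) * - s * R) = - (real n * (1 - c) * ((1 + c) * (1 + c) ^ (n - 1)) * R)"
        by (simp add: mult_ac)
      also have "real n * (1 - c) * ((1 + c) * (1 + c) ^ (n - 1)) = real n * (1 - c) * (1 + c) ^ n"
        by (cases n) simp_all
      finally show ?thesis using vpR[of 0] by (simp add: c_def algebra_simps)
    qed
    ultimately show "((\<lambda>t. sin ((z + t *\<^sub>R axis i 1) $ i) * vp n (z + t *\<^sub>R axis i 1)) has_real_derivative
        vp n z - real (Suc n) * ((1 - cos (z $ i)) * vp n z)) (at 0)"
      unfolding vpR by (simp add: axis_def c_def)
  qed
  have si: "smooth_periodic (\<lambda>z. (1 - cos (z $ i)) * vp n z)"
    by (intro smooth_periodic_mult smooth_periodic_diff smooth_periodic_const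
        smooth_periodic_coordinate_trig vp_smooth)
  have "0 = (LINT z|torus. vp n z - real (Suc n) * ((1 - cos (z $ i)) * vp n z))"
    using LINT_torus_partial_d[OF sm, of i] unfolding pd by simp
  also have "\<dots> = (LINT z|torus. vp n z) - real (Suc n) * (LINT z|torus. (1 - cos (z $ i)) * vp n z)"
    using integrable_smooth_periodic[OF si] integrable_smooth_periodic[OF vp_smooth, of n]
    by (subst Bochner_Integration.integral_diff) simp_all
  finally have "(LINT z|torus. (1 - cos (z $ i)) * vp n z) = (LINT z|torus. vp n z) / real (Suc n)"
    by (simp add: field_simps)
  moreover have "(LINT z|torus. (1 - cos (z $ i)) * eta n z) =
      (LINT z|torus. (1 - cos (z $ i)) * vp n z) / (LINT z|torus. vp n z)"
    unfolding eta_def by simp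
  ultimately show ?thesis using vp_integral_pos[of n] by simp
qed

section \<open>Mollification\<close>

lemma mol_integrand:
  fixes f :: "real^3 \<Rightarrow> 'b::euclidean_space"
  shows "integrable torus f \<Longrightarrow> integrable torus (\<lambda>y. eta n (x - y) *\<^sub>R f y)"
  by (rule finite_rank_integrable[OF eta_finite_rank])

lemma mol_smooth:
  fixes f :: "real^3 \<Rightarrow> 'b::euclidean_space"
  shows "integrable torus f \<Longrightarrow> smooth_periodic (mol n f)"
  unfolding mol_def by (rule finite_rank_operator(1)[OF eta_finite_rank])

lemma mol_linear:
  fixes f g :: "real^3 \<Rightarrow> 'b::euclidean_space"
  assumes "integrable torus f" "integrable torus g"
  shows "mol n (\<lambda>y. a *\<^sub>R f y + b *\<^sub>R g y) x = a *\<^sub>R mol n f x + b *\<^sub>R mol n g x"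
proof -
  have "mol n (\<lambda>y. a *\<^sub>R f y + b *\<^sub>R g y) x =
      (LINT y|torus. a *\<^sub>R (eta n (x - y) *\<^sub>R f y) + b *\<^sub>R (eta n (x - y) *\<^sub>R g y))"
    by (simp add: mol_def scaleR_add_right mult.commute)
  also have "\<dots> = a *\<^sub>R mol n f x + b *\<^sub>R mol n g x"
    unfolding mol_def
    by (simp only: Bochner_Integration.integral_add[OF integrable_scaleR_right[OF mol_integrand[OF assms(1)]]
          integrable_scaleR_right[OF mol_integrand[OF assms(2)]]] integral_scaleR_right)
  finally show ?thesis .
qed

lemma mol_diff:
  fixes f g :: "real^3 \<Rightarrow> 'b::euclidean_space"
  assumes "integrable torus f" "integrable torus g"
  shows "mol n (\<lambda>y. f y - g y) x = mol n f x - mol n g x"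
  using mol_linear[OF assms, of n 1 "-1" x] by simp

lemma mol_add:
  fixes f g :: "real^3 \<Rightarrow> 'b::euclidean_space"
  assumes "integrable torus f" "integrable torus g"
  shows "mol n (\<lambda>y. f y + g y) x = mol n f x + mol n g x"
  using mol_linear[OF assms, of n 1 1 x] by simp

lemma mol_bounded_linear:
  fixes f :: "real^3 \<Rightarrow> 'b::euclidean_space" and L :: "'b \<Rightarrow> 'c::euclidean_space"
  assumes L: "bounded_linear L" and f: "integrable torus f"
  shows "mol n (\<lambda>y. L (f y)) x = L (mol n f x)"
proof -
  have "L (eta n (x - y) *\<^sub>R f y) = eta n (x - y) *\<^sub>R L (f y)" for y
    by (rule linear_scale[OF bounded_linear.linear[OF L]])
  then show ?thesis
    unfolding mol_def using integral_bounded_linear[OF L mol_integrand[OF f, of n x]] by simp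
qed

lemma mol_component:
  fixes f :: "real^3 \<Rightarrow> real^'n"
  shows "integrable torus f \<Longrightarrow> mol n (\<lambda>y. f y $ i) x = mol n f x $ i"
  by (rule mol_bounded_linear[OF bounded_linear_vec_nth])

lemma mol_symmetric:
  fixes f g :: "real^3 \<Rightarrow> 'b::euclidean_space"
  assumes "integrable torus f" "integrable torus g"
  shows "(LINT x|torus. mol n f x \<bullet> g x) = (LINT x|torus. f x \<bullet> mol n g x)"
  using finite_rank_Fubini(2)[OF eta_finite_rank assms, of n]
  unfolding mol_def by (simp only: eta_diff_commute[of n])

text \<open>\<open>g\<close> is the derivative of \<open>f\<close> in direction \<open>j\<close>, in the sense of distributions.\<close>

definition weak_partial :: "3 \<Rightarrow> (real^3 \<Rightarrow> real) \<Rightarrow> (real^3 \<Rightarrow> real) \<Rightarrow> bool" where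
  "weak_partial j f g \<longleftrightarrow> integrable torus f \<and> integrable torus g \<and>
    (\<forall>\<psi>. smooth_periodic \<psi> \<longrightarrow> (LINT x|torus. f x * partial_d j \<psi> x) = - (LINT x|torus. g x * \<psi> x))"

lemma weak_partial_smooth: "smooth_periodic f \<Longrightarrow> weak_partial j f (partial_d j f)"
  by (simp add: weak_partial_def torus_integration_by_parts smooth_periodic_derivative(2) integrable_smooth_periodic)

lemma partial_d_eta:
  "partial_d j (\<lambda>x. eta n (x - y)) x = partial_d j (eta n) (x - y)"
  "partial_d j (\<lambda>y. eta n (x - y)) y = - partial_d j (eta n) (x - y)"
proof -
  note d = smooth_periodic_derivative(1)[OF eta_smooth, of n "x - y"]
  have "((\<lambda>x. eta n (x - y)) has_derivative (\<lambda>h. \<Sum>j\<in>UNIV. (h $ j) *\<^sub>R partial_d j (eta n) (x - y))) (at x)"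
    by (rule has_derivative_compose[where f = "\<lambda>x. x - y" and f' = "\<lambda>h. h", OF _ d])
       (auto intro!: derivative_eq_intros)
  from partial_d_eqI[OF this, of j] show "partial_d j (\<lambda>x. eta n (x - y)) x = partial_d j (eta n) (x - y)"
    by (simp only: sum_axis_scaleR)
  have "((\<lambda>y. eta n (x - y)) has_derivative (\<lambda>h. \<Sum>j\<in>UNIV. ((- h) $ j) *\<^sub>R partial_d j (eta n) (x - y))) (at y)"
    by (rule has_derivative_compose[where f = "\<lambda>y. x - y" and f' = "\<lambda>h. - h", OF _ d])
       (auto intro!: derivative_eq_intros)
  from partial_d_eqI[OF this, of j] show "partial_d j (\<lambda>y. eta n (x - y)) y = - partial_d j (eta n) (x - y)"
    by (simp only: vector_uminus_component scaleR_minus_left sum_negf sum_axis_scaleR)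
qed

lemma partial_d_mol_kernel:
  fixes f :: "real^3 \<Rightarrow> 'b::euclidean_space"
  assumes "integrable torus f"
  shows "partial_d j (mol n f) x = (LINT y|torus. partial_d j (eta n) (x - y) *\<^sub>R f y)"
    and "integrable torus (\<lambda>y. partial_d j (eta n) (x - y) *\<^sub>R f y)"
  using finite_rank_operator(2,3)[OF eta_finite_rank assms, of j n x]
  by (simp_all add: mol_def[abs_def] partial_d_eta(1))

lemma partial_d_mol:
  assumes "weak_partial j f g"
  shows "partial_d j (mol n f) x = mol n g x"
proof -
  have f: "integrable torus f" using assms by (simp add: weak_partial_def)
  have "partial_d j (mol n f) x = - (LINT y|torus. f y * partial_d j (\<lambda>y. eta n (x - y)) y)"
    unfolding partial_d_mol_kernel(1)[OF f] partial_d_eta by (simp add: mult.commute)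
  also have "\<dots> = (LINT y|torus. g y * eta n (x - y))"
    using assms finite_rank_smooth(2)[OF eta_finite_rank, of n x] by (simp add: weak_partial_def)
  finally show ?thesis by (simp add: mol_def mult.commute)
qed

text \<open>
  The graph of \<open>t powr p\<close> lies above its tangent at \<open>s\<close>; integrated against a probability density with \<open>s\<close> the
  mean, this is Jensen's inequality.
\<close>

lemma powr_tangent:
  fixes s t p :: real
  assumes p: "p > 1" and s: "s \<ge> 0" and t: "t \<ge> 0"
  shows "p * s powr (p - 1) * t \<le> t powr p + (p - 1) * s powr p"
proof -
  have "t * s powr (p - 1) \<le> t powr p / p + (s powr (p - 1)) powr (p / (p - 1)) / (p / (p - 1))"
    by (rule Youngs_inequality) (use assms in \<open>auto simp: field_simps\<close>)
  also have "(s powr (p - 1)) powr (p / (p - 1)) = s powr p"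
    using p by (simp add: powr_powr)
  finally have "p * (t * s powr (p - 1)) \<le> p * (t powr p / p + s powr p / (p / (p - 1)))"
    using p by (intro mult_left_mono) auto
  also have "p * (t powr p / p + s powr p / (p / (p - 1))) = t powr p + (p - 1) * s powr p"
    using p by (simp add: field_simps)
  finally show ?thesis by (simp add: mult_ac)
qed

lemma Jensen_powr:
  fixes w h :: "'a \<Rightarrow> real"
  assumes p: "p > 1" and w: "integrable M w" "\<And>x. w x \<ge> 0" "(LINT x|M. w x) = 1"
    and h: "\<And>x. h x \<ge> 0" "integrable M (\<lambda>x. w x * h x)" "integrable M (\<lambda>x. w x * h x powr p)"
  shows "(LINT x|M. w x * h x) powr p \<le> (LINT x|M. w x * h x powr p)"
proof -
  define s where "s = (LINT x|M. w x * h x)"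
  have s: "s \<ge> 0" unfolding s_def by (rule Bochner_Integration.integral_nonneg) (simp add: w h)
  have sp: "s powr (p - 1) * s = s powr p"
    using powr_mult_base[OF s, of "p - 1"] by (simp add: mult.commute)
  have "(LINT x|M. p * s powr (p - 1) * (w x * h x)) \<le> (LINT x|M. w x * h x powr p + (p - 1) * s powr p * w x)"
  proof (rule integral_mono)
    show "integrable M (\<lambda>x. p * s powr (p - 1) * (w x * h x))" by (rule integrable_mult_right[OF h(2)])
    show "integrable M (\<lambda>x. w x * h x powr p + (p - 1) * s powr p * w x)"
      by (rule Bochner_Integration.integrable_add[OF h(3) integrable_mult_right[OF w(1)]])
    fix x
    have "w x * (p * s powr (p - 1) * h x) \<le> w x * (h x powr p + (p - 1) * s powr p)"
      by (rule mult_left_mono[OF powr_tangent[OF p s h(1)] w(2)])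
    then show "p * s powr (p - 1) * (w x * h x) \<le> w x * h x powr p + (p - 1) * s powr p * w x"
      by (simp add: algebra_simps)
  qed
  also have "\<dots> = (LINT x|M. w x * h x powr p) + (p - 1) * s powr p"
    using Bochner_Integration.integral_add[OF h(3) integrable_mult_right[OF w(1), of "(p - 1) * s powr p"]] w(3)
    by simp
  also have "(LINT x|M. p * s powr (p - 1) * (w x * h x)) = p * (s powr (p - 1) * s)"
    unfolding s_def by simp
  finally show ?thesis unfolding sp by (simp add: s_def algebra_simps)
qed

lemma mol_Jensen:
  fixes f :: "real^3 \<Rightarrow> 'b::euclidean_space"
  assumes p: "p > 1" and f: "integrable torus f" and fp: "integrable torus (\<lambda>y. norm (f y) powr p)"
  shows "norm (mol n f x) powr p \<le> mol n (\<lambda>y. norm (f y) powr p) x"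
proof -
  have 1: "integrable torus (\<lambda>y. eta n (x - y) * norm (f y))"
    using mol_integrand[OF integrable_norm[OF f], of n x] by simp
  have 2: "integrable torus (\<lambda>y. eta n (x - y) * norm (f y) powr p)"
    using mol_integrand[OF fp, of n x] by simp
  have "norm (mol n f x) \<le> (LINT y|torus. norm (eta n (x - y) *\<^sub>R f y))"
    unfolding mol_def by (rule integral_norm_bound)
  then have "norm (mol n f x) \<le> (LINT y|torus. eta n (x - y) * norm (f y))"
    by (simp add: eta_nonneg)
  then have "norm (mol n f x) powr p \<le> (LINT y|torus. eta n (x - y) * norm (f y)) powr p"
    using p by (intro powr_mono2) auto
  also have "\<dots> \<le> (LINT y|torus. eta n (x - y) * norm (f y) powr p)"
    by (rule Jensen_powr[OF p integrable_smooth_periodic[OF finite_rank_smooth(2)[OF eta_finite_rank]]])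
       (auto simp: eta_nonneg eta_integral_diff 1 2)
  finally show ?thesis by (simp add: mol_def)
qed

lemma mol_const: "mol n (\<lambda>x. c) x = c"
  unfolding mol_def
  using integral_scaleR_left[of c torus "\<lambda>y. eta n (x - y)"]
    integrable_smooth_periodic[OF finite_rank_smooth(2)[OF eta_finite_rank, of n x]]
  by (simp add: eta_integral_diff)

lemma mol_integral:
  fixes f :: "real^3 \<Rightarrow> real"
  assumes "integrable torus f"
  shows "(LINT x|torus. mol n f x) = (LINT x|torus. f x)"
  using mol_symmetric[OF assms integrable_torus_const[of 1], of n] by (simp add: mol_const)

lemma mol_Lp:
  fixes f :: "real^3 \<Rightarrow> 'b::euclidean_space"
  assumes p: "p > 1" and f: "integrable torus f" and fp: "integrable torus (\<lambda>y. norm (f y) powr p)"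
  shows "(LINT x|torus. norm (mol n f x) powr p) \<le> (LINT x|torus. norm (f x) powr p)"
proof -
  have "(LINT x|torus. norm (mol n f x) powr p) \<le> (LINT x|torus. mol n (\<lambda>y. norm (f y) powr p) x)"
  proof (rule integral_mono)
    show "integrable torus (\<lambda>x. norm (mol n f x) powr p)"
      by (rule integrable_torus_continuous, rule continuous_on_powr')
         (use p in \<open>auto intro!: continuous_intros smooth_periodicD(3)[OF mol_smooth[OF f]]\<close>)
    show "integrable torus (mol n (\<lambda>y. norm (f y) powr p))"
      by (rule integrable_smooth_periodic[OF mol_smooth[OF fp]])
  qed (rule mol_Jensen[OF p f fp])
  then show ?thesis by (simp add: mol_integral[OF fp])
qed

text \<open>The density of the averaging measure is at most a multiple of \<open>sqrt (n + 1) ^ 3\<close>.\<close>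

lemma mol_sup:
  fixes f :: "real^3 \<Rightarrow> 'b::euclidean_space"
  assumes p: "p > 1" and f: "integrable torus f" and fp: "integrable torus (\<lambda>y. norm (f y) powr p)"
  shows "norm (mol n f x) powr p \<le> 3 * sqrt (real (Suc n)) ^ 3 * (LINT x|torus. norm (f x) powr p)"
proof -
  have "mol n (\<lambda>y. norm (f y) powr p) x \<le> (LINT y|torus. 3 * sqrt (real (Suc n)) ^ 3 * norm (f y) powr p)"
    unfolding mol_def real_scaleR_def
  proof (rule integral_mono)
    show "integrable torus (\<lambda>y. eta n (x - y) * norm (f y) powr p)"
      using mol_integrand[OF fp, of n x] by simp
    show "integrable torus (\<lambda>y. 3 * sqrt (real (Suc n)) ^ 3 * norm (f y) powr p)"
      by (rule integrable_mult_right[OF fp])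
  qed (intro mult_right_mono eta_le powr_ge_zero)
  with mol_Jensen[OF p f fp, of n x] show ?thesis by simp
qed

lemma mol_L2: "f \<in> L2 \<Longrightarrow> mol n f \<in> L2"
  by (rule smooth_periodic_L2[OF mol_smooth[OF L2_integrable]])

lemma mol_Lp_norm_2_le:
  assumes "f \<in> L2" shows "Lp_norm 2 (mol n f) \<le> Lp_norm 2 f"
  using mol_Lp[of 2 f n, OF _ L2_integrable[OF assms]] L2D(3)[OF assms]
  by (simp add: Lp_norm_2 ip_self_eq norm_powr_two)

lemma mol_ip: "f \<in> L2 \<Longrightarrow> g \<in> L2 \<Longrightarrow> ip (mol n f) g = ip f (mol n g)"
  unfolding ip_def by (rule mol_symmetric) (rule L2_integrable, assumption)+

section \<open>Translation of smooth periodic fields\<close>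

text \<open>\<open>dist2 z\<close> is comparable to the squared distance of \<open>z\<close> from the period lattice.\<close>

definition dist2 :: "real^3 \<Rightarrow> real" where
  "dist2 z = (\<Sum>i\<in>UNIV. 1 - cos (z $ i))"

text \<open>A weak form of Jordan's inequality, from the mean value theorem up to \<open>pi / 3\<close> and monotonicity beyond.\<close>

lemma sin_ge_quarter: assumes "0 \<le> t" "t \<le> pi / 2" shows "t / 4 \<le> sin t"
proof (cases "t \<le> pi / 3")
  case True
  show ?thesis
  proof (cases "t = 0")
    case False
    then have t: "0 < t" using assms by simp
    obtain \<xi> where \<xi>: "0 < \<xi>" "\<xi> < t" "sin t - sin 0 = (t - 0) * cos \<xi>"
      using MVT2[OF t, of sin cos] by auto
    have "cos (pi / 3) \<le> cos \<xi>" using \<xi> True pi_gt3 by (intro cos_monotone_0_pi_le) auto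
    then have "t * (1 / 2) \<le> t * cos \<xi>" using t by (intro mult_left_mono) (simp_all add: cos_60)
    then show ?thesis using \<xi> t by simp
  qed simp
next
  case False
  have "sin (pi / 6) \<le> sin t" using False assms pi_gt3 by (intro sin_monotone_2pi_le) auto
  then show ?thesis using assms pi_less_4 by (simp add: sin_30)
qed

lemma square_le_one_minus_cos: assumes "\<bar>s\<bar> \<le> pi" shows "s\<^sup>2 \<le> 32 * (1 - cos s)"
proof -
  have "\<bar>s\<bar> / 2 / 4 \<le> sin (\<bar>s\<bar> / 2)" by (rule sin_ge_quarter) (use assms in auto)
  then have "(\<bar>s\<bar> / 8)\<^sup>2 \<le> (sin (\<bar>s\<bar> / 2))\<^sup>2" by (intro power_mono) auto
  moreover have "1 - cos s = 2 * (sin (\<bar>s\<bar> / 2))\<^sup>2"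
    using cos_double_sin[of "\<bar>s\<bar> / 2"] by simp
  ultimately show ?thesis by (simp add: power_divide)
qed

lemma lattice_representative:
  obtains k :: "3 \<Rightarrow> int" where "(norm (z + (\<chi> i. 2 * pi * of_int (k i)) :: real^3))\<^sup>2 \<le> 32 * dist2 z"
proof -
  define k where "k i = - round (z $ i / (2 * pi))" for i
  define z' where "z' = z + (\<chi> i. 2 * pi * of_int (k i))"
  have z': "(z' $ i)\<^sup>2 \<le> 32 * (1 - cos (z $ i))" for i
  proof -
    have "\<bar>of_int (round (z $ i / (2 * pi))) - z $ i / (2 * pi)\<bar> \<le> 1 / 2" by (rule of_int_round_abs_le)
    then have "2 * pi * \<bar>of_int (round (z $ i / (2 * pi))) - z $ i / (2 * pi)\<bar> \<le> 2 * pi * (1 / 2)"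
      by (intro mult_left_mono) auto
    moreover have "z' $ i = - (2 * pi * (of_int (round (z $ i / (2 * pi))) - z $ i / (2 * pi)))"
      by (simp add: z'_def k_def algebra_simps)
    ultimately have "\<bar>z' $ i\<bar> \<le> pi" by (simp add: abs_mult)
    then have "(z' $ i)\<^sup>2 \<le> 32 * (1 - cos (z' $ i))" by (rule square_le_one_minus_cos)
    moreover have "cos (z' $ i) = cos (z $ i)"
      using cos_eq[of "z' $ i" "z $ i"] by (simp add: z'_def)
        (metis Ints_of_int mult.assoc mult.commute)
    ultimately show ?thesis by simp
  qed
  have "(norm z')\<^sup>2 = (\<Sum>i\<in>UNIV. (z' $ i)\<^sup>2)"
    unfolding power2_norm_eq_inner inner_vec_def by (simp add: power2_eq_square)
  also have "\<dots> \<le> (\<Sum>i\<in>UNIV. 32 * (1 - cos (z $ i)))" by (rule sum_mono) (rule z')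
  finally show ?thesis using that unfolding z'_def dist2_def sum_distrib_left by blast
qed

lemma dist2_smooth: "smooth_periodic dist2"
  unfolding dist2_def[abs_def]
  by (intro smooth_periodic_sum smooth_periodic_diff smooth_periodic_const smooth_periodic_coordinate_trig)

lemma dist2_nonneg: "0 \<le> dist2 z"
  unfolding dist2_def by (intro sum_nonneg) (simp add: cos_le_one)

lemma eta_dist2: "(LINT z|torus. eta n z * dist2 z) = 3 / real (Suc n)"
proof -
  have "(LINT z|torus. eta n z * dist2 z) = (LINT z|torus. (\<Sum>i\<in>UNIV. (1 - cos (z $ i)) * eta n z))"
    by (simp add: dist2_def sum_distrib_left mult.commute)
  also have "\<dots> = (\<Sum>i\<in>(UNIV::3 set). LINT z|torus. (1 - cos (z $ i)) * eta n z)"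
    by (rule Bochner_Integration.integral_sum)
       (intro integrable_smooth_periodic smooth_periodic_mult smooth_periodic_diff smooth_periodic_const
         smooth_periodic_coordinate_trig eta_smooth)
  finally show ?thesis by (simp add: eta_second_moment)
qed

text \<open>The Jacobian matrix, with the index conventions of \<open>has_weak_grad\<close>.\<close>

definition grad :: "(real^3 \<Rightarrow> real^3) \<Rightarrow> real^3 \<Rightarrow> real^3^3" where
  "grad u x = (\<chi> i j. partial_d j u x $ i)"

lemma norm_matrix_vector_le: "norm ((A::real^3^3) *v z) \<le> norm A * norm z"
proof (rule power2_le_imp_le)
  have n2: "(norm (v::'a::real_inner^3))\<^sup>2 = (\<Sum>i\<in>UNIV. (norm (v $ i))\<^sup>2)" for v
    unfolding power2_norm_eq_inner inner_vec_def by simp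
  have "(norm (A *v z))\<^sup>2 = (\<Sum>i\<in>UNIV. (norm ((A $ i) \<bullet> z))\<^sup>2)"
    by (simp add: n2 matrix_vector_mul_component)
  also have "\<dots> \<le> (\<Sum>i\<in>UNIV. (norm (A $ i) * norm z)\<^sup>2)"
    by (intro sum_mono power_mono) (simp_all add: Cauchy_Schwarz_ineq2)
  also have "\<dots> = (norm A * norm z)\<^sup>2"
    by (simp add: power_mult_distrib n2[of A] sum_distrib_right)
  finally show "(norm (A *v z))\<^sup>2 \<le> (norm A * norm z)\<^sup>2" .
qed simp

lemma grad_mult: "grad u x *v z = (\<Sum>j\<in>UNIV. (z $ j) *\<^sub>R partial_d j u x)"
  by (simp add: vec_eq_iff grad_def matrix_vector_mult_def mult.commute)

lemma grad_continuous:
  assumes "smooth_periodic u" shows "continuous_on UNIV (grad u)"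
  unfolding grad_def
  by (intro continuous_on_vec_lambda continuous_intros smooth_periodicD(3)[OF smooth_periodic_derivative(2)[OF assms]])

lemma grad_periodic:
  assumes "smooth_periodic u" shows "torus_periodic (grad u)"
  using smooth_periodicD(2)[OF smooth_periodic_derivative(2)[OF assms]]
  by (simp add: grad_def torus_periodic_def)

lemma norm_diff_le_integral_grad:
  assumes u: "smooth_periodic u"
  shows "norm (u (x + z) - u x) \<le> integral {0..1} (\<lambda>s. norm (grad u (x + s *\<^sub>R z))) * norm z"
proof -
  have cg: "continuous_on {0..1} (\<lambda>s. grad u (x + s *\<^sub>R z))"
    by (rule continuous_on_compose2[OF grad_continuous[OF u]]) (auto intro!: continuous_intros)
  have cn: "continuous_on {0..1} (\<lambda>s. norm (grad u (x + s *\<^sub>R z)) * norm z)"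
    by (intro continuous_intros cg)
  have deriv: "((\<lambda>s. u (x + s *\<^sub>R z)) has_vector_derivative grad u (x + s *\<^sub>R z) *v z) (at s within {0..1})" for s
  proof -
    have "((\<lambda>s. u (x + s *\<^sub>R z)) has_derivative
        (\<lambda>h. \<Sum>j\<in>UNIV. ((h *\<^sub>R z) $ j) *\<^sub>R partial_d j u (x + s *\<^sub>R z))) (at s within {0..1})"
      by (rule has_derivative_compose[where f = "\<lambda>s. x + s *\<^sub>R z" and f' = "\<lambda>h. h *\<^sub>R z",
            OF _ smooth_periodic_derivative(1)[OF u]])
         (auto intro!: derivative_eq_intros)
    then show ?thesis
      by (simp add: has_vector_derivative_def grad_mult scaleR_sum_right)
  qed
  from fundamental_theorem_of_calculus[OF _ deriv]
  have hi: "((\<lambda>s. grad u (x + s *\<^sub>R z) *v z) has_integral (u (x + z) - u x)) {0..1}"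
    by simp
  have "norm (integral {0..1} (\<lambda>s. grad u (x + s *\<^sub>R z) *v z)) \<le>
      integral {0..1} (\<lambda>s. norm (grad u (x + s *\<^sub>R z)) * norm z)"
    by (rule Henstock_Kurzweil_Integration.integral_norm_bound_integral)
       (use hi in \<open>auto intro: integrable_continuous_real cn norm_matrix_vector_le\<close>)
  then show ?thesis using integral_unique[OF hi] by simp
qed

lemma translation_sup_bound:
  assumes u: "smooth_periodic u" and L: "\<And>x. norm (grad u x) \<le> L"
  shows "(norm (u (x + z) - u x))\<^sup>2 \<le> 32 * L\<^sup>2 * dist2 z"
proof -
  obtain k where k: "(norm (z + (\<chi> i. 2 * pi * of_int (k i)) :: real^3))\<^sup>2 \<le> 32 * dist2 z"
    by (rule lattice_representative)
  define z' where "z' = z + (\<chi> i. 2 * pi * of_int (k i))"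
  have ux: "u (x + z) = u (x + z')"
    unfolding z'_def add.assoc[symmetric] by (rule periodic_lattice[OF smooth_periodicD(2)[OF u], symmetric])
  have "integral {0..1} (\<lambda>s. norm (grad u (x + s *\<^sub>R z'))) \<le> integral {0..1} (\<lambda>s::real. L)"
  proof (rule integral_le)
    show "(\<lambda>s. norm (grad u (x + s *\<^sub>R z'))) integrable_on {0..1}"
      by (intro integrable_continuous_real continuous_on_norm continuous_on_compose2[OF grad_continuous[OF u]])
         (auto intro!: continuous_intros)
  qed (use L in auto)
  then have "norm (u (x + z') - u x) \<le> L * norm z'"
    using norm_diff_le_integral_grad[OF u, of x z'] by (simp add: mult_right_mono order_trans)
  then have "(norm (u (x + z') - u x))\<^sup>2 \<le> (L * norm z')\<^sup>2" by (intro power_mono) auto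
  also have "\<dots> = L\<^sup>2 * (norm z')\<^sup>2" by (simp add: power_mult_distrib)
  also have "\<dots> \<le> L\<^sup>2 * (32 * dist2 z)" using k by (intro mult_left_mono) (auto simp: z'_def)
  finally show ?thesis by (simp add: ux)
qed

text \<open>
  Along the segment from \<open>x\<close> to \<open>x + z\<close> the difference is at most the mean of the gradient; Jensen's
  inequality, the exchange of the two integrals and translation invariance give the bound.
\<close>

lemma translation_Lp_bound:
  assumes u: "smooth_periodic u" and p: "p > 1"
  shows "(LINT x|torus. norm (u (x + z) - u x) powr p) \<le> norm z powr p * (LINT x|torus. norm (grad u x) powr p)"
proof -
  define g where "g x = norm (grad u x) powr p" for x
  have cg: "continuous_on UNIV g"
    unfolding g_def by (rule continuous_on_powr') (use p grad_continuous[OF u] in \<open>auto intro: continuous_intros\<close>)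
  have pg: "torus_periodic g" using grad_periodic[OF u] by (simp add: g_def torus_periodic_def)
  have cgs: "continuous_on S (\<lambda>s. g (x + s *\<^sub>R z))" for x S
    by (rule continuous_on_compose2[OF cg]) (auto intro!: continuous_intros)
  have cns: "continuous_on S (\<lambda>s. norm (grad u (x + s *\<^sub>R z)))" for x S
    by (intro continuous_on_norm continuous_on_compose2[OF grad_continuous[OF u]]) (auto intro!: continuous_intros)
  have point: "norm (u (x + z) - u x) powr p \<le> norm z powr p * integral {0..1} (\<lambda>s. g (x + s *\<^sub>R z))" for x
  proof -
    have "(LINT s|lebesgue_on {0..1}. 1 * norm (grad u (x + s *\<^sub>R z))) powr p \<le>
        (LINT s|lebesgue_on {0..1}. 1 * norm (grad u (x + s *\<^sub>R z)) powr p)"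
    proof (rule Jensen_powr[OF p])
      show "integrable (lebesgue_on {0..1::real}) (\<lambda>s. 1::real)" by (rule continuous_imp_integrable_real) simp
      show "(LINT s|lebesgue_on {0..1::real}. 1::real) = 1" by (simp add: measure_restrict_space)
      show "integrable (lebesgue_on {0..1}) (\<lambda>s. 1 * norm (grad u (x + s *\<^sub>R z)))"
        using cns by (simp add: continuous_imp_integrable_real)
      show "integrable (lebesgue_on {0..1}) (\<lambda>s. 1 * norm (grad u (x + s *\<^sub>R z)) powr p)"
        using cgs by (simp add: g_def continuous_imp_integrable_real)
    qed auto
    then have J: "integral {0..1} (\<lambda>s. norm (grad u (x + s *\<^sub>R z))) powr p \<le> integral {0..1} (\<lambda>s. g (x + s *\<^sub>R z))"
      using lebesgue_integral_eq_integral[OF continuous_imp_integrable_real[OF cns], of 0 1 x]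
        lebesgue_integral_eq_integral[OF continuous_imp_integrable_real[OF cgs], of 0 1 x]
      by (simp add: g_def)
    have "norm (u (x + z) - u x) powr p \<le> (integral {0..1} (\<lambda>s. norm (grad u (x + s *\<^sub>R z))) * norm z) powr p"
      using p by (intro powr_mono2 norm_diff_le_integral_grad[OF u]) auto
    also have "\<dots> = integral {0..1} (\<lambda>s. norm (grad u (x + s *\<^sub>R z))) powr p * norm z powr p"
      by (intro powr_mult)
    also have "\<dots> \<le> integral {0..1} (\<lambda>s. g (x + s *\<^sub>R z)) * norm z powr p"
      by (intro mult_right_mono J) simp
    finally show ?thesis by (simp add: mult.commute)
  qed
  define w :: "real^3" where "w = (\<chi> i. 2 * pi)"
  have cell: "torus_cell = cbox 0 w" by (simp add: torus_cell_def w_def)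
  have c2: "continuous_on (cbox (0, 0) (w, 1)) (\<lambda>(x, s). g (x + s *\<^sub>R z))"
    unfolding case_prod_beta by (rule continuous_on_compose2[OF cg]) (auto intro!: continuous_intros)
  have cint: "continuous_on UNIV (\<lambda>x. integral {0..1} (\<lambda>s. g (x + s *\<^sub>R z)))"
  proof -
    have "continuous_on (UNIV \<times> cbox 0 (1::real)) (\<lambda>(x, s). g (x + s *\<^sub>R z))"
      unfolding case_prod_beta by (rule continuous_on_compose2[OF cg]) (auto intro!: continuous_intros)
    from integral_continuous_on_param[OF this] show ?thesis by simp
  qed
  have cu: "continuous_on UNIV (\<lambda>x. norm (u (x + z) - u x) powr p)"
    by (rule continuous_on_powr')
       (use p in \<open>auto intro!: continuous_intros continuous_shift smooth_periodicD(3)[OF u]\<close>)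
  have "(LINT x|torus. norm (u (x + z) - u x) powr p) \<le>
      (LINT x|torus. norm z powr p * integral {0..1} (\<lambda>s. g (x + s *\<^sub>R z)))"
    by (rule integral_mono[OF integrable_torus_continuous[OF cu]
          integrable_mult_right[OF integrable_torus_continuous[OF cint]] point])
  also have "\<dots> = norm z powr p * integral torus_cell (\<lambda>x. integral {0..1} (\<lambda>s. g (x + s *\<^sub>R z)))"
    by (simp add: LINT_torus_eq_integral[OF integrable_torus_continuous[OF cint]])
  also have "integral torus_cell (\<lambda>x. integral {0..1} (\<lambda>s. g (x + s *\<^sub>R z))) =
      integral {0..1} (\<lambda>s. integral torus_cell (\<lambda>x. g (x + s *\<^sub>R z)))"
    using integral_swap_continuous[OF c2] unfolding cell by simp
  also have "\<dots> = integral {0..1} (\<lambda>s::real. LINT x|torus. g x)"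
  proof (rule arg_cong[where f = "integral {0..1}"], rule ext)
    fix s :: real
    show "integral torus_cell (\<lambda>x. g (x + s *\<^sub>R z)) = (LINT x|torus. g x)"
      using LINT_torus_shift[OF pg cg, of "s *\<^sub>R z"]
        LINT_torus_eq_integral[OF integrable_torus_continuous[OF continuous_shift[OF cg]], of "s *\<^sub>R z"]
      by simp
  qed
  finally show ?thesis by (simp add: g_def)
qed

text \<open>The error is an average of increments, whose mean square is controlled by the second moment of the kernel.\<close>

lemma mol_smooth_error:
  assumes u: "smooth_periodic u" and L: "\<And>x. norm (grad u x) \<le> L"
  shows "(norm (mol n u x - u x))\<^sup>2 \<le> 96 * L\<^sup>2 / real (Suc n)"
proof -
  have us: "integrable torus (\<lambda>y. u y - u x)"
    by (rule integrable_smooth_periodic[OF smooth_periodic_diff[OF u smooth_periodic_const]])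
  have cu: "continuous_on UNIV (\<lambda>y. u y - u x)" by (intro continuous_intros smooth_periodicD(3)[OF u])
  have us2: "integrable torus (\<lambda>y. norm (u y - u x) powr 2)"
    unfolding norm_powr_two by (intro integrable_torus_continuous continuous_intros cu)
  have "mol n u x - u x = mol n (\<lambda>y. u y - u x) x"
    by (subst mol_diff) (simp_all add: mol_const integrable_smooth_periodic[OF u])
  then have "(norm (mol n u x - u x))\<^sup>2 \<le> mol n (\<lambda>y. norm (u y - u x) powr 2) x"
    using mol_Jensen[of 2, OF _ us us2, of n x] by (simp add: norm_powr_two)
  also have "\<dots> \<le> (LINT y|torus. 32 * L\<^sup>2 * (eta n (y - x) * dist2 (y - x)))"
    unfolding mol_def
  proof (rule integral_mono)
    show "integrable torus (\<lambda>y. eta n (x - y) *\<^sub>R norm (u y - u x) powr 2)" by (rule mol_integrand[OF us2])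
    show "integrable torus (\<lambda>y. 32 * L\<^sup>2 * (eta n (y - x) * dist2 (y - x)))"
      using continuous_shift[OF smooth_periodicD(3)[OF smooth_periodic_mult[OF eta_smooth dist2_smooth]], of n "- x"]
      by (intro integrable_mult_right integrable_torus_continuous) simp
    fix y
    have "(norm (u (x + (y - x)) - u x))\<^sup>2 \<le> 32 * L\<^sup>2 * dist2 (y - x)" by (rule translation_sup_bound[OF u L])
    then have "eta n (x - y) * (norm (u y - u x))\<^sup>2 \<le> eta n (x - y) * (32 * L\<^sup>2 * dist2 (y - x))"
      by (intro mult_left_mono eta_nonneg) simp
    then show "eta n (x - y) *\<^sub>R norm (u y - u x) powr 2 \<le> 32 * L\<^sup>2 * (eta n (y - x) * dist2 (y - x))"
      by (simp add: norm_powr_two eta_diff_commute[of n x] mult_ac)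
  qed
  also have "\<dots> = 32 * L\<^sup>2 * (LINT y|torus. eta n (y + - x) * dist2 (y + - x))" by simp
  also have "(LINT y|torus. eta n (y + - x) * dist2 (y + - x)) = (LINT y|torus. eta n y * dist2 y)"
    by (rule LINT_torus_shift[OF smooth_periodicD(2,3)[OF smooth_periodic_mult[OF eta_smooth dist2_smooth]]])
  finally show ?thesis by (simp add: eta_dist2)
qed

lemma mol_smooth_L2_lim:
  fixes u :: "real^3 \<Rightarrow> real^3"
  assumes u: "smooth_periodic u"
  shows "L2_lim (\<lambda>n. mol n u) u"
proof -
  obtain L where L: "\<And>x. norm (grad u x) \<le> L"
    using periodic_bounded[OF grad_periodic[OF u] grad_continuous[OF u]] by blast
  define V where "V = (LINT x|torus. 1::real)"
  have uL: "u \<in> L2" by (rule smooth_periodic_L2[OF u])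
  have bound: "Lp_norm 2 (\<lambda>x. mol n u x - u x) \<le> sqrt (96 * L\<^sup>2 * V) * inverse (sqrt (real (Suc n)))" for n
  proof -
    have "ip (\<lambda>x. mol n u x - u x) (\<lambda>x. mol n u x - u x) \<le> (LINT x|torus. 96 * L\<^sup>2 / real (Suc n) * 1)"
      unfolding ip_self_eq
      by (rule integral_mono[OF L2D(3)[OF L2_diff[OF mol_L2[OF uL] uL]]])
         (use mol_smooth_error[OF u L] in \<open>simp_all del: of_nat_Suc\<close>)
    also have "\<dots> = 96 * L\<^sup>2 * V / real (Suc n)" unfolding V_def by simp
    finally have "Lp_norm 2 (\<lambda>x. mol n u x - u x) \<le> sqrt (96 * L\<^sup>2 * V / real (Suc n))"
      unfolding Lp_norm_2 by (rule real_sqrt_le_mono)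
    then show ?thesis by (simp only: divide_inverse real_sqrt_mult real_sqrt_inverse)
  qed
  have lim: "(\<lambda>n. sqrt (96 * L\<^sup>2 * V) * inverse (sqrt (real (Suc n)))) \<longlonglongrightarrow> sqrt (96 * L\<^sup>2 * V) * 0"
    by (intro tendsto_mult tendsto_const tendsto_inverse_0_at_top
        filterlim_compose[OF sqrt_at_top filterlim_compose[OF filterlim_real_sequentially filterlim_Suc]])
  have "(\<lambda>n. Lp_norm 2 (\<lambda>x. mol n u x - u x)) \<longlonglongrightarrow> 0"
    by (rule tendsto_sandwich[OF _ _ tendsto_const lim[unfolded mult_zero_right]])
       (use bound in \<open>auto intro!: always_eventually Lp_norm_2_nonneg simp del: of_nat_Suc\<close>)
  then show ?thesis using uL mol_L2[OF uL] by (simp add: L2_lim_def)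
qed

text \<open>Mollification is a contraction, so that convergence passes to limits of smooth fields.\<close>

lemma mol_L2_lim:
  fixes f :: "real^3 \<Rightarrow> real^3"
  assumes f: "f \<in> L2" and dense: "\<And>e. e > 0 \<Longrightarrow> \<exists>g. smooth_periodic g \<and> Lp_norm 2 (\<lambda>x. f x - g x) < e"
  shows "L2_lim (\<lambda>n. mol n f) f"
proof -
  have "(\<lambda>n. Lp_norm 2 (\<lambda>x. mol n f x - f x)) \<longlonglongrightarrow> 0"
  proof (rule LIMSEQ_I)
    fix e :: real assume e: "e > 0"
    then obtain g where g: "smooth_periodic g" "Lp_norm 2 (\<lambda>x. f x - g x) < e / 3"
      using dense[of "e / 3"] by auto
    have gL: "g \<in> L2" by (rule smooth_periodic_L2[OF g(1)])
    have "(\<lambda>n. Lp_norm 2 (\<lambda>x. mol n g x - g x)) \<longlonglongrightarrow> 0"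
      using mol_smooth_L2_lim[OF g(1)] by (simp add: L2_lim_def)
    from LIMSEQ_D[OF this, of "e / 3"] e
    obtain N where N: "\<And>n. n \<ge> N \<Longrightarrow> norm (Lp_norm 2 (\<lambda>x. mol n g x - g x) - 0) < e / 3" by auto
    have "norm (Lp_norm 2 (\<lambda>x. mol n f x - f x) - 0) < e" if n: "n \<ge> N" for n
    proof -
      note L = mol_L2[OF f, of n] mol_L2[OF gL, of n] f gL
      have "Lp_norm 2 (\<lambda>x. (mol n f x - mol n g x) + ((mol n g x - g x) + (g x - f x))) \<le>
          Lp_norm 2 (\<lambda>x. mol n f x - mol n g x) + Lp_norm 2 (\<lambda>x. (mol n g x - g x) + (g x - f x))"
        by (rule Lp_norm_2_triangle[OF L2_diff L2_add[OF L2_diff L2_diff]]) (rule L)+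
      moreover have "Lp_norm 2 (\<lambda>x. (mol n g x - g x) + (g x - f x)) \<le>
          Lp_norm 2 (\<lambda>x. mol n g x - g x) + Lp_norm 2 (\<lambda>x. g x - f x)"
        by (rule Lp_norm_2_triangle[OF L2_diff L2_diff]) (rule L)+
      moreover have "Lp_norm 2 (\<lambda>x. mol n f x - mol n g x) \<le> Lp_norm 2 (\<lambda>x. f x - g x)"
      proof -
        have "(\<lambda>x. mol n f x - mol n g x) = mol n (\<lambda>x. f x - g x)"
          by (simp add: fun_eq_iff mol_diff L2_integrable f gL)
        then show ?thesis using mol_Lp_norm_2_le[OF L2_diff[OF f gL], of n] by simp
      qed
      moreover have "(\<lambda>x. (mol n f x - mol n g x) + ((mol n g x - g x) + (g x - f x))) = (\<lambda>x. mol n f x - f x)"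
        by (simp add: fun_eq_iff)
      ultimately have "Lp_norm 2 (\<lambda>x. mol n f x - f x) < e"
        using g(2) N[OF n] Lp_norm_minus_commute[of 2 f g] by simp
      then show ?thesis by (simp add: Lp_norm_2_nonneg)
    qed
    then show "\<exists>N. \<forall>n\<ge>N. norm (Lp_norm 2 (\<lambda>x. mol n f x - f x) - 0) < e" by blast
  qed
  then show ?thesis using f mol_L2[OF f] by (simp add: L2_lim_def)
qed

section \<open>The energy flux through scale \<open>n\<close>\<close>

text \<open>
  The nonlinear term of the weak formulation.  At \<open>\<phi> = mol n (mol n u)\<close> it is the rate at which \<open>u\<close> loses or
  gains energy at scales larger than \<open>1 / sqrt (n + 1)\<close>.
\<close>

definition flux_form :: "(real^3 \<Rightarrow> real^3) \<Rightarrow> (real^3 \<Rightarrow> real^3) \<Rightarrow> real" where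
  "flux_form u \<phi> = (LINT x|torus. u x \<bullet> (grad \<phi> x *v u x))"

definition outer :: "real^3 \<Rightarrow> real^3^3" where
  "outer a = (\<chi> i j. a $ i * a $ j)"

lemma inner_matrix_vector: "a \<bullet> (A *v a) = A \<bullet> outer a"
  by (simp add: inner_vec_def matrix_vector_mult_def outer_def sum_distrib_left mult_ac)

lemma abs_inner_matrix_vector_le: "\<bar>a \<bullet> (A *v a)\<bar> \<le> norm (A::real^3^3) * (norm a)\<^sup>2"
proof -
  have "\<bar>a \<bullet> (A *v a)\<bar> \<le> norm a * norm (A *v a)" by (rule Cauchy_Schwarz_ineq2)
  also have "\<dots> \<le> norm a * (norm A * norm a)" by (intro mult_left_mono norm_matrix_vector_le) simp
  finally show ?thesis by (simp add: power2_eq_square mult_ac)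
qed

lemma outer_smooth: assumes "smooth_periodic u" shows "continuous_on UNIV (\<lambda>x. outer (u x))"
  unfolding outer_def
  by (intro continuous_on_vec_lambda continuous_intros smooth_periodicD(3)[OF assms])

text \<open>Mollification commutes with differentiation, also in the sense of distributions.\<close>

lemma grad_mol:
  fixes u :: "real^3 \<Rightarrow> real^3"
  assumes u: "integrable torus u" and G: "integrable torus G"
    and w: "\<And>i j. weak_partial j (\<lambda>x. u x $ i) (\<lambda>x. G x $ i $ j)"
  shows "grad (mol n u) = mol n G"
proof
  fix x
  have "partial_d j (mol n u) x $ i = mol n G x $ i $ j" for i j
  proof -
    have "partial_d j (mol n u) x $ i = partial_d j (\<lambda>x. mol n u x $ i) x"
      by (rule partial_d_component[OF mol_smooth[OF u], symmetric])
    also have "\<dots> = partial_d j (mol n (\<lambda>x. u x $ i)) x"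
      using mol_component[OF u, of n i] by presburger
    also have "\<dots> = mol n (\<lambda>x. G x $ i $ j) x" by (rule partial_d_mol[OF w])
    also have "\<dots> = mol n G x $ i $ j"
      by (rule mol_bounded_linear[OF bounded_linear_compose[OF bounded_linear_vec_nth bounded_linear_vec_nth] G])
    finally show ?thesis .
  qed
  then show "grad (mol n u) x = mol n G x" by (simp add: grad_def vec_eq_iff)
qed

lemma weak_partial_grad:
  assumes "smooth_periodic u"
  shows "weak_partial j (\<lambda>x. u x $ i) (\<lambda>x. grad u x $ i $ j)"
proof -
  have "partial_d j (\<lambda>x. u x $ i) = (\<lambda>x. grad u x $ i $ j)"
    using partial_d_component[OF assms] by (simp add: grad_def fun_eq_iff)
  then show ?thesis using weak_partial_smooth[OF smooth_periodic_component[OF assms]] by metis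
qed

lemma integrable_grad: "smooth_periodic u \<Longrightarrow> integrable torus (grad u)"
  by (rule integrable_torus_continuous[OF grad_continuous])

lemma grad_mol_smooth: "smooth_periodic u \<Longrightarrow> grad (mol n u) = mol n (grad u)"
  by (rule grad_mol[OF integrable_smooth_periodic integrable_grad weak_partial_grad])

text \<open>A solenoidal field transports its own energy density without creating any.\<close>

lemma flux_form_self:
  fixes U :: "real^3 \<Rightarrow> real^3"
  assumes U: "smooth_periodic U" and div: "\<And>x. divergence U x = 0"
  shows "flux_form U U = 0"
proof -
  define h where "h x = (\<Sum>i\<in>UNIV. 1 / 2 * (U x $ i * U x $ i))" for x
  have ii: "smooth_periodic (\<lambda>x. 1 / 2 * (U x $ i * U x $ i))" for i
    by (intro smooth_periodic_mult smooth_periodic_const smooth_periodic_component U)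
  have h: "smooth_periodic h" unfolding h_def by (rule smooth_periodic_sum[OF ii])
  have pdh: "partial_d j h x = (\<Sum>i\<in>UNIV. U x $ i * partial_d j U x $ i)" for j x
  proof -
    have "partial_d j (\<lambda>x. 1 / 2 * (U x $ i * U x $ i)) x = U x $ i * partial_d j U x $ i" for i
    proof -
      note Ui = smooth_periodic_component[OF U, of i]
      have "partial_d j (\<lambda>x. 1 / 2 * (U x $ i * U x $ i)) x = 1 / 2 * partial_d j (\<lambda>x. U x $ i * U x $ i) x"
        unfolding partial_d_simps(4)[OF smooth_periodic_const smooth_periodic_mult[OF Ui Ui]] partial_d_simps(5)
        by simp
      also have "\<dots> = U x $ i * partial_d j U x $ i"
        unfolding partial_d_simps(4)[OF Ui Ui] partial_d_component[OF U] by simp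
      finally show ?thesis .
    qed
    then show ?thesis unfolding h_def partial_d_sum[OF ii] by (rule sum.cong[OF refl])
  qed
  have cj: "smooth_periodic (\<lambda>x. U x $ j)" for j by (rule smooth_periodic_component[OF U])
  have pd: "smooth_periodic (partial_d j h)" for j by (rule smooth_periodic_derivative(2)[OF h])
  have pdc: "smooth_periodic (\<lambda>x. partial_d j U x $ j)" for j
    by (rule smooth_periodic_component[OF smooth_periodic_derivative(2)[OF U]])
  have "flux_form U U = (LINT x|torus. (\<Sum>j\<in>UNIV. U x $ j * partial_d j h x))"
    unfolding flux_form_def grad_mult inner_sum_right pdh
    by (intro Bochner_Integration.integral_cong refl)
       (simp add: inner_vec_def sum_distrib_left mult_ac)
  also have "\<dots> = (\<Sum>j\<in>UNIV. LINT x|torus. U x $ j * partial_d j h x)"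
    by (rule Bochner_Integration.integral_sum) (intro integrable_smooth_periodic smooth_periodic_mult cj pd)
  also have "\<dots> = (\<Sum>j\<in>UNIV. - (LINT x|torus. partial_d j U x $ j * h x))"
    by (simp add: torus_integration_by_parts[OF cj h] partial_d_component[OF U])
  also have "\<dots> = - (LINT x|torus. (\<Sum>j\<in>UNIV. partial_d j U x $ j * h x))"
    unfolding sum_negf
    by (subst Bochner_Integration.integral_sum) (auto intro!: integrable_smooth_periodic smooth_periodic_mult pdc h)
  also have "\<dots> = - (LINT x|torus. divergence U x * h x)"
    by (simp add: divergence_def sum_distrib_right)
  finally show ?thesis by (simp add: div)
qed

lemma mol_increment_square:
  fixes u :: "real^3 \<Rightarrow> real^3"
  assumes u: "smooth_periodic u"
  shows "(norm (mol n u x - u x))\<^sup>2 \<le> mol n (\<lambda>y. (norm (u y - u x))\<^sup>2) x"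
proof -
  have d: "smooth_periodic (\<lambda>y. u y - u x)" by (rule smooth_periodic_diff[OF u smooth_periodic_const])
  have "integrable torus (\<lambda>y. norm (u y - u x) powr 2)"
    unfolding norm_powr_two by (intro integrable_torus_continuous continuous_intros smooth_periodicD(3)[OF u])
  from mol_Jensen[of 2, OF _ integrable_smooth_periodic[OF d] this, of n x]
  show ?thesis by (simp add: mol_diff mol_const integrable_smooth_periodic[OF u] norm_powr_two)
qed

text \<open>
  The commutator of mollification with the product \<open>u \<otimes> u\<close> is a covariance, hence quadratic in the
  increments of \<open>u\<close> (Constantin, E and Titi).
\<close>

lemma commutator_bound:
  fixes u :: "real^3 \<Rightarrow> real^3" and A :: "real^3^3"
  assumes u: "smooth_periodic u"
  shows "\<bar>A \<bullet> mol n (\<lambda>y. outer (u y)) x - mol n u x \<bullet> (A *v mol n u x)\<bar>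
    \<le> 2 * norm A * mol n (\<lambda>y. (norm (u y - u x))\<^sup>2) x"
proof -
  define c where "c = u x"
  define Q where "Q a = a \<bullet> (A *v a)" for a
  define l where "l a = a \<bullet> (A *v c) + c \<bullet> (A *v a)" for a
  have ui: "integrable torus u" by (rule integrable_smooth_periodic[OF u])
  have oi: "integrable torus (\<lambda>y. outer (u y))" by (rule integrable_torus_continuous[OF outer_smooth[OF u]])
  have Qd: "Q (a - c) = Q a - l a + Q c" for a
    by (simp add: Q_def l_def inner_diff_left inner_diff_right matrix_vector_mult_diff_distrib)
  have bA: "bounded_linear (\<lambda>W. A \<bullet> W)" by (rule bounded_linear_inner_right)
  have bl: "bounded_linear l"
    unfolding l_def by (intro linear_conv_bounded_linear[THEN iffD1] linearI)
      (simp_all add: inner_add_left inner_add_right matrix_vector_right_distrib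
        matrix_vector_mult_scaleR algebra_simps)
  have cu: "continuous_on UNIV (\<lambda>y. norm (u y - c))" by (intro continuous_intros smooth_periodicD(3)[OF u])
  have Qi: "integrable torus (\<lambda>y. Q (u y))"
    using integrable_bounded_linear[OF bA oi] by (simp add: Q_def inner_matrix_vector)
  have li: "integrable torus (\<lambda>y. l (u y))" by (rule integrable_bounded_linear[OF bl ui])
  have ni: "integrable torus (\<lambda>y. norm A * (norm (u y - c))\<^sup>2)"
    by (intro integrable_torus_continuous continuous_intros cu)
  have "A \<bullet> mol n (\<lambda>y. outer (u y)) x = mol n (\<lambda>y. Q (u y)) x"
    using mol_bounded_linear[OF bA oi, of n x] by (simp add: Q_def inner_matrix_vector)
  moreover have "mol n (\<lambda>y. Q (u y - c)) x = mol n (\<lambda>y. Q (u y)) x - l (mol n u x) + Q c"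
    unfolding Qd
    by (subst mol_add) (simp_all add: mol_diff mol_const Qi li mol_bounded_linear[OF bl ui])
  moreover have "Q (mol n u x - c) = Q (mol n u x) - l (mol n u x) + Q c" by (rule Qd)
  ultimately have eq: "A \<bullet> mol n (\<lambda>y. outer (u y)) x - mol n u x \<bullet> (A *v mol n u x) =
      mol n (\<lambda>y. Q (u y - c)) x - Q (mol n u x - c)"
    by (simp add: Q_def)
  have "\<bar>mol n (\<lambda>y. Q (u y - c)) x\<bar> \<le> (LINT y|torus. eta n (x - y) * (norm A * (norm (u y - c))\<^sup>2))"
    unfolding mol_def real_scaleR_def real_norm_def[symmetric]
  proof (rule Bochner_Integration.integral_norm_bound_integral)
    have "integrable torus (\<lambda>y. Q (u y - c))" unfolding Qd using Qi li by simp
    from mol_integrand[OF this, of n x] show "integrable torus (\<lambda>y. eta n (x - y) * Q (u y - c))" by simp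
    from mol_integrand[OF ni, of n x]
    show "integrable torus (\<lambda>y. eta n (x - y) * (norm A * (norm (u y - c))\<^sup>2))" by simp
    fix y
    show "norm (eta n (x - y) * Q (u y - c)) \<le> eta n (x - y) * (norm A * (norm (u y - c))\<^sup>2)"
      using abs_inner_matrix_vector_le[of "u y - c" A] eta_nonneg[of n "x - y"]
      by (simp add: Q_def abs_mult mult_left_mono)
  qed
  also have "\<dots> = norm A * mol n (\<lambda>y. (norm (u y - c))\<^sup>2) x"
    unfolding mol_def by (simp add: mult.left_commute[of _ "norm A"])
  finally have "\<bar>mol n (\<lambda>y. Q (u y - c)) x\<bar> \<le> norm A * mol n (\<lambda>y. (norm (u y - c))\<^sup>2) x" .
  moreover have "\<bar>Q (mol n u x - c)\<bar> \<le> norm A * mol n (\<lambda>y. (norm (u y - c))\<^sup>2) x"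
    unfolding Q_def c_def
    by (rule order_trans[OF abs_inner_matrix_vector_le mult_left_mono[OF mol_increment_square[OF u] norm_ge_zero]])
  ultimately show ?thesis unfolding eq c_def by linarith
qed

lemma mol_increment_shift:
  fixes u :: "real^3 \<Rightarrow> real^3"
  assumes u: "smooth_periodic u"
  shows "mol n (\<lambda>y. (norm (u y - u x))\<^sup>2) x = (LINT z|torus. eta n z * (norm (u (x + z) - u x))\<^sup>2)"
proof -
  define F where "F y = eta n (y - x) * (norm (u y - u x))\<^sup>2" for y
  have e: "smooth_periodic (\<lambda>y. eta n (y - x))" by (rule finite_rank_smooth(1)[OF eta_finite_rank])
  have "torus_periodic F"
    using smooth_periodicD(2)[OF e] smooth_periodicD(2)[OF u] by (simp add: torus_periodic_def F_def)
  moreover have "continuous_on UNIV F"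
    unfolding F_def by (intro continuous_intros smooth_periodicD(3)[OF e] smooth_periodicD(3)[OF u])
  ultimately have "(LINT z|torus. F (z + x)) = (LINT y|torus. F y)" by (rule LINT_torus_shift)
  then show ?thesis by (simp add: F_def mol_def eta_diff_commute[of n x] add.commute[of _ x])
qed

lemma LINT_torus_swap:
  fixes f :: "real^3 \<Rightarrow> real^3 \<Rightarrow> real"
  assumes c: "continuous_on UNIV (\<lambda>(x, z). f x z)"
  shows "continuous_on UNIV (\<lambda>x. LINT z|torus. f x z)"
    and "continuous_on UNIV (\<lambda>z. LINT x|torus. f x z)"
    and "(LINT x|torus. LINT z|torus. f x z) = (LINT z|torus. LINT x|torus. f x z)"
proof -
  define w :: "real^3" where "w = (\<chi> i. 2 * pi)"
  have cell: "torus_cell = cbox 0 w" by (simp add: torus_cell_def w_def)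
  have c1: "continuous_on UNIV (\<lambda>z. f x z)" for x
    using continuous_on_compose2[OF c, of UNIV "\<lambda>z. (x, z)"] by (simp add: continuous_intros)
  have c2: "continuous_on UNIV (\<lambda>x. f x z)" for z
    using continuous_on_compose2[OF c, of UNIV "\<lambda>x. (x, z)"] by (simp add: continuous_intros)
  have c': "continuous_on UNIV (\<lambda>(z, x). f x z)"
    using continuous_on_compose2[OF c, of UNIV "\<lambda>(z, x). (x, z)"]
    by (simp add: case_prod_beta continuous_intros)
  have L: "(LINT z|torus. f x z) = integral (cbox 0 w) (f x)" for x
    using LINT_torus_eq_integral[OF integrable_torus_continuous[OF c1]] by (simp add: cell)
  have R: "(LINT x|torus. f x z) = integral (cbox 0 w) (\<lambda>x. f x z)" for z
    using LINT_torus_eq_integral[OF integrable_torus_continuous[OF c2]] by (simp add: cell)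
  show k1: "continuous_on UNIV (\<lambda>x. LINT z|torus. f x z)"
    unfolding L by (rule integral_continuous_on_param, rule continuous_on_subset[OF c]) simp
  show k2: "continuous_on UNIV (\<lambda>z. LINT x|torus. f x z)"
    unfolding R by (rule integral_continuous_on_param, rule continuous_on_subset[OF c']) simp
  have "(LINT x|torus. LINT z|torus. f x z) = integral (cbox 0 w) (\<lambda>x. integral (cbox 0 w) (f x))"
    using LINT_torus_eq_integral[OF integrable_torus_continuous[OF k1]] by (simp add: cell L)
  also have "\<dots> = integral (cbox 0 w) (\<lambda>z. integral (cbox 0 w) (\<lambda>x. f x z))"
    by (rule integral_swap_continuous[OF continuous_on_subset[OF c]]) simp
  also have "\<dots> = (LINT z|torus. LINT x|torus. f x z)"
    using LINT_torus_eq_integral[OF integrable_torus_continuous[OF k2]] by (simp add: cell R)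
  finally show "(LINT x|torus. LINT z|torus. f x z) = (LINT z|torus. LINT x|torus. f x z)" .
qed

text \<open>The work that the increments \<open>u (x + z) - u x\<close> do against the mollified gradient.\<close>

definition increment_work :: "nat \<Rightarrow> (real^3 \<Rightarrow> real^3) \<Rightarrow> real^3 \<Rightarrow> real" where
  "increment_work n u z = (LINT x|torus. (norm (u (x + z) - u x))\<^sup>2 * norm (grad (mol n u) x))"

text \<open>
  By symmetry one mollification moves from the gradient to \<open>u \<otimes> u\<close>.  Subtracting the flux of \<open>mol n u\<close> through
  itself, which vanishes, leaves the commutator, and the order of the integrals over \<open>x\<close> and \<open>z\<close> is exchanged.
\<close>

lemma flux_le_increment_work:
  fixes u :: "real^3 \<Rightarrow> real^3"
  assumes u: "smooth_periodic u" and div: "\<And>x. divergence (mol n u) x = 0"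
  shows "\<bar>flux_form u (mol n (mol n u))\<bar> \<le> 2 * (LINT z|torus. eta n z * increment_work n u z)"
    and "integrable torus (\<lambda>z. eta n z * increment_work n u z)"
proof -
  define U where "U = mol n u"
  have ui: "integrable torus u" by (rule integrable_smooth_periodic[OF u])
  have U: "smooth_periodic U" unfolding U_def by (rule mol_smooth[OF ui])
  have cG: "continuous_on UNIV (grad U)" by (rule grad_continuous[OF U])
  have Gi: "integrable torus (grad U)" by (rule integrable_grad[OF U])
  have oi: "integrable torus (\<lambda>y. outer (u y))" by (rule integrable_torus_continuous[OF outer_smooth[OF u]])
  have cu: "continuous_on S (\<lambda>x. u (f x))" if "continuous_on S f" for S and f :: "'x::topological_space \<Rightarrow> real^3"
    by (rule continuous_on_compose2[OF smooth_periodicD(3)[OF u] that]) simp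
  have ce: "continuous_on S (\<lambda>x. eta n (f x))" if "continuous_on S f" for S and f :: "'x::topological_space \<Rightarrow> real^3"
    by (rule continuous_on_compose2[OF smooth_periodicD(3)[OF eta_smooth] that]) simp
  have cg: "continuous_on S (\<lambda>x. grad U (f x))" if "continuous_on S f" for S and f :: "'x::topological_space \<Rightarrow> real^3"
    by (rule continuous_on_compose2[OF cG that]) simp
  define F where "F x z = eta n z * ((norm (u (x + z) - u x))\<^sup>2 * norm (grad U x))" for x z
  have cF: "continuous_on UNIV (\<lambda>(x, z). F x z)"
    unfolding F_def case_prod_beta by (intro continuous_intros cu ce cg)
  note swap = LINT_torus_swap[of F, OF cF]
  have work: "(LINT x|torus. F x z) = eta n z * increment_work n u z" for z
    unfolding F_def increment_work_def U_def by (rule integral_mult_right_zero)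
  show "integrable torus (\<lambda>z. eta n z * increment_work n u z)"
    using integrable_torus_continuous[OF swap(2)] by (simp add: work)
  have gU: "grad (mol n U) = mol n (grad U)" by (rule grad_mol_smooth[OF U])
  have i1: "integrable torus (\<lambda>x. grad U x \<bullet> mol n (\<lambda>y. outer (u y)) x)"
    by (intro integrable_torus_continuous continuous_intros cG smooth_periodicD(3)[OF mol_smooth[OF oi]])
  have i2: "integrable torus (\<lambda>x. U x \<bullet> (grad U x *v U x))"
    unfolding inner_matrix_vector
    by (intro integrable_torus_continuous continuous_intros cG outer_smooth[OF U])
  have "flux_form u (mol n U) = (LINT x|torus. mol n (grad U) x \<bullet> outer (u x))"
    by (simp add: flux_form_def gU inner_matrix_vector)
  also have "\<dots> = (LINT x|torus. grad U x \<bullet> mol n (\<lambda>y. outer (u y)) x)" by (rule mol_symmetric[OF Gi oi])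
  also have "\<dots> = (LINT x|torus. grad U x \<bullet> mol n (\<lambda>y. outer (u y)) x) - flux_form U U"
    using flux_form_self[OF U] div by (simp add: U_def)
  also have "\<dots> = (LINT x|torus. grad U x \<bullet> mol n (\<lambda>y. outer (u y)) x - U x \<bullet> (grad U x *v U x))"
    unfolding flux_form_def by (rule Bochner_Integration.integral_diff[OF i1 i2, symmetric])
  also have "\<bar>\<dots>\<bar> \<le> (LINT x|torus. 2 * (LINT z|torus. F x z))"
    unfolding real_norm_def[symmetric]
  proof (rule Bochner_Integration.integral_norm_bound_integral)
    show "integrable torus (\<lambda>x. grad U x \<bullet> mol n (\<lambda>y. outer (u y)) x - U x \<bullet> (grad U x *v U x))"
      by (rule Bochner_Integration.integrable_diff[OF i1 i2])
    show "integrable torus (\<lambda>x. 2 * (LINT z|torus. F x z))"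
      by (rule integrable_mult_right[OF integrable_torus_continuous[OF swap(1)]])
    fix x
    have "(LINT z|torus. F x z) = norm (grad U x) * mol n (\<lambda>y. (norm (u y - u x))\<^sup>2) x"
      unfolding F_def mol_increment_shift[OF u] by (simp flip: integral_mult_right_zero add: mult_ac)
    then show "norm (grad U x \<bullet> mol n (\<lambda>y. outer (u y)) x - U x \<bullet> (grad U x *v U x)) \<le> 2 * (LINT z|torus. F x z)"
      using commutator_bound[OF u, of "grad U x" n x] by (simp add: U_def)
  qed
  also have "\<dots> = 2 * (LINT z|torus. LINT x|torus. F x z)" by (simp add: swap(3))
  finally show "\<bar>flux_form u (mol n (mol n u))\<bar> \<le> 2 * (LINT z|torus. eta n z * increment_work n u z)"
    by (simp add: work U_def)
qed

lemma weighted_product_le_sum: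
  fixes X Y W a b c :: real
  assumes "X \<ge> 0" "Y \<ge> 0" "W \<ge> 0" "a \<ge> 0" "b \<ge> 0" "c \<ge> 0" "a + b + c = 1"
  shows "X powr a * Y powr b * W powr c \<le> X + Y + W"
proof -
  define m where "m = max X (max Y W)"
  have m: "X \<le> m" "Y \<le> m" "W \<le> m" "0 \<le> m" using assms by (auto simp: m_def)
  have "X powr a * Y powr b * W powr c \<le> m powr a * m powr b * m powr c"
    using m assms by (intro mult_mono powr_mono2) auto
  also have "\<dots> = m powr (a + b + c)" by (simp only: powr_add)
  also have "\<dots> = m" using m assms(7) by simp
  also have "m \<le> X + Y + W" using assms by (auto simp: m_def)
  finally show ?thesis .
qed

text \<open>
  Young's inequality with the exponents \<open>1 - \<theta>\<close>, \<open>2 * \<theta> / q\<close> and \<open>\<theta> * (q - 2) / q\<close>, which add up to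
  one; the increment \<open>a\<close> is measured in \<open>L2\<close> and, divided by its distance, in \<open>Lq\<close>, and the gradient
  \<open>g\<close> in \<open>Lq\<close> and in the supremum norm.
\<close>

lemma increment_Young:
  fixes a g \<rho> A N q \<theta> :: real
  assumes a: "a \<ge> 0" and g: "0 \<le> g" "g \<le> N" and pos: "\<rho> > 0" "A > 0" and q: "q > 2"
    and \<theta>: "0 \<le> \<theta>" "\<theta> \<le> 1" "\<theta> * (q - 2) \<le> 1"
  shows "a\<^sup>2 * g \<le> N powr (1 - \<theta> * (q - 2)) * (\<rho> * A) powr (2 * \<theta>) * A powr (\<theta> * (q - 2)) *
    (a\<^sup>2 + a powr q / (\<rho> * A) powr q + g powr q / A powr q)"
proof (cases "a = 0 \<or> g = 0")
  case True
  then have "a\<^sup>2 * g = 0" by auto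
  moreover have "0 \<le> N powr (1 - \<theta> * (q - 2)) * (\<rho> * A) powr (2 * \<theta>) * A powr (\<theta> * (q - 2)) *
    (a\<^sup>2 + a powr q / (\<rho> * A) powr q + g powr q / A powr q)" by (intro mult_nonneg_nonneg add_nonneg_nonneg) auto
  ultimately show ?thesis by (simp only:)
next
  case False
  then have a0: "a > 0" and g0: "g > 0" using a g by auto
  define \<alpha> where "\<alpha> = \<theta> * (q - 2)"
  define X where "X = a\<^sup>2"
  define Y where "Y = a powr q / (\<rho> * A) powr q"
  define W where "W = g powr q / A powr q"
  have rA: "\<rho> * A > 0" using pos by simp
  have X: "X powr (1 - \<theta>) = a powr (2 - 2 * \<theta>)"
  proof -
    have "X = a powr 2" using a0 by (simp add: X_def)
    then show ?thesis by (simp add: powr_powr algebra_simps)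
  qed
  have Y: "Y powr (2 * \<theta> / q) * (\<rho> * A) powr (2 * \<theta>) = a powr (2 * \<theta>)"
  proof -
    have "Y = (a / (\<rho> * A)) powr q" using a0 rA by (simp add: Y_def powr_divide)
    then have "Y powr (2 * \<theta> / q) = (a / (\<rho> * A)) powr (2 * \<theta>)" using q by (simp add: powr_powr)
    also have "\<dots> = a powr (2 * \<theta>) / (\<rho> * A) powr (2 * \<theta>)" using a0 rA by (simp add: powr_divide)
    finally have "Y powr (2 * \<theta> / q) = a powr (2 * \<theta>) / (\<rho> * A) powr (2 * \<theta>)" .
    moreover have "(\<rho> * A) powr (2 * \<theta>) \<noteq> 0" using pos by simp
    ultimately show ?thesis by (metis times_divide_eq_left nonzero_mult_div_cancel_right)
  qed
  have W: "W powr (\<alpha> / q) * A powr \<alpha> = g powr \<alpha>"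
  proof -
    have "W = (g / A) powr q" using g0 pos by (simp add: W_def powr_divide)
    then have "W powr (\<alpha> / q) = (g / A) powr \<alpha>" using q by (simp add: powr_powr)
    also have "\<dots> = g powr \<alpha> / A powr \<alpha>" using g0 pos by (simp add: powr_divide)
    finally show ?thesis using pos by simp
  qed
  have gg: "g \<le> g powr \<alpha> * N powr (1 - \<alpha>)"
  proof -
    have "g = g powr \<alpha> * g powr (1 - \<alpha>)" using g0 by (simp flip: powr_add)
    also have "\<dots> \<le> g powr \<alpha> * N powr (1 - \<alpha>)"
      using g0 g \<theta> by (intro mult_left_mono powr_mono2) (auto simp: \<alpha>_def)
    finally show ?thesis .
  qed
  have aa: "a\<^sup>2 = a powr (2 - 2 * \<theta>) * a powr (2 * \<theta>)"
    using a0 by (simp flip: powr_add)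
  have "a\<^sup>2 * g \<le> a powr (2 - 2 * \<theta>) * a powr (2 * \<theta>) * (g powr \<alpha> * N powr (1 - \<alpha>))"
    unfolding aa using gg by (intro mult_left_mono) auto
  also have "\<dots> = N powr (1 - \<alpha>) * (\<rho> * A) powr (2 * \<theta>) * A powr \<alpha> *
      (X powr (1 - \<theta>) * Y powr (2 * \<theta> / q) * W powr (\<alpha> / q))"
    unfolding X Y[symmetric] W[symmetric] by (simp only: mult_ac)
  also have "\<dots> \<le> N powr (1 - \<alpha>) * (\<rho> * A) powr (2 * \<theta>) * A powr \<alpha> * (X + Y + W)"
  proof (intro mult_left_mono weighted_product_le_sum)
    show "1 - \<theta> + 2 * \<theta> / q + \<alpha> / q = 1" using q by (simp add: \<alpha>_def field_simps)
  qed (use \<theta> q in \<open>auto simp: X_def Y_def W_def \<alpha>_def\<close>)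
  finally show ?thesis by (simp add: X_def Y_def W_def \<alpha>_def)
qed

lemma increment_L2_le:
  fixes u :: "real^3 \<Rightarrow> real^3"
  assumes u: "smooth_periodic u"
  shows "(LINT x|torus. (norm (u (x + z) - u x))\<^sup>2) \<le> 4 * ip u u"
proof -
  have cu: "continuous_on UNIV (\<lambda>x. (norm (u x))\<^sup>2)" by (intro continuous_intros smooth_periodicD(3)[OF u])
  have pu: "torus_periodic (\<lambda>x. (norm (u x))\<^sup>2)" using smooth_periodicD(2)[OF u] by (simp add: torus_periodic_def)
  have i1: "integrable torus (\<lambda>x. 2 * (norm (u (x + z)))\<^sup>2)"
    by (rule integrable_mult_right[OF integrable_torus_continuous[OF continuous_shift[OF cu]]])
  have i2: "integrable torus (\<lambda>x. 2 * (norm (u x))\<^sup>2)"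
    by (rule integrable_mult_right[OF integrable_torus_continuous[OF cu]])
  have "(LINT x|torus. (norm (u (x + z) - u x))\<^sup>2) \<le> (LINT x|torus. 2 * (norm (u (x + z)))\<^sup>2 + 2 * (norm (u x))\<^sup>2)"
  proof (rule integral_mono)
    show "integrable torus (\<lambda>x. (norm (u (x + z) - u x))\<^sup>2)"
      by (intro integrable_torus_continuous continuous_intros continuous_shift smooth_periodicD(3)[OF u])
    show "integrable torus (\<lambda>x. 2 * (norm (u (x + z)))\<^sup>2 + 2 * (norm (u x))\<^sup>2)"
      by (rule Bochner_Integration.integrable_add[OF i1 i2])
    fix x
    have "(norm (u (x + z) - u x))\<^sup>2 \<le> (norm (u (x + z)) + norm (u x))\<^sup>2"
      by (intro power_mono norm_triangle_ineq4) simp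
    also have "\<dots> \<le> 2 * (norm (u (x + z)))\<^sup>2 + 2 * (norm (u x))\<^sup>2"
      using sum_squares_bound[of "norm (u (x + z))" "norm (u x)"] by (simp add: power2_sum)
    finally show "(norm (u (x + z) - u x))\<^sup>2 \<le> 2 * (norm (u (x + z)))\<^sup>2 + 2 * (norm (u x))\<^sup>2" .
  qed
  also have "\<dots> = 2 * (LINT x|torus. (norm (u (x + z)))\<^sup>2) + 2 * (LINT x|torus. (norm (u x))\<^sup>2)"
    by (simp add: Bochner_Integration.integral_add[OF i1 i2])
  also have "\<dots> = 4 * ip u u" by (simp add: ip_self_eq LINT_torus_shift[OF pu cu])
  finally show ?thesis .
qed

text \<open>
  For each increment separately, the three terms of Young's inequality are integrated in \<open>x\<close>; the
  increments in \<open>Lq\<close> are estimated along a short representative of \<open>z\<close> modulo the period lattice.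
\<close>

lemma increment_work_bound:
  fixes u :: "real^3 \<Rightarrow> real^3"
  assumes u: "smooth_periodic u" and q: "q > 2" and A: "A > 0"
    and E: "ip u u \<le> E" and G: "(LINT x|torus. norm (grad u x) powr q) \<le> A powr q"
    and \<theta>: "0 \<le> \<theta>" "\<theta> \<le> 1" "\<theta> * (q - 2) \<le> 1"
    and \<rho>: "\<rho> > 0" "32 * dist2 z \<le> \<rho>\<^sup>2"
  shows "increment_work n u z \<le> (3 * sqrt (real (Suc n)) ^ 3 * A powr q) powr ((1 - \<theta> * (q - 2)) / q) *
    (\<rho> * A) powr (2 * \<theta>) * A powr (\<theta> * (q - 2)) * (4 * E + 2)"
proof -
  define N where "N = (3 * sqrt (real (Suc n)) ^ 3 * A powr q) powr (1 / q)"
  define K where "K = N powr (1 - \<theta> * (q - 2)) * (\<rho> * A) powr (2 * \<theta>) * A powr (\<theta> * (q - 2))"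
  have K: "K \<ge> 0" by (simp add: K_def)
  have ui: "integrable torus u" by (rule integrable_smooth_periodic[OF u])
  have U: "smooth_periodic (mol n u)" by (rule mol_smooth[OF ui])
  have gi: "integrable torus (grad u)" by (rule integrable_grad[OF u])
  have cgp: "continuous_on UNIV (\<lambda>x. norm (grad w x) powr q)" if "smooth_periodic w" for w
    by (rule continuous_on_powr') (use q grad_continuous[OF that] in \<open>auto intro: continuous_intros\<close>)
  have gp: "integrable torus (\<lambda>x. norm (grad u x) powr q)" by (rule integrable_torus_continuous[OF cgp[OF u]])
  have gN: "norm (grad (mol n u) x) \<le> N" for x
  proof -
    have "norm (grad (mol n u) x) powr q \<le> 3 * sqrt (real (Suc n)) ^ 3 * (LINT x|torus. norm (grad u x) powr q)"
      unfolding grad_mol_smooth[OF u] by (rule mol_sup[OF _ gi gp]) (use q in simp)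
    also have "\<dots> \<le> 3 * sqrt (real (Suc n)) ^ 3 * A powr q" by (intro mult_left_mono G) simp
    finally have "(norm (grad (mol n u) x) powr q) powr (1 / q) \<le> N"
      unfolding N_def using q by (intro powr_mono2) auto
    then show ?thesis using q by (simp add: powr_powr)
  qed
  have gA: "(LINT x|torus. norm (grad (mol n u) x) powr q) \<le> A powr q"
    unfolding grad_mol_smooth[OF u] by (rule order_trans[OF mol_Lp[OF _ gi gp] G]) (use q in simp)
  obtain k where k: "(norm (z + (\<chi> i. 2 * pi * of_int (k i)) :: real^3))\<^sup>2 \<le> 32 * dist2 z"
    by (rule lattice_representative)
  define z' where "z' = z + (\<chi> i. 2 * pi * of_int (k i))"
  have uz: "u (x + z) = u (x + z')" for x
    unfolding z'_def add.assoc[symmetric] by (rule periodic_lattice[OF smooth_periodicD(2)[OF u], symmetric])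
  have z': "norm z' \<le> \<rho>"
    by (rule power2_le_imp_le[OF order_trans[OF k[folded z'_def] \<rho>(2)] less_imp_le[OF \<rho>(1)]])
  have uq: "(LINT x|torus. norm (u (x + z) - u x) powr q) \<le> (\<rho> * A) powr q"
  proof -
    have "(LINT x|torus. norm (u (x + z) - u x) powr q) \<le> norm z' powr q * (LINT x|torus. norm (grad u x) powr q)"
      unfolding uz by (rule translation_Lp_bound[OF u]) (use q in simp)
    also have "\<dots> \<le> \<rho> powr q * A powr q"
      using z' q by (intro mult_mono powr_mono2 G) auto
    finally show ?thesis using \<rho> A by (simp add: powr_mult)
  qed
  have cd: "continuous_on UNIV (\<lambda>x. norm (u (x + z) - u x))"
    by (intro continuous_intros continuous_shift smooth_periodicD(3)[OF u])
  have cG: "continuous_on UNIV (\<lambda>x. norm (grad (mol n u) x))" by (intro continuous_intros grad_continuous[OF U])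
  have i1: "integrable torus (\<lambda>x. (norm (u (x + z) - u x))\<^sup>2)"
    by (intro integrable_torus_continuous continuous_intros cd)
  have i2: "integrable torus (\<lambda>x. norm (u (x + z) - u x) powr q)"
    by (rule integrable_torus_continuous, rule continuous_on_powr') (use q cd in auto)
  have i3: "integrable torus (\<lambda>x. norm (grad (mol n u) x) powr q)"
    by (rule integrable_torus_continuous[OF cgp[OF U]])
  have i4: "integrable torus (\<lambda>x. (norm (u (x + z) - u x))\<^sup>2 + norm (u (x + z) - u x) powr q / (\<rho> * A) powr q +
      norm (grad (mol n u) x) powr q / A powr q)"
    by (intro Bochner_Integration.integrable_add integrable_divide_zero i1 i2 i3)
  have "increment_work n u z \<le> (LINT x|torus. K * ((norm (u (x + z) - u x))\<^sup>2 +
      norm (u (x + z) - u x) powr q / (\<rho> * A) powr q + norm (grad (mol n u) x) powr q / A powr q))"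
    unfolding increment_work_def
  proof (rule integral_mono)
    show "integrable torus (\<lambda>x. (norm (u (x + z) - u x))\<^sup>2 * norm (grad (mol n u) x))"
      by (intro integrable_torus_continuous continuous_intros cd cG)
  qed (use i4 increment_Young[OF _ _ gN \<rho>(1) A q \<theta>] in \<open>auto simp: K_def\<close>)
  also have "\<dots> = K * ((LINT x|torus. (norm (u (x + z) - u x))\<^sup>2) +
      (LINT x|torus. norm (u (x + z) - u x) powr q) / (\<rho> * A) powr q +
      (LINT x|torus. norm (grad (mol n u) x) powr q) / A powr q)"
    by (simp add: Bochner_Integration.integral_add i1 i2 i3)
  also have "\<dots> \<le> K * (4 * E + 1 + 1)"
  proof (intro mult_left_mono add_mono K)
    show "(LINT x|torus. (norm (u (x + z) - u x))\<^sup>2) \<le> 4 * E" using increment_L2_le[OF u, of z] E by simp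
    show "(LINT x|torus. norm (u (x + z) - u x) powr q) / (\<rho> * A) powr q \<le> 1"
      using uq \<rho> A by simp
    show "(LINT x|torus. norm (grad (mol n u) x) powr q) / A powr q \<le> 1" using gA A by simp
  qed
  also have "\<dots> = K * (4 * E + 2)" by simp
  also have "K = (3 * sqrt (real (Suc n)) ^ 3 * A powr q) powr ((1 - \<theta> * (q - 2)) / q) *
      (\<rho> * A) powr (2 * \<theta>) * A powr (\<theta> * (q - 2))"
    unfolding K_def N_def by (simp add: powr_powr del: of_nat_Suc)
  finally show ?thesis .
qed

text \<open>
  The condition \<open>\<theta> > 3 / (5 * q - 6)\<close> makes the exponent of \<open>1 / (n + 1)\<close> positive, and the power
  \<open>1 + 2 * \<theta>\<close> of \<open>A\<close> then exceeds \<open>5 * q / (5 * q - 6)\<close>.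
\<close>

lemma flux_estimate_smooth:
  fixes u :: "real^3 \<Rightarrow> real^3"
  assumes u: "smooth_periodic u" and div: "\<And>x. divergence (mol n u) x = 0" and q: "q > 2" and A: "A > 0"
    and E: "ip u u \<le> E" and G: "(LINT x|torus. norm (grad u x) powr q) \<le> A powr q"
    and \<theta>: "0 \<le> \<theta>" "\<theta> \<le> 1" "\<theta> * (q - 2) \<le> 1"
  shows "\<bar>flux_form u (mol n (mol n u))\<bar> \<le> 582 * (4 * E + 2) *
    (1 / real (Suc n)) powr (\<theta> - 3 * (1 - \<theta> * (q - 2)) / (2 * q)) * A powr (1 + 2 * \<theta>)"
proof -
  define e where "e = 1 / real (Suc n)"
  define \<beta> where "\<beta> = (1 - \<theta> * (q - 2)) / q"
  have e: "e > 0" by (simp add: e_def)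
  have E0: "E \<ge> 0" using E ip_self_nonneg[of u] by linarith
  have "0 \<le> \<theta> * (q - 2)" using \<theta> q by simp
  then have "1 - \<theta> * (q - 2) \<le> q" using q by linarith
  then have \<beta>: "0 \<le> \<beta>" "\<beta> \<le> 1" using \<theta> q by (simp_all add: \<beta>_def divide_le_eq)
  have s3: "sqrt (real (Suc n)) ^ 3 = e powr (- 3 / 2)"
  proof -
    have "sqrt (real (Suc n)) ^ 3 = (real (Suc n) powr (1 / 2)) powr 3"
      by (simp add: powr_half_sqrt)
    also have "\<dots> = real (Suc n) powr (3 / 2)" by (simp only: powr_powr) simp
    also have "\<dots> = e powr (- 3 / 2)" unfolding e_def by (simp add: powr_minus powr_divide)
    finally show ?thesis .
  qed
  define C where "C = 3 * e powr (- 3 * \<beta> / 2) * A powr (q * \<beta>) * e powr (\<theta> - 1) * A powr (2 * \<theta>) *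
      A powr (\<theta> * (q - 2)) * (4 * E + 2)"
  have work: "increment_work n u z \<le> C * (32 * dist2 z + e)" for z
  proof -
    \<comment> \<open>The summand \<open>e\<close> keeps \<open>\<rho>\<^sup>2 / e\<close> above one, so that its power \<open>\<theta>\<close> is at most \<open>\<rho>\<^sup>2 / e\<close>, whose mean is known from the second moment of the kernel.\<close>
    define \<rho> where "\<rho> = sqrt (32 * dist2 z + e)"
    have d: "32 * dist2 z + e > 0" using dist2_nonneg[of z] e by linarith
    have \<rho>: "\<rho> > 0" "32 * dist2 z \<le> \<rho>\<^sup>2" using d e by (auto simp: \<rho>_def)
    have \<rho>2: "\<rho> powr (2 * \<theta>) \<le> e powr (\<theta> - 1) * (32 * dist2 z + e)"
    proof -
      have "\<rho> powr (2 * \<theta>) = (32 * dist2 z + e) powr \<theta>"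
        unfolding \<rho>_def using d by (simp add: powr_half_sqrt[symmetric] powr_powr)
      also have "\<dots> = e powr \<theta> * ((32 * dist2 z + e) / e) powr \<theta>"
        using d e by (simp add: powr_divide)
      also have "\<dots> \<le> e powr \<theta> * ((32 * dist2 z + e) / e) powr 1"
        using \<theta> e dist2_nonneg[of z] by (intro mult_left_mono powr_mono) (auto simp: field_simps)
      also have "\<dots> = e powr (\<theta> - 1) * (32 * dist2 z + e)"
        using d e by (simp add: powr_diff)
      finally show ?thesis .
    qed
    have "3 powr \<beta> \<le> 3 powr (1::real)" using \<beta> by (intro powr_mono) auto
    then have N: "(3 * sqrt (real (Suc n)) ^ 3 * A powr q) powr \<beta> \<le> 3 * e powr (- 3 * \<beta> / 2) * A powr (q * \<beta>)"
      unfolding s3 using e A by (simp add: powr_mult powr_powr)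
    have "increment_work n u z \<le> (3 * sqrt (real (Suc n)) ^ 3 * A powr q) powr \<beta> *
        (\<rho> * A) powr (2 * \<theta>) * A powr (\<theta> * (q - 2)) * (4 * E + 2)"
      unfolding \<beta>_def by (rule increment_work_bound[OF u q A E G \<theta> \<rho>])
    also have "\<dots> \<le> (3 * e powr (- 3 * \<beta> / 2) * A powr (q * \<beta>)) *
        ((e powr (\<theta> - 1) * (32 * dist2 z + e)) * A powr (2 * \<theta>)) * A powr (\<theta> * (q - 2)) * (4 * E + 2)"
      using N \<rho>2 \<rho> A E0 by (intro mult_right_mono mult_mono) (auto simp: powr_mult)
    also have "\<dots> = C * (32 * dist2 z + e)" by (simp add: C_def mult_ac)
    finally show ?thesis .
  qed
  have C: "C \<ge> 0" using E0 by (simp add: C_def)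
  have ed: "integrable torus (\<lambda>z. eta n z * dist2 z)"
    by (rule integrable_smooth_periodic[OF smooth_periodic_mult[OF eta_smooth dist2_smooth]])
  have ei: "integrable torus (eta n)" by (rule integrable_smooth_periodic[OF eta_smooth])
  have "(LINT z|torus. eta n z * increment_work n u z) \<le> (LINT z|torus. C * (32 * (eta n z * dist2 z) + e * eta n z))"
  proof (rule integral_mono)
    show "integrable torus (\<lambda>z. eta n z * increment_work n u z)" by (rule flux_le_increment_work(2)[OF u div])
    show "integrable torus (\<lambda>z. C * (32 * (eta n z * dist2 z) + e * eta n z))"
      by (intro integrable_mult_right Bochner_Integration.integrable_add ed ei)
    fix z
    have "eta n z * increment_work n u z \<le> eta n z * (C * (32 * dist2 z + e))"
      by (intro mult_left_mono work eta_nonneg)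
    then show "eta n z * increment_work n u z \<le> C * (32 * (eta n z * dist2 z) + e * eta n z)"
      by (simp add: algebra_simps)
  qed
  also have "\<dots> = C * (32 * (LINT z|torus. eta n z * dist2 z) + e * (LINT z|torus. eta n z))"
    using ed ei by simp
  also have "\<dots> = C * (97 * e)" by (simp add: eta_dist2 eta_integral e_def)
  finally have "\<bar>flux_form u (mol n (mol n u))\<bar> \<le> 2 * (C * (97 * e))"
    using flux_le_increment_work(1)[OF u div] by linarith
  also have "\<dots> = 582 * (4 * E + 2) * (e powr (- 3 * \<beta> / 2) * e powr (\<theta> - 1) * e powr 1) *
      (A powr (q * \<beta>) * A powr (2 * \<theta>) * A powr (\<theta> * (q - 2)))"
    using e by (simp add: C_def mult_ac)
  also have "e powr (- 3 * \<beta> / 2) * e powr (\<theta> - 1) * e powr 1 = e powr (\<theta> - 3 * (1 - \<theta> * (q - 2)) / (2 * q))"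
  proof -
    have "- 3 * \<beta> / 2 + (\<theta> - 1) + 1 = \<theta> - 3 * (1 - \<theta> * (q - 2)) / (2 * q)" using q by (simp add: \<beta>_def field_simps)
    then show ?thesis by (simp only: powr_add[symmetric])
  qed
  also have "A powr (q * \<beta>) * A powr (2 * \<theta>) * A powr (\<theta> * (q - 2)) = A powr (1 + 2 * \<theta>)"
  proof -
    have "q * \<beta> + 2 * \<theta> + \<theta> * (q - 2) = 1 + 2 * \<theta>" using q by (simp add: \<beta>_def)
    then show ?thesis by (simp only: powr_add[symmetric])
  qed
  finally show ?thesis by (simp only: e_def)
qed

section \<open>Weak gradients and solenoidal fields\<close>

text \<open>For an interval \<open>(a, b)\<close> in a period, \<open>cos (t - c) > cos r\<close> selects \<open>(a, b)\<close> periodically.\<close>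

lemma cos_greater_iff:
  assumes ab: "0 \<le> a" "a < b" "b \<le> 2 * pi" and t: "0 \<le> t" "t \<le> 2 * pi"
  shows "cos (t - (a + b) / 2) > cos ((b - a) / 2) \<longleftrightarrow> a < t \<and> t < b"
proof -
  define r d where "r = (b - a) / 2" and "d = \<bar>t - (a + b) / 2\<bar>"
  have r: "0 < r" "r \<le> pi" using ab by (simp_all add: r_def)
  have d: "0 \<le> d" "d \<le> 2 * pi - r" using ab t by (auto simp: d_def r_def abs_if field_simps)
  have cd: "cos (t - (a + b) / 2) = cos d" by (simp add: d_def)
  have "a < t \<and> t < b \<longleftrightarrow> d < r" by (auto simp: d_def r_def abs_if field_simps)
  moreover have "cos d > cos r \<longleftrightarrow> d < r"
  proof
    assume "d < r" then show "cos d > cos r" using r d by (intro cos_monotone_0_pi) auto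
  next
    assume gt: "cos d > cos r"
    show "d < r"
    proof (rule ccontr)
      assume "\<not> d < r"
      have "cos d \<le> cos r"
      proof (cases "d \<le> pi")
        case True
        then show ?thesis using \<open>\<not> d < r\<close> r by (intro cos_monotone_0_pi_le) auto
      next
        case False
        have "cos d = cos (2 * pi - d)" by (simp add: cos_diff)
        also have "\<dots> \<le> cos r" using False d r by (intro cos_monotone_0_pi_le) auto
        finally show ?thesis .
      qed
      with gt show False by simp
    qed
  qed
  ultimately show ?thesis unfolding cd r_def[symmetric] by blast
qed

lemma bump_periodic:
  fixes h :: "real^3 \<Rightarrow> real"
  shows "smooth_periodic h \<Longrightarrow> smooth_periodic (\<lambda>x. bump (h x))"
  by (simp add: smooth_periodic_def smooth_on_bump torus_periodic_def)

lemma box_Int_torus_cell_sets: "box a b \<inter> torus_cell \<in> sets torus"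
proof -
  have "box a b \<in> sets lebesgue" by (rule fmeasurableD[OF lmeasurable_box])
  then show ?thesis unfolding torus_def sets_restrict_space by (intro image_eqI[of _ _ "box a b"]) auto
qed

text \<open>Products of bumps of shifted cosines are periodic test functions that converge to the indicator of a box.\<close>

lemma weak_zero_imp_box_zero:
  fixes f :: "real^3 \<Rightarrow> real"
  assumes f: "integrable torus f" and w: "\<And>\<psi>. smooth_periodic \<psi> \<Longrightarrow> (LINT x|torus. f x * \<psi> x) = 0"
    and ab: "\<And>i. 0 \<le> a $ i" "\<And>i. a $ i < b $ i" "\<And>i. b $ i \<le> 2 * pi"
  shows "(LINT x|torus. f x * indicator (box a b) x) = 0"
proof -
  define h where "h i x = cos (x $ i - (a $ i + b $ i) / 2) - cos ((b $ i - a $ i) / 2)" for i and x :: "real^3"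
  have hs: "smooth_periodic (h i)" for i
    unfolding h_def cos_diff
    by (intro smooth_periodic_diff smooth_periodic_add smooth_periodic_mult smooth_periodic_const
        smooth_periodic_coordinate_trig)
  define \<psi> where "\<psi> n x = (\<Prod>i\<in>UNIV. bump (real n * h i x))" for n and x :: "real^3"
  have \<psi>: "smooth_periodic (\<psi> n)" for n
    unfolding \<psi>_def by (intro smooth_periodic_prod bump_periodic smooth_periodic_mult smooth_periodic_const hs)
  have lim: "(\<lambda>n. \<psi> n x) \<longlonglongrightarrow> indicator (box a b) x" if "x \<in> torus_cell" for x
  proof -
    have x: "0 \<le> x $ i" "x $ i \<le> 2 * pi" for i using that by (auto simp: torus_cell_def mem_box_cart)
    have "(\<lambda>n. \<psi> n x) \<longlonglongrightarrow> (\<Prod>i\<in>UNIV. if h i x > 0 then 1 else 0)"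
      unfolding \<psi>_def by (intro tendsto_prod bump_scaled_tendsto)
    moreover have "h i x > 0 \<longleftrightarrow> a $ i < x $ i \<and> x $ i < b $ i" for i
      using cos_greater_iff[OF ab(1) ab(2) ab(3) x, of i i] by (simp add: h_def)
    moreover have "(\<Prod>i\<in>UNIV. if a $ i < x $ i \<and> x $ i < b $ i then 1 else (0::real)) = indicator (box a b) x"
      by (auto simp: indicator_def mem_box_cart)
    ultimately show ?thesis by simp
  qed
  have bd: "\<bar>\<psi> n x\<bar> \<le> 1" for n x
  proof -
    have "0 \<le> \<psi> n x" unfolding \<psi>_def by (intro prod_nonneg) (simp add: bump_bounds)
    moreover have "\<psi> n x \<le> 1" unfolding \<psi>_def by (intro prod_le_1) (simp add: bump_bounds)
    ultimately show ?thesis by simp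
  qed
  have mb: "(\<lambda>x. f x * indicator (box a b) x) \<in> borel_measurable torus"
  proof -
    have "(indicator (box a b) :: real^3 \<Rightarrow> real) \<in> borel_measurable torus"
      using box_Int_torus_cell_sets[of a b] by (subst borel_measurable_indicator_iff) simp
    then show ?thesis using borel_measurable_integrable[OF f] by (intro borel_measurable_times)
  qed
  have "(\<lambda>n. LINT x|torus. f x * \<psi> n x) \<longlonglongrightarrow> (LINT x|torus. f x * indicator (box a b) x)"
  proof (rule integral_dominated_convergence[where w = "\<lambda>x. norm (f x)"])
    show "(\<lambda>x. f x * \<psi> n x) \<in> borel_measurable torus" for n
      by (rule borel_measurable_times[OF borel_measurable_integrable[OF f]
            borel_measurable_integrable[OF integrable_smooth_periodic[OF \<psi>]]])
    show "AE x in torus. (\<lambda>n. f x * \<psi> n x) \<longlonglongrightarrow> f x * indicator (box a b) x"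
    proof (rule AE_I2)
      fix x assume "x \<in> space torus"
      then have "x \<in> torus_cell" by simp
      then show "(\<lambda>n. f x * \<psi> n x) \<longlonglongrightarrow> f x * indicator (box a b) x"
        by (rule tendsto_mult[OF tendsto_const lim])
    qed
    show "AE x in torus. norm (f x * \<psi> n x) \<le> norm (f x)" for n
      using bd by (intro AE_I2) (simp add: abs_mult mult_left_le)
    show "integrable torus (\<lambda>x. norm (f x))" by (rule integrable_norm[OF f])
  qed (rule mb)
  then show ?thesis by (simp add: w[OF \<psi>] LIMSEQ_const_iff)
qed

text \<open>The vanishing of all box averages propagates to the function at its Lebesgue points.\<close>

lemma weak_zero_imp_AE_zero:
  fixes f :: "real^3 \<Rightarrow> real"
  assumes f: "integrable torus f" and w: "\<And>\<psi>. smooth_periodic \<psi> \<Longrightarrow> (LINT x|torus. f x * \<psi> x) = 0"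
  shows "AE x in torus. f x = 0"
proof -
  define p :: "real^3" where "p = (\<chi> i. 2 * pi)"
  have cell: "torus_cell = cbox 0 p" by (simp add: torus_cell_def p_def)
  define g where "g x = (if x \<in> torus_cell then f x else 0)" for x
  have fi: "f integrable_on torus_cell"
    using integrable_on_lebesgue_on[OF _ torus_cell_sets] f unfolding torus_def by blast
  have gi: "g integrable_on cbox a b" for a b
  proof -
    have "g integrable_on UNIV" unfolding g_def using fi integrable_restrict_UNIV by blast
    then show ?thesis by (rule integrable_on_subcbox) simp
  qed
  obtain N where N: "negligible N" "\<And>x e. x \<notin> N \<Longrightarrow> 0 < e \<Longrightarrow> \<exists>d>0. \<forall>h. 0 < h \<and> h < d \<longrightarrow>
      norm (integral (cbox x (x + h *\<^sub>R One)) g /\<^sub>R h ^ DIM(real^3) - g x) < e"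
    using integrable_ccontinuous_explicit[of g, OF gi] by metis
  have zero: "integral (cbox a b) g = 0" if ab: "\<And>i. 0 \<le> a $ i" "\<And>i. a $ i < b $ i" "\<And>i. b $ i \<le> 2 * pi" for a b
  proof -
    have "x \<in> torus_cell" if "x \<in> cbox a b" for x
    proof -
      have "0 \<le> x $ i \<and> x $ i \<le> 2 * pi" for i
      proof -
        have "a $ i \<le> x $ i" "x $ i \<le> b $ i" using that by (auto simp: mem_box_cart)
        then show ?thesis using ab(1)[of i] ab(3)[of i] by linarith
      qed
      then show ?thesis by (simp add: torus_cell_def mem_box_cart)
    qed
    then have sub: "box a b \<subseteq> torus_cell" "cbox a b \<subseteq> torus_cell" using box_subset_cbox[of a b] by blast+
    have "integral (cbox a b) g = integral (box a b) g" by (rule integral_open_interval[symmetric])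
    also have "\<dots> = integral (box a b) f"
      by (rule integral_cong) (use sub in \<open>auto simp: g_def\<close>)
    also have "\<dots> = integral torus_cell (\<lambda>x. f x * indicator (box a b) x)"
    proof -
      have "integral torus_cell (\<lambda>x. f x * indicator (box a b) x) = integral torus_cell (\<lambda>x. if x \<in> box a b then f x else 0)"
        by (rule integral_cong) (simp add: indicator_def)
      also have "\<dots> = integral (box a b \<inter> torus_cell) f"
        by (rule Henstock_Kurzweil_Integration.integral_restrict_Int)
      finally show ?thesis using sub(1) by (simp add: Int_absorb2)
    qed
    also have "\<dots> = (LINT x|torus. f x * indicator (box a b) x)"
    proof (rule LINT_torus_eq_integral[symmetric])
      have "integrable torus (\<lambda>x. indicator (box a b \<inter> torus_cell) x *\<^sub>R f x)"
        by (rule integrable_mult_indicator[OF box_Int_torus_cell_sets f])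
      then show "integrable torus (\<lambda>x. f x * indicator (box a b) x)"
        by (rule Bochner_Integration.integrable_cong[THEN iffD1, rotated 2]) (auto simp: indicator_def)
    qed
    also have "\<dots> = 0" by (rule weak_zero_imp_box_zero[OF f w ab])
    finally show ?thesis .
  qed
  have fz: "f x = 0" if x: "x \<in> box 0 p" "x \<notin> N" for x
  proof (rule ccontr)
    assume "f x \<noteq> 0"
    have xb: "0 < x $ i" "x $ i < 2 * pi" for i using x by (auto simp: mem_box_cart p_def)
    have gx: "g x = f x" using x box_subset_cbox[of 0 p] by (auto simp: g_def cell)
    obtain d where d: "d > 0" "\<forall>h. 0 < h \<and> h < d \<longrightarrow>
        norm (integral (cbox x (x + h *\<^sub>R One)) g /\<^sub>R h ^ DIM(real^3) - g x) < norm (f x)"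
      using N(2)[OF x(2), of "norm (f x)"] \<open>f x \<noteq> 0\<close> by auto
    define m where "m = Min (range (\<lambda>i. 2 * pi - x $ i))"
    have m: "m > 0" unfolding m_def using xb by (subst Min_gr_iff) auto
    have mi: "m \<le> 2 * pi - x $ i" for i unfolding m_def by (rule Min_le) auto
    define h where "h = min d m / 2"
    have h: "0 < h" "h < d" "h \<le> m" using d m by (auto simp: h_def)
    have One: "(\<Sum>b\<in>Basis. (b :: real^3) $ i) = 1" for i
      by (simp add: cart_eq_inner_axis inner_Basis)
    have "integral (cbox x (x + h *\<^sub>R One)) g = 0"
    proof (rule zero)
      fix i
      show "0 \<le> x $ i" using xb less_imp_le by blast
      show "x $ i < (x + h *\<^sub>R One) $ i" using h by (simp add: One)
      show "(x + h *\<^sub>R One) $ i \<le> 2 * pi" using h mi[of i] by (simp add: One)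
    qed
    then show False using d(2) h gx by auto
  qed
  have "negligible (N \<union> (cbox 0 p - box 0 p))"
    using N(1) negligible_frontier_interval by (rule negligible_Un)
  then have "N \<union> (cbox 0 p - box 0 p) \<in> null_sets lebesgue" by (simp add: negligible_iff_null_sets)
  then have "AE x in lebesgue. x \<notin> N \<union> (cbox 0 p - box 0 p)" by (rule AE_not_in)
  then have "AE x in lebesgue. x \<in> torus_cell \<longrightarrow> f x = 0"
    by eventually_elim (use fz cell in auto)
  then show ?thesis unfolding torus_def by (subst AE_restrict_space_iff) simp_all
qed

lemma integrable_Lp_torus_1: "G \<in> Lp_torus 1 \<Longrightarrow> integrable torus G"
  by (rule integrable_norm_cancel) (simp_all add: Lp_torus_def)

lemma has_weak_grad_weak_partial:
  assumes u: "integrable torus u" and G: "has_weak_grad u G"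
  shows "weak_partial j (\<lambda>x. u x $ i) (\<lambda>x. G x $ i $ j)" "integrable torus G"
proof -
  show Gi: "integrable torus G" using G integrable_Lp_torus_1 by (auto simp: has_weak_grad_def)
  have "integrable torus (\<lambda>x. u x $ i)" by (rule integrable_bounded_linear[OF bounded_linear_vec_nth u])
  moreover have "integrable torus (\<lambda>x. G x $ i $ j)"
    by (rule integrable_bounded_linear[OF bounded_linear_vec_nth integrable_bounded_linear[OF bounded_linear_vec_nth Gi]])
  ultimately show "weak_partial j (\<lambda>x. u x $ i) (\<lambda>x. G x $ i $ j)"
    using G by (simp add: weak_partial_def has_weak_grad_def smooth_periodic_def)
qed

lemma weak_partial_unique:
  assumes "weak_partial j f g" "weak_partial j f h"
  shows "AE x in torus. g x = h x"
proof -
  have gh: "integrable torus g" "integrable torus h" using assms by (auto simp: weak_partial_def)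
  have "AE x in torus. g x - h x = 0"
  proof (rule weak_zero_imp_AE_zero)
    show "integrable torus (\<lambda>x. g x - h x)" using gh by simp
    fix \<psi> :: "real^3 \<Rightarrow> real" assume \<psi>: "smooth_periodic \<psi>"
    have i: "integrable torus (\<lambda>x. g x * \<psi> x)" "integrable torus (\<lambda>x. h x * \<psi> x)"
      using smooth_periodic_times_integrable[OF \<psi> gh(1)] smooth_periodic_times_integrable[OF \<psi> gh(2)]
      by (simp_all add: mult.commute)
    have "(LINT x|torus. g x * \<psi> x) = (LINT x|torus. h x * \<psi> x)"
      using assms \<psi> by (simp add: weak_partial_def)
    then show "(LINT x|torus. (g x - h x) * \<psi> x) = 0" using i by (simp add: left_diff_distrib)
  qed
  then show ?thesis by simp
qed

text \<open>
  The chosen representative \<open>weak_grad u\<close> is known to be a weak gradient, and another weak gradient is known to be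
  in \<open>Lq\<close>; they agree almost everywhere.
\<close>

lemma W1_torus_weak_gradient:
  assumes u: "u \<in> W1_torus q" "integrable torus u" and q: "q > 1"
  obtains G where "integrable torus G" "\<And>i j. weak_partial j (\<lambda>x. u x $ i) (\<lambda>x. G x $ i $ j)"
    "integrable torus (\<lambda>x. norm (G x) powr q)" "(LINT x|torus. norm (G x) powr q) \<le> W1_norm q u powr q"
proof -
  obtain G where G: "has_weak_grad u G" "G \<in> Lp_torus q" using u by (auto simp: W1_torus_def)
  have wg: "has_weak_grad u (weak_grad u)" unfolding weak_grad_def by (rule someI[of "has_weak_grad u", OF G(1)])
  note wG = has_weak_grad_weak_partial[OF u(2) G(1)]
  note wW = has_weak_grad_weak_partial[OF u(2) wg]
  have "AE x in torus. G x $ i $ j = weak_grad u x $ i $ j" for i j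
    by (rule weak_partial_unique[OF wG(1) wW(1)])
  then have "AE x in torus. \<forall>i j. G x $ i $ j = weak_grad u x $ i $ j" by (simp add: AE_all_countable)
  then have eq: "AE x in torus. norm (G x) powr q = norm (weak_grad u x) powr q"
  proof eventually_elim
    case (elim x)
    then have "G x = weak_grad u x" by (simp add: vec_eq_iff)
    then show ?case by simp
  qed
  have Gq: "integrable torus (\<lambda>x. norm (G x) powr q)" using G(2) by (simp add: Lp_torus_def)
  have m: "(\<lambda>x. norm (weak_grad u x) powr q) \<in> borel_measurable torus"
    using borel_measurable_integrable[OF wW(2)] by measurable
  have "(LINT x|torus. norm (G x) powr q) = (LINT x|torus. norm (weak_grad u x) powr q)"
    by (rule integral_cong_AE[OF borel_measurable_integrable[OF Gq] m eq])
  also have "\<dots> = Lp_norm q (weak_grad u) powr q"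
    using q by (simp add: Lp_norm_def powr_powr)
  also have "\<dots> \<le> W1_norm q u powr q"
    using q by (simp add: W1_norm_def powr_powr)
  finally show ?thesis using that wG Gq by blast
qed

definition gradient :: "(real^3 \<Rightarrow> real) \<Rightarrow> real^3 \<Rightarrow> real^3" where
  "gradient \<psi> x = (\<chi> i. partial_d i \<psi> x)"

lemma gradient_smooth: "smooth_periodic \<psi> \<Longrightarrow> smooth_periodic (gradient \<psi>)"
  by (rule smooth_periodic_vecI) (simp add: gradient_def smooth_periodic_derivative(2))

text \<open>Orthogonality to gradients is preserved by limits in \<open>L2\<close>, unlike a pointwise divergence.\<close>

definition solenoidal :: "(real^3 \<Rightarrow> real^3) \<Rightarrow> bool" where
  "solenoidal u \<longleftrightarrow> u \<in> L2 \<and> (\<forall>\<psi>. smooth_periodic \<psi> \<longrightarrow> ip u (gradient \<psi>) = 0)"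

lemma solenoidal_smooth:
  assumes u: "smooth_periodic u" and div: "\<And>x. divergence u x = 0"
  shows "solenoidal u"
  unfolding solenoidal_def
proof (intro conjI allI impI smooth_periodic_L2[OF u])
  fix \<psi> :: "real^3 \<Rightarrow> real" assume \<psi>: "smooth_periodic \<psi>"
  have ci: "smooth_periodic (\<lambda>x. u x $ i)" for i by (rule smooth_periodic_component[OF u])
  have pi: "smooth_periodic (\<lambda>x. partial_d i u x $ i)" for i
    by (rule smooth_periodic_component[OF smooth_periodic_derivative(2)[OF u]])
  have "ip u (gradient \<psi>) = (LINT x|torus. (\<Sum>i\<in>UNIV. u x $ i * partial_d i \<psi> x))"
    by (simp add: ip_def gradient_def inner_vec_def)
  also have "\<dots> = (\<Sum>i\<in>UNIV. LINT x|torus. u x $ i * partial_d i \<psi> x)"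
    by (rule Bochner_Integration.integral_sum)
       (intro integrable_smooth_periodic smooth_periodic_mult ci smooth_periodic_derivative(2)[OF \<psi>])
  also have "\<dots> = (\<Sum>i\<in>UNIV. - (LINT x|torus. partial_d i u x $ i * \<psi> x))"
    by (simp add: torus_integration_by_parts[OF ci \<psi>] partial_d_component[OF u])
  also have "\<dots> = - (LINT x|torus. (\<Sum>i\<in>UNIV. partial_d i u x $ i * \<psi> x))"
    unfolding sum_negf
    by (subst Bochner_Integration.integral_sum) (auto intro!: integrable_smooth_periodic smooth_periodic_mult pi \<psi>)
  also have "\<dots> = - (LINT x|torus. divergence u x * \<psi> x)"
    by (simp add: divergence_def sum_distrib_right)
  finally show "ip u (gradient \<psi>) = 0" by (simp add: div)
qed

text \<open>The divergence of the mollified field at \<open>x\<close> is the pairing with the gradient of the kernel centred at \<open>x\<close>.\<close>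

lemma solenoidal_mol:
  assumes "solenoidal u" shows "divergence (mol n u) x = 0"
proof -
  have uL: "u \<in> L2" using assms by (simp add: solenoidal_def)
  have ui: "integrable torus u" by (rule L2_integrable[OF uL])
  have es: "smooth_periodic (\<lambda>y. eta n (x - y))" by (rule finite_rank_smooth(2)[OF eta_finite_rank])
  have ki: "integrable torus (\<lambda>y. partial_d i (eta n) (x - y) * u y $ i)" for i
    using integrable_bounded_linear[OF bounded_linear_vec_nth partial_d_mol_kernel(2)[OF ui]] by simp
  have "divergence (mol n u) x = (\<Sum>i\<in>UNIV. LINT y|torus. partial_d i (eta n) (x - y) * u y $ i)"
    unfolding divergence_def partial_d_mol_kernel(1)[OF ui]
    using integral_bounded_linear[OF bounded_linear_vec_nth partial_d_mol_kernel(2)[OF ui]] by simp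
  also have "\<dots> = (LINT y|torus. (\<Sum>i\<in>UNIV. partial_d i (eta n) (x - y) * u y $ i))"
    by (rule Bochner_Integration.integral_sum[symmetric]) (rule ki)
  also have "\<dots> = (LINT y|torus. - (u y \<bullet> gradient (\<lambda>y. eta n (x - y)) y))"
    by (simp add: gradient_def inner_vec_def partial_d_eta(2) sum_negf mult.commute)
  also have "\<dots> = - ip u (gradient (\<lambda>y. eta n (x - y)))" by (simp add: ip_def)
  also have "\<dots> = 0" using assms es by (simp add: solenoidal_def)
  finally show ?thesis .
qed

lemma L2_limI_approx:
  fixes f :: "real^3 \<Rightarrow> real^3"
  assumes f: "f \<in> L2" and a: "\<And>e. e > 0 \<Longrightarrow> \<exists>g\<in>V. Lp_norm 2 (\<lambda>x. f x - g x) < e" and V: "V \<subseteq> L2"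
  shows "\<exists>F. L2_lim F f \<and> (\<forall>n. F n \<in> V)"
proof -
  have "\<exists>g. g \<in> V \<and> Lp_norm 2 (\<lambda>x. f x - g x) < inverse (real (Suc n))" for n
    using a[of "inverse (real (Suc n))"] by auto
  then obtain F where F: "\<And>n. F n \<in> V" "\<And>n. Lp_norm 2 (\<lambda>x. f x - F n x) < inverse (real (Suc n))"
    by metis
  have "(\<lambda>n. Lp_norm 2 (\<lambda>x. F n x - f x)) \<longlonglongrightarrow> 0"
  proof (rule tendsto_sandwich[OF _ _ tendsto_const LIMSEQ_inverse_real_of_nat])
    show "\<forall>\<^sub>F n in sequentially. 0 \<le> Lp_norm 2 (\<lambda>x. F n x - f x)" by (simp add: Lp_norm_2_nonneg)
    show "\<forall>\<^sub>F n in sequentially. Lp_norm 2 (\<lambda>x. F n x - f x) \<le> inverse (real (Suc n))"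
    proof (intro always_eventually allI)
      fix n show "Lp_norm 2 (\<lambda>x. F n x - f x) \<le> inverse (real (Suc n))"
        by (subst Lp_norm_minus_commute) (rule less_imp_le[OF F(2)])
    qed
  qed
  then show ?thesis using F(1) V f by (auto simp: L2_lim_def)
qed

definition smooth_solenoidal :: "(real^3 \<Rightarrow> real^3) set" where
  "smooth_solenoidal = {g. smooth_periodic g \<and> (\<forall>x. divergence g x = 0)}"

lemma smooth_solenoidal_L2: "smooth_solenoidal \<subseteq> L2"
  by (auto simp: smooth_solenoidal_def smooth_periodic_L2)

lemma smooth_solenoidal_linear:
  assumes "f \<in> smooth_solenoidal" "g \<in> smooth_solenoidal"
  shows "(\<lambda>x. a *\<^sub>R f x + b *\<^sub>R g x) \<in> smooth_solenoidal"
proof -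
  have fg: "smooth_periodic f" "smooth_periodic g" "\<And>x. divergence f x = 0" "\<And>x. divergence g x = 0"
    using assms by (auto simp: smooth_solenoidal_def)
  have s: "smooth_periodic (\<lambda>x. a *\<^sub>R f x)" "smooth_periodic (\<lambda>x. b *\<^sub>R g x)"
    by (rule smooth_periodic_scaleR[OF smooth_periodic_const], rule fg)+
  have pd: "partial_d j (\<lambda>x. a *\<^sub>R f x + b *\<^sub>R g x) x = a *\<^sub>R partial_d j f x + b *\<^sub>R partial_d j g x" for j x
    unfolding partial_d_simps(1)[OF s]
    by (simp add: partial_d_simps(6)[OF bounded_linear_scaleR_right] fg)
  have "divergence (\<lambda>x. a *\<^sub>R f x + b *\<^sub>R g x) x = a * divergence f x + b * divergence g x" for x
    by (simp add: divergence_def pd sum.distrib sum_distrib_left)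
  then show ?thesis by (simp add: smooth_solenoidal_def fg s smooth_periodic_add)
qed

lemma space_H_approx:
  assumes "f \<in> space_H"
  shows "f \<in> L2" "\<And>e. e > 0 \<Longrightarrow> \<exists>g\<in>smooth_solenoidal. Lp_norm 2 (\<lambda>x. f x - g x) < e"
  using assms by (auto simp: space_H_def smooth_solenoidal_def smooth_periodic_def)

lemma space_H_solenoidal:
  assumes f: "f \<in> space_H" shows "solenoidal f"
proof -
  note a = space_H_approx[OF f]
  obtain F where F: "L2_lim F f" "\<And>n. F n \<in> smooth_solenoidal"
    using L2_limI_approx[OF a smooth_solenoidal_L2] by blast
  have "ip f (gradient \<psi>) = 0" if \<psi>: "smooth_periodic \<psi>" for \<psi>
  proof -
    have "(\<lambda>n. ip (F n) (gradient \<psi>)) \<longlonglongrightarrow> ip f (gradient \<psi>)"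
      by (rule L2_lim_ip[OF F(1) smooth_periodic_L2[OF gradient_smooth[OF \<psi>]]])
    moreover have "ip (F n) (gradient \<psi>) = 0" for n
      using F(2)[of n] solenoidal_smooth[of "F n"] \<psi> by (simp add: smooth_solenoidal_def solenoidal_def)
    ultimately show ?thesis by (simp add: LIMSEQ_const_iff)
  qed
  then show ?thesis using a(1) by (simp add: solenoidal_def)
qed

lemma space_H_mol_lim:
  assumes f: "f \<in> space_H" shows "L2_lim (\<lambda>n. mol n f) f"
  by (rule mol_L2_lim[OF space_H_approx(1)[OF f]])
     (use space_H_approx(2)[OF f] in \<open>auto simp: smooth_solenoidal_def\<close>)

section \<open>Continuity of the flux\<close>

lemma norm_le_sum_components: "norm (x::'a::real_normed_vector^'n) \<le> (\<Sum>i\<in>UNIV. norm (x $ i))"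
  unfolding norm_vec_def by (rule L2_set_le_sum) simp

text \<open>At a fixed scale, mollified gradients are controlled uniformly in space by the \<open>L2\<close> norm.\<close>

lemma grad_mol_bound:
  obtains D where "D \<ge> 0" "\<And>g x. g \<in> L2 \<Longrightarrow> norm (grad (mol n g) x) \<le> D * Lp_norm 2 g"
proof -
  have "\<exists>B. B > 0 \<and> (\<forall>z. norm (partial_d j (eta n) z) \<le> B)" for j
    using periodic_bounded[OF smooth_periodicD(2,3)[OF smooth_periodic_derivative(2)[OF eta_smooth]]] by metis
  then obtain B where B: "\<And>j. B j > 0" "\<And>j z. norm (partial_d j (eta n) z) \<le> B j" by metis
  define c where "c = Lp_norm 2 (\<lambda>x::real^3. 1::real)"
  define D where "D = (\<Sum>i\<in>(UNIV::3 set). \<Sum>j\<in>UNIV. B j * c)"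
  have c: "c \<ge> 0" by (simp add: c_def Lp_norm_2_nonneg)
  have "norm (grad (mol n g) x) \<le> D * Lp_norm 2 g" if g: "g \<in> L2" for g x
  proof -
    have gi: "integrable torus g" by (rule L2_integrable[OF g])
    have e: "norm (partial_d j (mol n g) x) \<le> B j * c * Lp_norm 2 g" for j
    proof -
      have "norm (partial_d j (mol n g) x) \<le> (LINT y|torus. B j * norm (g y))"
        unfolding partial_d_mol_kernel(1)[OF gi]
        by (rule Bochner_Integration.integral_norm_bound_integral[OF partial_d_mol_kernel(2)[OF gi]])
           (use B gi in \<open>auto intro!: mult_right_mono\<close>)
      also have "\<dots> = B j * (LINT y|torus. norm (g y))" by simp
      also have "\<dots> \<le> B j * (c * Lp_norm 2 g)"
        unfolding c_def using B(1) by (intro mult_left_mono LINT_norm_le_Lp_norm_2[OF g]) (simp add: less_imp_le)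
      finally show ?thesis by simp
    qed
    have "norm (grad (mol n g) x) \<le> (\<Sum>i\<in>UNIV. norm (grad (mol n g) x $ i))"
      by (rule norm_le_sum_components)
    also have "\<dots> \<le> (\<Sum>i\<in>UNIV. \<Sum>j\<in>UNIV. norm (grad (mol n g) x $ i $ j))"
      by (intro sum_mono norm_le_sum_components)
    also have "\<dots> \<le> (\<Sum>i\<in>(UNIV::3 set). \<Sum>j\<in>UNIV. B j * c * Lp_norm 2 g)"
    proof (intro sum_mono)
      fix i j
      have "norm (grad (mol n g) x $ i $ j) \<le> norm (partial_d j (mol n g) x)"
        unfolding grad_def vec_lambda_beta by (rule Finite_Cartesian_Product.norm_nth_le)
      then show "norm (grad (mol n g) x $ i $ j) \<le> B j * c * Lp_norm 2 g" using e[of j] by linarith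
    qed
    also have "\<dots> = D * Lp_norm 2 g" by (simp add: D_def sum_distrib_right)
    finally show ?thesis .
  qed
  moreover have "D \<ge> 0" unfolding D_def by (intro sum_nonneg mult_nonneg_nonneg c less_imp_le B)
  ultimately show ?thesis using that by blast
qed

lemma matrix_form_integrable:
  fixes a b :: "real^3 \<Rightarrow> real^3" and A :: "real^3 \<Rightarrow> real^3^3"
  assumes a: "a \<in> L2" and b: "b \<in> L2" and A: "continuous_on UNIV A" and K: "\<And>x. norm (A x) \<le> K"
  shows "integrable torus (\<lambda>x. a x \<bullet> (A x *v b x))"
    and "\<bar>LINT x|torus. a x \<bullet> (A x *v b x)\<bar> \<le> K * (Lp_norm 2 a * Lp_norm 2 b)"
proof -
  have bd: "\<bar>a x \<bullet> (A x *v b x)\<bar> \<le> K * (norm (a x) * norm (b x))" for x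
  proof -
    have "\<bar>a x \<bullet> (A x *v b x)\<bar> \<le> norm (a x) * norm (A x *v b x)" by (rule Cauchy_Schwarz_ineq2)
    also have "\<dots> \<le> norm (a x) * (K * norm (b x))"
      by (intro mult_left_mono order_trans[OF norm_matrix_vector_le] mult_right_mono K) auto
    finally show ?thesis by (simp add: mult_ac)
  qed
  have ab: "integrable torus (\<lambda>x. K * (norm (a x) * norm (b x)))"
    using L2_inner_integrable[OF L2_norm[OF a] L2_norm[OF b]] by simp
  show i: "integrable torus (\<lambda>x. a x \<bullet> (A x *v b x))"
  proof (rule Bochner_Integration.integrable_bound[OF ab])
    have Am: "A \<in> borel_measurable torus" by (rule borel_measurable_integrable[OF integrable_torus_continuous[OF A]])
    have "(\<lambda>x. A x \<bullet> (\<chi> i j. a x $ i * b x $ j)) \<in> borel_measurable torus"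
      unfolding inner_vec_def vec_lambda_beta inner_real_def
      by (intro borel_measurable_sum borel_measurable_times)
         (rule measurable_compose[OF Am] measurable_compose[OF L2D(2)[OF a]] measurable_compose[OF L2D(2)[OF b]],
           rule borel_measurable_continuous_onI, intro continuous_intros)+
    moreover have "A x \<bullet> (\<chi> i j. a x $ i * b x $ j) = a x \<bullet> (A x *v b x)" for x
      by (simp add: inner_vec_def matrix_vector_mult_def sum_distrib_left mult_ac)
    ultimately show "(\<lambda>x. a x \<bullet> (A x *v b x)) \<in> borel_measurable torus" by simp
    show "AE x in torus. norm (a x \<bullet> (A x *v b x)) \<le> norm (K * (norm (a x) * norm (b x)))"
      by (rule AE_I2) (use order_trans[OF bd abs_ge_self] in simp)
  qed
  have "\<bar>LINT x|torus. a x \<bullet> (A x *v b x)\<bar> \<le> (LINT x|torus. K * (norm (a x) * norm (b x)))"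
    unfolding real_norm_def[symmetric]
    by (rule Bochner_Integration.integral_norm_bound_integral[OF i ab]) (use bd in simp)
  also have "\<dots> = K * ip (\<lambda>x. norm (a x)) (\<lambda>x. norm (b x))" by (simp add: ip_def)
  also have "\<dots> \<le> K * (Lp_norm 2 a * Lp_norm 2 b)"
  proof (rule mult_left_mono)
    show "ip (\<lambda>x. norm (a x)) (\<lambda>x. norm (b x)) \<le> Lp_norm 2 a * Lp_norm 2 b"
      using ip_Cauchy_Schwarz[OF L2_norm[OF a] L2_norm[OF b]] by (simp add: Lp_norm_2_norm)
    show "0 \<le> K" using K[of 0] norm_ge_zero order_trans by blast
  qed
  finally show "\<bar>LINT x|torus. a x \<bullet> (A x *v b x)\<bar> \<le> K * (Lp_norm 2 a * Lp_norm 2 b)" .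
qed

lemma grad_bounded:
  assumes "smooth_periodic \<phi>" obtains K where "K \<ge> 0" "\<And>x. norm (grad \<phi> x) \<le> K"
  using periodic_bounded[OF grad_periodic[OF assms] grad_continuous[OF assms]] less_imp_le by metis

lemma flux_form_integrable:
  "u \<in> L2 \<Longrightarrow> smooth_periodic \<phi> \<Longrightarrow> integrable torus (\<lambda>x. u x \<bullet> (grad \<phi> x *v u x))"
  by (rule grad_bounded, assumption) (rule matrix_form_integrable(1)[OF _ _ grad_continuous])

lemma flux_form_le:
  "u \<in> L2 \<Longrightarrow> smooth_periodic \<phi> \<Longrightarrow> (\<And>x. norm (grad \<phi> x) \<le> K) \<Longrightarrow> \<bar>flux_form u \<phi>\<bar> \<le> K * (Lp_norm 2 u)\<^sup>2"
  unfolding flux_form_def power2_eq_square by (rule matrix_form_integrable(2)) (auto intro: grad_continuous)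

lemma grad_linear:
  assumes "smooth_periodic f" "smooth_periodic g"
  shows "grad (\<lambda>x. a *\<^sub>R f x + b *\<^sub>R g x) x = a *\<^sub>R grad f x + b *\<^sub>R grad g x"
proof -
  have s: "smooth_periodic (\<lambda>x. a *\<^sub>R f x)" "smooth_periodic (\<lambda>x. b *\<^sub>R g x)"
    by (rule smooth_periodic_scaleR[OF smooth_periodic_const], rule assms)+
  have "partial_d j (\<lambda>x. a *\<^sub>R f x + b *\<^sub>R g x) x = a *\<^sub>R partial_d j f x + b *\<^sub>R partial_d j g x" for j
    unfolding partial_d_simps(1)[OF s]
    by (simp add: partial_d_simps(6)[OF bounded_linear_scaleR_right] assms)
  then show ?thesis by (simp add: grad_def vec_eq_iff)
qed

lemma flux_form_linear:
  assumes u: "u \<in> L2" and f: "smooth_periodic f" and g: "smooth_periodic g"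
  shows "flux_form u (\<lambda>x. a *\<^sub>R f x + b *\<^sub>R g x) = a * flux_form u f + b * flux_form u g"
  unfolding flux_form_def grad_linear[OF f g]
  using flux_form_integrable[OF u f] flux_form_integrable[OF u g]
  by (simp add: matrix_vector_mult_add_rdistrib scaleR_matrix_vector_assoc[symmetric] inner_add_right)

lemma L2_lim_diff: "L2_lim F f \<Longrightarrow> (\<lambda>n. Lp_norm 2 (\<lambda>x. F n x - f x)) \<longlonglongrightarrow> 0"
  by (simp add: L2_lim_def)

lemma null_dominated:
  fixes f g :: "nat \<Rightarrow> real"
  assumes "\<And>k. \<bar>f k\<bar> \<le> g k" "g \<longlonglongrightarrow> L" "L = 0"
  shows "f \<longlonglongrightarrow> 0"
  by (rule Lim_null_comparison[OF always_eventually]) (use assms in auto)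

text \<open>The flux is quadratic in the field with a bounded coefficient, hence continuous in \<open>L2\<close>.\<close>

lemma flux_form_tendsto:
  assumes F: "L2_lim F u" and \<phi>: "smooth_periodic \<phi>"
  shows "(\<lambda>k. flux_form (F k) \<phi>) \<longlonglongrightarrow> flux_form u \<phi>"
proof -
  obtain K where K: "K \<ge> 0" "\<And>x. norm (grad \<phi> x) \<le> K" using grad_bounded[OF \<phi>] by blast
  have L: "F k \<in> L2" "u \<in> L2" for k using F by (auto simp: L2_lim_def)
  note mf = matrix_form_integrable[OF _ _ grad_continuous[OF \<phi>] K(2)]
  have "\<bar>flux_form (F k) \<phi> - flux_form u \<phi>\<bar> \<le>
      K * (Lp_norm 2 (\<lambda>x. F k x - u x) * (Lp_norm 2 (F k) + Lp_norm 2 u))" for k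
  proof -
    note d = L2_diff[OF L(1)[of k] L(2)]
    have "flux_form (F k) \<phi> - flux_form u \<phi> =
        (LINT x|torus. F k x \<bullet> (grad \<phi> x *v F k x) - u x \<bullet> (grad \<phi> x *v u x))"
      unfolding flux_form_def using mf(1)[OF L(1) L(1)] mf(1)[OF L(2) L(2)] by simp
    also have "\<dots> = (LINT x|torus. (F k x - u x) \<bullet> (grad \<phi> x *v F k x) + u x \<bullet> (grad \<phi> x *v (F k x - u x)))"
      by (intro Bochner_Integration.integral_cong refl)
         (simp add: inner_diff_left inner_diff_right matrix_vector_mult_diff_distrib)
    also have "\<dots> = (LINT x|torus. (F k x - u x) \<bullet> (grad \<phi> x *v F k x)) +
        (LINT x|torus. u x \<bullet> (grad \<phi> x *v (F k x - u x)))"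
      by (rule Bochner_Integration.integral_add[OF mf(1)[OF d L(1)] mf(1)[OF L(2) d]])
    finally show ?thesis
      using mf(2)[OF d L(1), of k] mf(2)[OF L(2) d] by (simp add: algebra_simps)
  qed
  moreover have "(\<lambda>k. K * (Lp_norm 2 (\<lambda>x. F k x - u x) * (Lp_norm 2 (F k) + Lp_norm 2 u))) \<longlonglongrightarrow>
      K * (0 * (Lp_norm 2 u + Lp_norm 2 u))"
    by (rule tendsto_mult[OF tendsto_const tendsto_mult[OF L2_lim_diff[OF F]
            tendsto_add[OF L2_lim_norm[OF F] tendsto_const]]])
  ultimately have "(\<lambda>k. flux_form (F k) \<phi> - flux_form u \<phi>) \<longlonglongrightarrow> 0"
    by (rule null_dominated) simp
  then show ?thesis by (simp add: LIM_zero_iff)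
qed

lemma mol_mol_smooth: "u \<in> L2 \<Longrightarrow> smooth_periodic (mol n (mol n u))"
  by (rule mol_smooth[OF L2_integrable[OF mol_L2]])

lemma flux_tendsto:
  assumes F: "L2_lim F u"
  shows "(\<lambda>k. flux_form (F k) (mol n (mol n (F k)))) \<longlonglongrightarrow> flux_form u (mol n (mol n u))"
proof -
  obtain D where D: "D \<ge> 0" "\<And>g x. g \<in> L2 \<Longrightarrow> norm (grad (mol n g) x) \<le> D * Lp_norm 2 g"
    using grad_mol_bound[of n] by blast
  have L: "F k \<in> L2" "u \<in> L2" for k using F by (auto simp: L2_lim_def)
  have "\<bar>flux_form (F k) (mol n (mol n (F k))) - flux_form (F k) (mol n (mol n u))\<bar> \<le>
      D * Lp_norm 2 (\<lambda>x. F k x - u x) * (Lp_norm 2 (F k))\<^sup>2" for k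
  proof -
    note d = L2_diff[OF L(1)[of k] L(2)]
    have eq: "mol n (mol n (\<lambda>x. F k x - u x)) = (\<lambda>x. mol n (mol n (F k)) x - mol n (mol n u) x)"
    proof -
      have 1: "mol n (\<lambda>x. F k x - u x) = (\<lambda>x. mol n (F k) x - mol n u x)"
        by (simp add: fun_eq_iff mol_diff L2_integrable L)
      show ?thesis
        unfolding 1 by (simp add: fun_eq_iff mol_diff[OF L2_integrable[OF mol_L2[OF L(1)]] L2_integrable[OF mol_L2[OF L(2)]]])

    qed
    have "norm (grad (mol n (mol n (\<lambda>x. F k x - u x))) x) \<le> D * Lp_norm 2 (\<lambda>x. F k x - u x)" for x
      using D(2)[OF mol_L2[OF d], of n x] mult_left_mono[OF mol_Lp_norm_2_le[OF d, of n] D(1)] by linarith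
    from flux_form_le[OF L(1)[of k] mol_mol_smooth[OF d] this]
    show ?thesis
      unfolding eq
      using flux_form_linear[OF L(1)[of k] mol_mol_smooth[OF L(1)[of k]] mol_mol_smooth[OF L(2)], of 1 n "-1" n]
      by simp
  qed
  moreover have "(\<lambda>k. D * Lp_norm 2 (\<lambda>x. F k x - u x) * (Lp_norm 2 (F k))\<^sup>2) \<longlonglongrightarrow> D * 0 * (Lp_norm 2 u)\<^sup>2"
    by (rule tendsto_mult[OF tendsto_mult[OF tendsto_const L2_lim_diff[OF F]] tendsto_power[OF L2_lim_norm[OF F]]])
  ultimately have "(\<lambda>k. flux_form (F k) (mol n (mol n (F k))) - flux_form (F k) (mol n (mol n u))) \<longlonglongrightarrow> 0"
    by (rule null_dominated) simp
  from tendsto_add[OF this flux_form_tendsto[OF F mol_mol_smooth[OF L(2), of n]]] show ?thesis by simp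
qed

text \<open>
  The bound for the smooth solenoidal fields \<open>mol k u\<close> is uniform in \<open>k\<close>, since mollification increases neither the
  energy nor the \<open>Lq\<close> norm of the gradient, and it passes to the limit.
\<close>

lemma flux_estimate:
  fixes u :: "real^3 \<Rightarrow> real^3"
  assumes u: "u \<in> space_H" "u \<in> W1_torus q" and q: "q > 2" and A: "A > 0" "W1_norm q u \<le> A"
    and E: "ip u u \<le> E" and \<theta>: "0 \<le> \<theta>" "\<theta> \<le> 1" "\<theta> * (q - 2) \<le> 1"
  shows "\<bar>flux_form u (mol n (mol n u))\<bar> \<le> 582 * (4 * E + 2) *
    (1 / real (Suc n)) powr (\<theta> - 3 * (1 - \<theta> * (q - 2)) / (2 * q)) * A powr (1 + 2 * \<theta>)" (is "_ \<le> ?B")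
proof -
  have uL: "u \<in> L2" by (rule space_H_approx(1)[OF u(1)])
  have ui: "integrable torus u" by (rule L2_integrable[OF uL])
  obtain G where G: "integrable torus G" "\<And>i j. weak_partial j (\<lambda>x. u x $ i) (\<lambda>x. G x $ i $ j)"
    "integrable torus (\<lambda>x. norm (G x) powr q)" "(LINT x|torus. norm (G x) powr q) \<le> W1_norm q u powr q"
    by (rule W1_torus_weak_gradient[OF u(2) ui]) (use q in auto)
  have "\<bar>flux_form (mol k u) (mol n (mol n (mol k u)))\<bar> \<le> ?B" for k
  proof (rule flux_estimate_smooth[OF mol_smooth[OF ui] _ q A(1) _ _ \<theta>])
    have "solenoidal (mol k u)"
      by (rule solenoidal_smooth[OF mol_smooth[OF ui] solenoidal_mol[OF space_H_solenoidal[OF u(1)]]])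
    then show "divergence (mol n (mol k u)) x = 0" for x by (rule solenoidal_mol)
    have "(Lp_norm 2 (mol k u))\<^sup>2 \<le> (Lp_norm 2 u)\<^sup>2"
      by (intro power_mono mol_Lp_norm_2_le[OF uL] Lp_norm_2_nonneg)
    then show "ip (mol k u) (mol k u) \<le> E" using E by (simp add: Lp_norm_2_squared)
    have "(LINT x|torus. norm (grad (mol k u) x) powr q) \<le> (LINT x|torus. norm (G x) powr q)"
      unfolding grad_mol[OF ui G(1,2)] by (rule mol_Lp[OF _ G(1,3)]) (use q in simp)
    also have "\<dots> \<le> W1_norm q u powr q" by (rule G(4))
    also have "\<dots> \<le> A powr q" using A q by (intro powr_mono2) (auto simp: W1_norm_def)
    finally show "(LINT x|torus. norm (grad (mol k u) x) powr q) \<le> A powr q" .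
  qed
  moreover have "(\<lambda>k. \<bar>flux_form (mol k u) (mol n (mol n (mol k u)))\<bar>) \<longlonglongrightarrow> \<bar>flux_form u (mol n (mol n u))\<bar>"
    by (intro tendsto_rabs flux_tendsto space_H_mol_lim u(1))
  ultimately show ?thesis by (intro LIMSEQ_le_const2) auto
qed

section \<open>From the weak formulation to an equation in time\<close>

lemma AE_time_iff:
  fixes T :: real
  shows "(AE t in lebesgue_on {0<..<T}. P t) \<longleftrightarrow> (AE t in lebesgue. 0 < t \<and> t < T \<longrightarrow> P t)"
  by (subst AE_restrict_space_iff) simp_all

lemma borel_measurable_time_AE:
  fixes f g :: "real \<Rightarrow> real"
  assumes f: "f \<in> borel_measurable (lebesgue_on {0<..<T})" and ae: "AE t in lebesgue_on {0<..<T}. f t = g t"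
  shows "g \<in> borel_measurable (lebesgue_on {0<..<T})"
proof -
  have S: "{0<..<T} \<in> sets lebesgue" by simp
  have "(\<lambda>t. if t \<in> {0<..<T} then f t else 0) \<in> borel_measurable lebesgue"
    using f borel_measurable_if[OF S, of f] by blast
  moreover have "AE t in lebesgue. (if t \<in> {0<..<T} then f t else 0) = (if t \<in> {0<..<T} then g t else 0)"
    using ae unfolding AE_time_iff by eventually_elim auto
  ultimately have "(\<lambda>t. if t \<in> {0<..<T} then g t else 0) \<in> borel_measurable lebesgue"
    by (rule borel_measurable_AE)
  then show ?thesis using borel_measurable_if[OF S, of g] by blast
qed

text \<open>A set of full measure is dense.\<close>

lemma continuous_AE_le:
  fixes f :: "real \<Rightarrow> real"
  assumes T: "T > 0" and f: "continuous_on {0..T} f" and ae: "AE t in lebesgue_on {0<..<T}. f t \<le> c"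
    and t: "t \<in> {0..T}"
  shows "f t \<le> c"
proof (rule ccontr)
  assume "\<not> f t \<le> c"
  then obtain d where d: "d > 0" "\<And>s. s \<in> {0..T} \<Longrightarrow> dist s t < d \<Longrightarrow> dist (f s) (f t) < f t - c"
    using f[unfolded continuous_on_iff, rule_format, OF t, of "f t - c"] by auto
  define a b where "a = max 0 (t - d)" and "b = min T (t + d)"
  have "a < b" using t T d(1) by (auto simp: a_def b_def)
  have "{a<..<b} \<subseteq> {s. \<not> (0 < s \<and> s < T \<longrightarrow> f s \<le> c)}"
  proof
    fix s assume s: "s \<in> {a<..<b}"
    then have "s \<in> {0..T}" "dist s t < d" "0 < s" "s < T" by (auto simp: a_def b_def dist_real_def)
    with d(2)[of s] show "s \<in> {s. \<not> (0 < s \<and> s < T \<longrightarrow> f s \<le> c)}" by (auto simp: dist_real_def)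
  qed
  moreover have "{s. \<not> (0 < s \<and> s < T \<longrightarrow> f s \<le> c)} \<in> null_sets lebesgue"
    using ae unfolding AE_time_iff by (subst (asm) completion.AE_iff_null_sets) simp
  ultimately have "negligible {a<..<b}"
    unfolding negligible_iff_null_sets[symmetric] by (rule negligible_subset[rotated])
  moreover have "\<not> negligible {a<..<b}" using \<open>a < b\<close> by (intro open_not_negligible) auto
  ultimately show False by simp
qed

lemma continuous_AE_eq:
  fixes f g :: "real \<Rightarrow> real"
  assumes T: "T > 0" and f: "continuous_on {0..T} f" and g: "continuous_on {0..T} g"
    and ae: "AE t in lebesgue_on {0<..<T}. f t = g t" and t: "t \<in> {0..T}"
  shows "f t = g t"
proof -
  have "f t - g t \<le> 0"
    by (rule continuous_AE_le[OF T _ _ t, of "\<lambda>t. f t - g t"])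
       (use ae in \<open>auto intro!: continuous_intros f g elim: eventually_mono\<close>)
  moreover have "g t - f t \<le> 0"
    by (rule continuous_AE_le[OF T _ _ t, of "\<lambda>t. g t - f t"])
       (use ae in \<open>auto intro!: continuous_intros f g elim: eventually_mono\<close>)
  ultimately show ?thesis by simp
qed

lemma LINT_time_eq_integral:
  fixes h :: "real \<Rightarrow> real"
  assumes "integrable (lebesgue_on {0<..<T}) h"
  shows "(LINT t|lebesgue_on {0<..<T}. h t) = integral {0..T} h" "h integrable_on {0..T}"
proof -
  have "h integrable_on {0<..<T}" by (rule integrable_on_lebesgue_on[OF assms]) simp
  then show "h integrable_on {0..T}" by (simp add: integrable_on_open_interval_real)
  show "(LINT t|lebesgue_on {0<..<T}. h t) = integral {0..T} h"
    using lebesgue_integral_eq_integral[OF assms] by (simp add: integral_open_interval_real)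
qed

definition time_test :: "real \<Rightarrow> (real \<Rightarrow> real) \<Rightarrow> bool" where
  "time_test T \<zeta> \<longleftrightarrow> smooth_on {0..<T} \<zeta> \<and>
    (\<exists>K. compact K \<and> K \<subseteq> {0..<T} \<and> (\<forall>t\<in>{0..<T} - K. \<zeta> t = 0))"

text \<open>
  The primitive, vanishing at \<open>b\<close>, of a bump supported in \<open>[a, b]\<close>: it is constant before \<open>a\<close> and zero after
  \<open>b\<close>, hence compactly supported in \<open>[0, T)\<close>.  Tested with it, the equation compares an average over
  \<open>[a, b]\<close> with the initial value.
\<close>

lemma time_test_primitive:
  assumes ab: "0 \<le> a" "a < b" "b < T" and n: "n > 0"
  defines "\<omega> \<equiv> \<lambda>t. bump (real n * ((t - a) * (b - t)))"
  obtains \<zeta> where "time_test T \<zeta>" "\<And>t. 0 < t \<Longrightarrow> t < T \<Longrightarrow> vector_derivative \<zeta> (at t) = \<omega> t"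
    "\<And>t. 0 \<le> t \<Longrightarrow> t \<le> a \<Longrightarrow> \<zeta> t = - integral {0..T} \<omega>" "\<And>t. b \<le> t \<Longrightarrow> t \<le> T \<Longrightarrow> \<zeta> t = 0"
    "\<And>t. 0 \<le> t \<Longrightarrow> t \<le> T \<Longrightarrow> \<bar>\<zeta> t\<bar> \<le> integral {0..T} \<omega>" "continuous_on {0..T} \<zeta>"
proof -
  have T: "T > 0" using ab by simp
  have sm: "smooth_on S \<omega>" for S
    unfolding \<omega>_def
    by (intro smooth_on_bump smooth_on_mult smooth_on_const smooth_on_diff)
       (rule smooth_on_linear[OF bounded_linear_ident])+
  have c: "continuous_on S \<omega>" for S by (rule smooth_on_continuous[OF sm])
  have int: "\<omega> integrable_on {x..y}" for x y by (rule integrable_continuous_real[OF c])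
  have nonneg: "0 \<le> \<omega> t" for t by (simp add: \<omega>_def bump_bounds)
  have zero: "\<omega> t = 0" if "t \<le> a \<or> b \<le> t" for t
  proof -
    have "(t - a) * (b - t) \<le> 0" using that ab by (auto simp: mult_nonneg_nonpos mult_nonpos_nonneg)
    then show ?thesis unfolding \<omega>_def by (intro bump_bounds) (simp add: mult_nonneg_nonpos)
  qed
  \<comment> \<open>Starting at \<open>-1\<close> makes the derivative at time \<open>0\<close> two-sided.\<close>
  define \<Omega> where "\<Omega> t = integral {-1..t} \<omega>" for t
  have diff: "\<Omega> t - \<Omega> s = integral {s..t} \<omega>" if "-1 \<le> s" "s \<le> t" for s t
    using Henstock_Kurzweil_Integration.integral_combine[OF that int] by (simp add: \<Omega>_def)
  have deriv: "(\<Omega> has_real_derivative \<omega> t) (at t)" if "0 \<le> t" "t \<le> T" for t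
  proof -
    have "(\<Omega> has_real_derivative \<omega> t) (at t within {-1..T+1})"
      unfolding \<Omega>_def by (rule integral_has_real_derivative[OF c]) (use that in auto)
    moreover have "at t within {-1..T+1} = at t" by (rule at_within_Icc_at) (use that in auto)
    ultimately show ?thesis by simp
  qed
  define \<zeta> where "\<zeta> t = \<Omega> t - \<Omega> b" for t
  have d\<zeta>: "(\<zeta> has_real_derivative \<omega> t) (at t)" if "0 \<le> t" "t \<le> T" for t
    unfolding \<zeta>_def using DERIV_diff[OF deriv[OF that] DERIV_const] by simp
  have z: "integral {s..t} \<omega> = 0" if "b \<le> s \<or> t \<le> a" for s t
  proof -
    have "integral {s..t} \<omega> = integral {s..t} (\<lambda>_. 0)"
      by (rule Henstock_Kurzweil_Integration.integral_cong) (use that zero in auto)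
    then show ?thesis by simp
  qed
  have tot: "integral {0..T} \<omega> = \<Omega> b - \<Omega> 0"
    using diff[of 0 b] diff[of b T] diff[of 0 T] z[of b T] ab by simp
  have after: "\<zeta> t = 0" if "b \<le> t" for t
    using diff[of b t] z[of b t] that ab by (simp add: \<zeta>_def)
  show ?thesis
  proof (rule that[of \<zeta>])
    show "time_test T \<zeta>"
      unfolding time_test_def smooth_on_def
    proof (intro conjI allI exI[of _ "{0..b}"])
      have "Ck_on (Suc k) {0..<T} \<zeta>" for k
      proof (rule Ck_on_SucI[of _ _ "\<lambda>t h. \<omega> t * h"])
        show "(\<zeta> has_derivative (\<lambda>h. \<omega> t * h)) (at t within {0..<T})" if "t \<in> {0..<T}" for t
          using d\<zeta>[of t] that
          by (simp add: has_field_derivative_def has_derivative_at_withinI)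
        show "Ck_on k {0..<T} (\<lambda>t. \<omega> t * h)" if "h \<in> Basis" for h :: real
          using that sm[of "{0..<T}"] by (simp add: smooth_on_def)
      qed
      then show "Ck_on k {0..<T} \<zeta>" for k by (rule Ck_on_SucD)
    qed (use ab after in auto)
    show "vector_derivative \<zeta> (at t) = \<omega> t" if "0 < t" "t < T" for t
      using d\<zeta>[of t] that by (intro vector_derivative_at) (simp add: has_real_derivative_iff_has_vector_derivative)
    show "\<zeta> t = - integral {0..T} \<omega>" if "0 \<le> t" "t \<le> a" for t
      using diff[of 0 t] z[of 0 t] that by (simp add: tot \<zeta>_def)
    show "\<zeta> t = 0" if "b \<le> t" "t \<le> T" for t
      by (rule after[OF that(1)])
    show "\<bar>\<zeta> t\<bar> \<le> integral {0..T} \<omega>" if t: "0 \<le> t" "t \<le> T" for t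
    proof (cases "t \<le> b")
      case True
      have "0 \<le> integral {t..b} \<omega>" "0 \<le> integral {0..t} \<omega>"
        by (rule Henstock_Kurzweil_Integration.integral_nonneg[OF int nonneg])+
      then show ?thesis using diff[of t b] diff[of 0 t] t True by (simp add: tot \<zeta>_def)
    next
      case False
      have "0 \<le> integral {0..T} \<omega>" by (rule Henstock_Kurzweil_Integration.integral_nonneg[OF int nonneg])
      then show ?thesis using after[of t] False by simp
    qed
    show "continuous_on {0..T} \<zeta>"
      by (rule DERIV_continuous_on, rule has_field_derivative_at_within, rule d\<zeta>) auto
  qed
qed

text \<open>
  As the bump tends to the indicator of \<open>(a, b)\<close>, its integral tends to \<open>b - a\<close>.  On \<open>[a, b]\<close> only the size of
  the test function is used; this costs \<open>M * (b - a)\<^sup>2\<close>.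
\<close>

lemma time_average_estimate:
  fixes f g :: "real \<Rightarrow> real"
  assumes f: "integrable (lebesgue_on {0<..<T}) f" and g: "integrable (lebesgue_on {0<..<T}) g"
    and M: "\<And>t. 0 < t \<Longrightarrow> t < T \<Longrightarrow> \<bar>g t\<bar> \<le> M"
    and weak: "\<And>\<zeta>. time_test T \<zeta> \<Longrightarrow>
      (LINT t|lebesgue_on {0<..<T}. f t * vector_derivative \<zeta> (at t) + g t * \<zeta> t) = - (c * \<zeta> 0)"
    and ab: "0 \<le> a" "a < b" "b < T"
  shows "\<bar>integral {a..b} f - (b - a) * (c + integral {0..a} g)\<bar> \<le> M * (b - a)\<^sup>2"
proof -
  define \<omega> where "\<omega> n t = bump (real n * ((t - a) * (b - t)))" for n t
  define \<kappa> where "\<kappa> n = integral {0..T} (\<omega> n)" for n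
  have T: "0 < T" using ab by simp
  have gi: "g integrable_on {x..y}" if "0 \<le> x" "y \<le> T" for x y
    by (rule integrable_on_subinterval[OF LINT_time_eq_integral(2)[OF g]]) (use that in auto)
  have M0: "M \<ge> 0" using M[of "T / 2"] T by simp
  have c\<omega>: "continuous_on S (\<omega> n)" for S n
    unfolding \<omega>_def
    by (intro smooth_on_continuous smooth_on_bump smooth_on_mult smooth_on_const smooth_on_diff)
       (rule smooth_on_linear[OF bounded_linear_ident])+
  have \<omega>m: "\<omega> n \<in> borel_measurable (lebesgue_on {0<..<T})" for n
    by (rule continuous_imp_measurable_on_sets_lebesgue[OF c\<omega>]) simp
  have \<omega>b: "\<bar>\<omega> n t\<bar> \<le> 1" for n t using bump_bounds by (simp add: \<omega>_def)
  have lim: "(\<lambda>n. \<omega> n t) \<longlonglongrightarrow> indicator {a<..<b} t" for t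
  proof -
    have "(t - a) * (b - t) > 0 \<longleftrightarrow> t \<in> {a<..<b}" using ab by (auto simp: zero_less_mult_iff)
    then have i: "(indicator {a<..<b} t :: real) = (if (t - a) * (b - t) > 0 then 1 else 0)"
      by (simp add: indicator_def)
    show ?thesis unfolding \<omega>_def i by (rule bump_scaled_tendsto)
  qed
  have prod_int: "integrable (lebesgue_on {0<..<T}) (\<lambda>t. h t * \<omega> n t)"
    if "integrable (lebesgue_on {0<..<T}) h" for h n
    by (rule Bochner_Integration.integrable_bound[OF that borel_measurable_times[OF borel_measurable_integrable[OF that] \<omega>m]])
       (use \<omega>b in \<open>auto intro!: AE_I2 simp: abs_mult mult_left_le\<close>)
  have prod_lim: "(\<lambda>n. LINT t|lebesgue_on {0<..<T}. h t * \<omega> n t) \<longlonglongrightarrow> integral {a..b} h"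
    if h: "integrable (lebesgue_on {0<..<T}) h" for h
  proof -
    have hi: "integrable (lebesgue_on {0<..<T}) (\<lambda>t. h t * indicator {a<..<b} t)"
    proof -
      have "{a<..<b} \<in> sets (lebesgue_on {0<..<T})"
        using ab by (subst sets_restrict_space_iff) auto
      from integrable_mult_indicator[OF this h] show ?thesis by (simp add: mult.commute)
    qed
    have "(\<lambda>n. LINT t|lebesgue_on {0<..<T}. h t * \<omega> n t) \<longlonglongrightarrow>
        (LINT t|lebesgue_on {0<..<T}. h t * indicator {a<..<b} t)"
    proof (rule integral_dominated_convergence[where w = "\<lambda>t. norm (h t)"])
      show "(\<lambda>t. h t * indicator {a<..<b} t) \<in> borel_measurable (lebesgue_on {0<..<T})"
        by (rule borel_measurable_integrable[OF hi])
      show "(\<lambda>t. h t * \<omega> n t) \<in> borel_measurable (lebesgue_on {0<..<T})" for n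
        by (rule borel_measurable_integrable[OF prod_int[OF h]])
      show "integrable (lebesgue_on {0<..<T}) (\<lambda>t. norm (h t))" by (rule integrable_norm[OF h])
      show "AE t in lebesgue_on {0<..<T}. (\<lambda>n. h t * \<omega> n t) \<longlonglongrightarrow> h t * indicator {a<..<b} t"
        by (rule AE_I2) (rule tendsto_mult[OF tendsto_const lim])
      show "AE t in lebesgue_on {0<..<T}. norm (h t * \<omega> n t) \<le> norm (h t)" for n
        by (rule AE_I2) (use \<omega>b in \<open>auto simp: abs_mult mult_left_le\<close>)
    qed
    moreover have "(LINT t|lebesgue_on {0<..<T}. h t * indicator {a<..<b} t) = integral {a..b} h"
    proof -
      have "(LINT t|lebesgue_on {0<..<T}. h t * indicator {a<..<b} t) =
          integral {0..T} (\<lambda>t. if t \<in> {a<..<b} then h t else 0)"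
        unfolding LINT_time_eq_integral(1)[OF hi]
        by (rule Henstock_Kurzweil_Integration.integral_cong) (simp add: indicator_def)
      also have "\<dots> = integral ({a<..<b} \<inter> {0..T}) h"
        by (rule Henstock_Kurzweil_Integration.integral_restrict_Int)
      also have "{a<..<b} \<inter> {0..T} = {a<..<b}" using ab by auto
      finally show ?thesis by (simp add: integral_open_interval_real)
    qed
    ultimately show ?thesis by simp
  qed
  have one: "integrable (lebesgue_on {0<..<T}) (\<lambda>t. 1::real)"
    by (rule finite_measure.integrable_const[OF finite_measure_lebesgue_on]) simp
  have \<kappa>lim: "\<kappa> \<longlonglongrightarrow> b - a"
  proof -
    have "(LINT t|lebesgue_on {0<..<T}. 1 * \<omega> n t) = \<kappa> n" for n
      using LINT_time_eq_integral(1)[OF prod_int[OF one, of n]] by (simp add: \<kappa>_def)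
    then show ?thesis using prod_lim[OF one] ab by simp
  qed
  have est: "\<bar>(LINT t|lebesgue_on {0<..<T}. f t * \<omega> n t) - \<kappa> n * (c + integral {0..a} g)\<bar> \<le> M * \<kappa> n * (b - a)"
    if n: "n > 0" for n
  proof -
    have W: "(\<lambda>t. bump (real n * ((t - a) * (b - t)))) = \<omega> n" by (simp add: fun_eq_iff \<omega>_def)
    obtain \<zeta> where \<zeta>: "time_test T \<zeta>" "\<And>t. 0 < t \<Longrightarrow> t < T \<Longrightarrow> vector_derivative \<zeta> (at t) = \<omega> n t"
      "\<And>t. 0 \<le> t \<Longrightarrow> t \<le> a \<Longrightarrow> \<zeta> t = - \<kappa> n" "\<And>t. b \<le> t \<Longrightarrow> t \<le> T \<Longrightarrow> \<zeta> t = 0"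
      "\<And>t. 0 \<le> t \<Longrightarrow> t \<le> T \<Longrightarrow> \<bar>\<zeta> t\<bar> \<le> \<kappa> n" "continuous_on {0..T} \<zeta>"
      by (rule time_test_primitive[OF ab n, unfolded W, folded \<omega>_def \<kappa>_def]) (rule that; blast)
    have \<kappa>0: "\<kappa> n \<ge> 0" using \<zeta>(5)[of 0] T by simp
    have g\<zeta>: "integrable (lebesgue_on {0<..<T}) (\<lambda>t. g t * \<zeta> t)"
    proof (rule Bochner_Integration.integrable_bound[of _ "\<lambda>t. \<kappa> n * g t"])
      show "integrable (lebesgue_on {0<..<T}) (\<lambda>t. \<kappa> n * g t)" by (rule integrable_mult_right[OF g])
      have "\<zeta> \<in> borel_measurable (lebesgue_on {0<..<T})"
        by (rule continuous_imp_measurable_on_sets_lebesgue[OF continuous_on_subset[OF \<zeta>(6)]]) auto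
      then show "(\<lambda>t. g t * \<zeta> t) \<in> borel_measurable (lebesgue_on {0<..<T})"
        by (rule borel_measurable_times[OF borel_measurable_integrable[OF g]])
      show "AE t in lebesgue_on {0<..<T}. norm (g t * \<zeta> t) \<le> norm (\<kappa> n * g t)"
      proof (rule AE_I2)
        fix t assume "t \<in> space (lebesgue_on {0<..<T})"
        then have "\<bar>\<zeta> t\<bar> \<le> \<kappa> n" by (intro \<zeta>(5)) auto
        then show "norm (g t * \<zeta> t) \<le> norm (\<kappa> n * g t)"
          using mult_right_mono[OF _ abs_ge_zero[of "g t"], of "\<bar>\<zeta> t\<bar>" "\<kappa> n"] \<kappa>0
          by (simp add: abs_mult mult.commute)
      qed
    qed
    have "- (c * \<zeta> 0) = (LINT t|lebesgue_on {0<..<T}. f t * \<omega> n t + g t * \<zeta> t)"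
      unfolding weak[OF \<zeta>(1), symmetric]
      by (rule Bochner_Integration.integral_cong) (auto simp: \<zeta>(2))
    also have "\<dots> = (LINT t|lebesgue_on {0<..<T}. f t * \<omega> n t) + integral {0..T} (\<lambda>t. g t * \<zeta> t)"
      unfolding LINT_time_eq_integral(1)[OF g\<zeta>, symmetric]
      by (rule Bochner_Integration.integral_add[OF prod_int[OF f] g\<zeta>])
    also have "integral {0..T} (\<lambda>t. g t * \<zeta> t) = - \<kappa> n * integral {0..a} g + integral {a..b} (\<lambda>t. g t * \<zeta> t)"
    proof -
      note i = LINT_time_eq_integral(2)[OF g\<zeta>]
      have "integral {0..T} (\<lambda>t. g t * \<zeta> t) = integral {0..a} (\<lambda>t. g t * \<zeta> t) + integral {a..T} (\<lambda>t. g t * \<zeta> t)"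
        by (rule Henstock_Kurzweil_Integration.integral_combine[symmetric, OF _ _ i]) (use ab in auto)
      moreover have "integral {a..T} (\<lambda>t. g t * \<zeta> t) = integral {a..b} (\<lambda>t. g t * \<zeta> t) + integral {b..T} (\<lambda>t. g t * \<zeta> t)"
        by (rule Henstock_Kurzweil_Integration.integral_combine[symmetric, OF _ _ integrable_on_subinterval[OF i]])
           (use ab in auto)
      moreover have "integral {0..a} (\<lambda>t. g t * \<zeta> t) = integral {0..a} (\<lambda>t. - \<kappa> n * g t)"
        by (rule Henstock_Kurzweil_Integration.integral_cong) (use \<zeta>(3) in auto)
      moreover have "integral {b..T} (\<lambda>t. g t * \<zeta> t) = integral {b..T} (\<lambda>t. 0)"
        by (rule Henstock_Kurzweil_Integration.integral_cong) (use \<zeta>(4) in auto)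
      ultimately show ?thesis by simp
    qed
    finally have eq: "(LINT t|lebesgue_on {0<..<T}. f t * \<omega> n t) - \<kappa> n * (c + integral {0..a} g) =
        - integral {a..b} (\<lambda>t. g t * \<zeta> t)"
      using \<zeta>(3)[of 0] ab by (simp add: algebra_simps)
    have gx: "(\<lambda>t. g t * \<zeta> t) integrable_on {a<..<b}"
    proof -
      have "(\<lambda>t. g t * \<zeta> t) integrable_on {a..b}"
        by (rule integrable_on_subinterval[OF LINT_time_eq_integral(2)[OF g\<zeta>]]) (use ab in auto)
      then show ?thesis by (simp add: integrable_on_open_interval_real)
    qed
    have cx: "(\<lambda>t. M * \<kappa> n) integrable_on {a<..<b}"
      by (simp add: integrable_on_open_interval_real integrable_const_ivl)
    have "norm (integral {a<..<b} (\<lambda>t. g t * \<zeta> t)) \<le> integral {a<..<b} (\<lambda>t. M * \<kappa> n)"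
    proof (rule Henstock_Kurzweil_Integration.integral_norm_bound_integral[OF gx cx])
      fix t assume t: "t \<in> {a<..<b}"
      then have "\<bar>g t\<bar> \<le> M" "\<bar>\<zeta> t\<bar> \<le> \<kappa> n" using ab M[of t] \<zeta>(5)[of t] by auto
      then show "norm (g t * \<zeta> t) \<le> M * \<kappa> n" using M0 by (simp add: abs_mult mult_mono)
    qed
    also have "\<dots> = M * \<kappa> n * (b - a)"
    proof -
      have "integral {a<..<b} (\<lambda>t. M * \<kappa> n) = integral {a..b} (\<lambda>t. M * \<kappa> n)"
        by (rule integral_open_interval_real[symmetric])
      also have "\<dots> = M * \<kappa> n * (b - a)" using ab by (subst integral_const_real) simp
      finally show ?thesis .
    qed
    finally show ?thesis unfolding eq by (simp add: integral_open_interval_real)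
  qed
  have L: "(\<lambda>n. \<bar>(LINT t|lebesgue_on {0<..<T}. f t * \<omega> n t) - \<kappa> n * (c + integral {0..a} g)\<bar>) \<longlonglongrightarrow>
      \<bar>integral {a..b} f - (b - a) * (c + integral {0..a} g)\<bar>"
    by (rule tendsto_rabs[OF tendsto_diff[OF prod_lim[OF f] tendsto_mult[OF \<kappa>lim tendsto_const]]])
  have R: "(\<lambda>n. M * \<kappa> n * (b - a)) \<longlonglongrightarrow> M * (b - a) * (b - a)"
    by (rule tendsto_mult[OF tendsto_mult[OF tendsto_const \<kappa>lim] tendsto_const])
  have "\<bar>integral {a..b} f - (b - a) * (c + integral {0..a} g)\<bar> \<le> M * (b - a) * (b - a)"
    by (rule LIMSEQ_le[OF L R]) (use est in \<open>auto intro!: exI[of _ 1]\<close>)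
  then show ?thesis by (simp add: power2_eq_square mult.assoc)
qed

text \<open>Lebesgue points of \<open>f\<close> turn the averaged identity into a pointwise one.\<close>

lemma weak_time_equation:
  fixes f g :: "real \<Rightarrow> real"
  assumes f: "integrable (lebesgue_on {0<..<T}) f" and g: "integrable (lebesgue_on {0<..<T}) g"
    and M: "\<And>t. 0 < t \<Longrightarrow> t < T \<Longrightarrow> \<bar>g t\<bar> \<le> M"
    and weak: "\<And>\<zeta>. time_test T \<zeta> \<Longrightarrow>
      (LINT t|lebesgue_on {0<..<T}. f t * vector_derivative \<zeta> (at t) + g t * \<zeta> t) = - (c * \<zeta> 0)"
  shows "AE t in lebesgue_on {0<..<T}. f t = c + integral {0..t} g"
proof -
  define F where "F t = (if t \<in> {0..T} then f t else 0)" for t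
  have fT: "f integrable_on {0..T}" by (rule LINT_time_eq_integral(2)[OF f])
  have Fi: "F integrable_on cbox a b" for a b
  proof -
    have "F integrable_on UNIV" unfolding F_def using fT integrable_restrict_UNIV by blast
    then show ?thesis by (rule integrable_on_subcbox) simp
  qed
  obtain N where N: "negligible N" "\<And>x e. x \<notin> N \<Longrightarrow> 0 < e \<Longrightarrow> \<exists>d>0. \<forall>h. 0 < h \<and> h < d \<longrightarrow>
      norm (integral (cbox x (x + h *\<^sub>R One)) F /\<^sub>R h ^ DIM(real) - F x) < e"
    using integrable_ccontinuous_explicit[of F, OF Fi] by metis
  have eq: "f t = c + integral {0..t} g" if t: "0 < t" "t < T" "t \<notin> N" for t
  proof (rule ccontr)
    define e where "e = \<bar>f t - (c + integral {0..t} g)\<bar> / 2"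
    assume "f t \<noteq> c + integral {0..t} g"
    then have e: "e > 0" by (simp add: e_def)
    obtain d where d: "d > 0" "\<forall>h. 0 < h \<and> h < d \<longrightarrow> norm (integral (cbox t (t + h *\<^sub>R One)) F /\<^sub>R h ^ DIM(real) - F t) < e"
      using N(2)[OF t(3) e] by blast
    have M0: "M \<ge> 0" using M[OF t(1,2)] by simp
    \<comment> \<open>so short that \<open>[t, t + h]\<close> stays in the time interval and the error \<open>M * h\<close> of the averages is at most \<open>e\<close>\<close>
    define h where "h = min (min (d / 2) ((T - t) / 2)) (e / (M + 1))"
    have "0 < h" using d(1) t e M0 by (simp add: h_def)
    moreover have "h \<le> d / 2" "h \<le> (T - t) / 2" "h \<le> e / (M + 1)"
      by (simp_all only: h_def min_le_iff_disj order_refl simp_thms)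
    ultimately have h: "0 < h" "h < d" "t + h < T" "h \<le> e / (M + 1)" using d(1) t by auto
    have Mh: "M * h \<le> e"
    proof -
      have "M * h \<le> (M + 1) * (e / (M + 1))" using h M0 by (intro mult_mono) auto
      then show ?thesis using M0 by simp
    qed
    have Ff: "integral {t..t + h} F = integral {t..t + h} f"
      by (rule Henstock_Kurzweil_Integration.integral_cong) (use t h in \<open>auto simp: F_def\<close>)
    have 1: "\<bar>integral {t..t + h} f / h - f t\<bar> < e"
      using d(2) h t Ff by (auto simp: F_def divide_inverse mult.commute)
    have "\<bar>integral {t..t + h} f - h * (c + integral {0..t} g)\<bar> \<le> M * h\<^sup>2"
      using time_average_estimate[OF f g M weak, of t "t + h"] t h by simp
    then have "\<bar>integral {t..t + h} f - h * (c + integral {0..t} g)\<bar> / h \<le> M * h\<^sup>2 / h"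
      using h by (intro divide_right_mono) auto
    moreover have "\<bar>integral {t..t + h} f - h * (c + integral {0..t} g)\<bar> / h =
        \<bar>integral {t..t + h} f / h - (c + integral {0..t} g)\<bar>"
    proof -
      have "integral {t..t + h} f / h - (c + integral {0..t} g) = (integral {t..t + h} f - h * (c + integral {0..t} g)) / h"
        using h by (simp add: diff_divide_distrib)
      then show ?thesis using h by (simp add: abs_divide)
    qed
    ultimately have 2: "\<bar>integral {t..t + h} f / h - (c + integral {0..t} g)\<bar> \<le> e"
      using Mh h by (simp add: power2_eq_square)
    have "\<bar>f t - (c + integral {0..t} g)\<bar> = 2 * e" by (simp add: e_def)
    with 1 2 show False by linarith
  qed
  have "N \<in> null_sets lebesgue" using N(1) by (simp add: negligible_iff_null_sets)
  then have "AE t in lebesgue. t \<notin> N" by (rule AE_not_in)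
  then show ?thesis unfolding AE_time_iff by eventually_elim (use eq in auto)
qed

lemma smooth_on_time_space:
  assumes "smooth_on {0..<T} \<zeta>" "smooth_on UNIV \<psi>"
  shows "smooth_on ({0..<T} \<times> UNIV) (\<lambda>(t, x). \<zeta> t *\<^sub>R \<psi> x)"
  using assms by (simp add: smooth_on_def Ck_on_product)

lemma test_field_product:
  assumes \<zeta>: "time_test T \<zeta>" and \<psi>: "\<psi> \<in> smooth_solenoidal"
  shows "test_field T (\<lambda>t x. \<zeta> t *\<^sub>R \<psi> x)"
proof -
  have s: "smooth_periodic \<psi>" "\<And>x. divergence \<psi> x = 0" using \<psi> by (auto simp: smooth_solenoidal_def)
  have "(\<lambda>x. \<zeta> t *\<^sub>R \<psi> x) \<in> smooth_solenoidal" for t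
    using smooth_solenoidal_linear[OF \<psi> \<psi>, of "\<zeta> t" 0] by simp
  then have d: "divergence (\<lambda>x. \<zeta> t *\<^sub>R \<psi> x) x = 0" for t x by (simp add: smooth_solenoidal_def)
  obtain K where K: "compact K" "K \<subseteq> {0..<T}" "\<forall>t\<in>{0..<T} - K. \<zeta> t = 0"
    using \<zeta> by (auto simp: time_test_def)
  show ?thesis
    unfolding test_field_def
  proof (intro conjI ballI allI d)
    show "smooth_on ({0..<T} \<times> UNIV) (\<lambda>(t, x). \<zeta> t *\<^sub>R \<psi> x)"
      by (rule smooth_on_time_space) (use \<zeta> s in \<open>auto simp: time_test_def smooth_periodic_def\<close>)
    show "torus_periodic (\<lambda>x. \<zeta> t *\<^sub>R \<psi> x)" for t
      using s by (simp add: smooth_periodic_def torus_periodic_def)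
    show "\<exists>K. compact K \<and> K \<subseteq> {0..<T} \<and> (\<forall>t\<in>{0..<T} - K. \<forall>x. \<zeta> t *\<^sub>R \<psi> x = 0)"
      using K by (intro exI[of _ K]) auto
  qed
qed

text \<open>
  Products of a time test function and a smooth solenoidal field are admissible, and for them the weak
  formulation is the scalar equation with the unknown \<open>ip (u t) \<psi>\<close>.
\<close>

lemma weak_form_product:
  assumes v: "euler_weak_solution T v0 v" and \<zeta>: "time_test T \<zeta>" and \<psi>: "\<psi> \<in> smooth_solenoidal"
    and u: "AE t in lebesgue_on {0<..<T}. u t = v t" "\<And>t. 0 < t \<Longrightarrow> t < T \<Longrightarrow> u t \<in> L2"
    and m: "(\<lambda>t. ip (u t) \<psi>) \<in> borel_measurable (lebesgue_on {0<..<T})"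
      "(\<lambda>t. flux_form (u t) \<psi>) \<in> borel_measurable (lebesgue_on {0<..<T})"
  shows "(LINT t|lebesgue_on {0<..<T}. ip (u t) \<psi> * vector_derivative \<zeta> (at t) + flux_form (u t) \<psi> * \<zeta> t)
    = - (ip v0 \<psi> * \<zeta> 0)"
proof -
  have s: "smooth_periodic \<psi>" using \<psi> by (auto simp: smooth_solenoidal_def)
  define I where "I t = (LINT x|torus. v t x \<bullet> vector_derivative (\<lambda>s. \<zeta> s *\<^sub>R \<psi> x) (at t) +
            (\<Sum>i\<in>UNIV. \<Sum>j\<in>UNIV. v t x $ i * v t x $ j * partial_d j (\<lambda>x. \<zeta> t *\<^sub>R \<psi> x) x $ i))" for t
  have d\<zeta>: "\<exists>D. (\<zeta> has_vector_derivative D) (at t)" if "0 < t" "t < T" for t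
  proof -
    have "Ck_on (Suc 0) {0..<T} \<zeta>" using \<zeta> unfolding time_test_def smooth_on_def by blast
    then obtain D where D: "\<forall>t\<in>{0..<T}. (\<zeta> has_derivative D t) (at t within {0..<T})" by auto
    have "at t within {0..<T} = at t" using that by (intro at_within_interior) (simp add: interior_atLeastLessThan)
    then have "(\<zeta> has_derivative D t) (at t)" using D[rule_format, of t] that by simp
    then have "\<zeta> differentiable (at t)" unfolding differentiable_def by blast
    then show ?thesis using differentiable_iff_scaleR vector_derivative_works by blast
  qed
  have I: "I t = ip (u t) \<psi> * vector_derivative \<zeta> (at t) + flux_form (u t) \<psi> * \<zeta> t"
    if t: "0 < t" "t < T" and uv: "u t = v t" for t
  proof -
    have uL: "u t \<in> L2" by (rule u(2)[OF t])
    obtain D where D: "(\<zeta> has_vector_derivative D) (at t)" using d\<zeta>[OF t] by blast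
    have vd: "vector_derivative (\<lambda>s. \<zeta> s *\<^sub>R \<psi> x) (at t) = D *\<^sub>R \<psi> x" for x
      by (rule vector_derivative_at)
         (rule bounded_linear.has_vector_derivative[OF bounded_linear_scaleR_left D])
    have pd: "partial_d j (\<lambda>x. \<zeta> t *\<^sub>R \<psi> x) x $ i = \<zeta> t * (grad \<psi> x $ i $ j)" for i j x
      unfolding partial_d_simps(6)[OF bounded_linear_scaleR_right s] by (simp add: grad_def)
    have "I t = (LINT x|torus. D * (u t x \<bullet> \<psi> x) + \<zeta> t * (u t x \<bullet> (grad \<psi> x *v u t x)))"
      unfolding I_def vd pd uv
      by (intro Bochner_Integration.integral_cong refl)
         (simp add: inner_vec_def matrix_vector_mult_def sum_distrib_left mult_ac)
    also have "\<dots> = D * ip (u t) \<psi> + \<zeta> t * flux_form (u t) \<psi>"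
      unfolding ip_def flux_form_def
      using L2_inner_integrable[OF uL smooth_periodic_L2[OF s]] flux_form_integrable[OF uL s] by simp
    finally show ?thesis using vector_derivative_at[OF D] by (simp add: mult.commute)
  qed
  have "(LINT t|lebesgue_on {0<..<T}. I t) = - (LINT x|torus. v0 x \<bullet> (\<zeta> 0 *\<^sub>R \<psi> x))"
    using v test_field_product[OF \<zeta> \<psi>] unfolding euler_weak_solution_def I_def by blast
  also have "\<dots> = - (ip v0 \<psi> * \<zeta> 0)" by (simp add: ip_def)
  finally have 1: "(LINT t|lebesgue_on {0<..<T}. I t) = - (ip v0 \<psi> * \<zeta> 0)" .
  have ae: "AE t in lebesgue_on {0<..<T}. I t = ip (u t) \<psi> * vector_derivative \<zeta> (at t) + flux_form (u t) \<psi> * \<zeta> t"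
    using u(1) unfolding AE_time_iff by eventually_elim (use I in blast)
  have mr: "(\<lambda>t. ip (u t) \<psi> * vector_derivative \<zeta> (at t) + flux_form (u t) \<psi> * \<zeta> t) \<in> borel_measurable (lebesgue_on {0<..<T})"
    if "(\<lambda>t. vector_derivative \<zeta> (at t)) \<in> borel_measurable (lebesgue_on {0<..<T})"
      "\<zeta> \<in> borel_measurable (lebesgue_on {0<..<T})"
    by (intro borel_measurable_add borel_measurable_times m that)
  have m\<zeta>: "\<zeta> \<in> borel_measurable (lebesgue_on {0<..<T})"
    by (rule continuous_imp_measurable_on_sets_lebesgue[OF continuous_on_subset[of "{0..<T}"]])
       (use \<zeta> in \<open>auto simp: time_test_def intro: smooth_on_continuous\<close>)
  have md: "(\<lambda>t. vector_derivative \<zeta> (at t)) \<in> borel_measurable (lebesgue_on {0<..<T})"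
  proof -
    have "Ck_on (Suc 0) {0..<T} \<zeta>" using \<zeta> unfolding time_test_def smooth_on_def by blast
    then obtain D where "\<forall>t\<in>{0..<T}. (\<zeta> has_derivative D t) (at t within {0..<T})"
      "\<forall>b\<in>Basis. Ck_on 0 {0..<T} (\<lambda>t. D t b)" by auto
    then have D: "\<And>t. t \<in> {0..<T} \<Longrightarrow> (\<zeta> has_derivative D t) (at t within {0..<T})"
      "continuous_on {0..<T} (\<lambda>t. D t 1)" by (blast, simp)
    have "vector_derivative \<zeta> (at t) = D t 1" if t: "t \<in> {0<..<T}" for t
    proof -
      have "at t within {0..<T} = at t" using t by (intro at_within_interior) (simp add: interior_atLeastLessThan)
      then have h: "(\<zeta> has_derivative D t) (at t)" using D(1)[of t] t by auto
      have "D t h = h *\<^sub>R D t 1" for h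
        using linear_scale[OF has_derivative_linear[OF h], of h 1] by simp
      then have "D t = (\<lambda>h. h *\<^sub>R D t 1)" by blast
      then show ?thesis using h by (intro vector_derivative_at) (simp add: has_vector_derivative_def)
    qed
    then have "continuous_on {0<..<T} (\<lambda>t. vector_derivative \<zeta> (at t))"
    proof -
      have "{0<..<T} \<subseteq> {0..<T}" by auto
      from continuous_on_subset[OF D(2) this] show ?thesis
        using \<open>\<And>t. t \<in> {0<..<T} \<Longrightarrow> vector_derivative \<zeta> (at t) = D t 1\<close>
        by (simp only: continuous_on_cong[OF refl, of "{0<..<T}" "\<lambda>t. vector_derivative \<zeta> (at t)" "\<lambda>t. D t 1"])
    qed
    then show ?thesis by (rule continuous_imp_measurable_on_sets_lebesgue) simp
  qed
  have mI: "I \<in> borel_measurable (lebesgue_on {0<..<T})"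
    by (rule borel_measurable_time_AE[OF mr[OF md m\<zeta>]]) (use ae in \<open>auto elim: eventually_mono\<close>)
  from integral_cong_AE[OF mI mr[OF md m\<zeta>] ae] 1 show ?thesis by simp
qed

section \<open>The weakly continuous representative\<close>

lemma bounded_time_integrable:
  fixes h :: "real \<Rightarrow> real"
  assumes "h \<in> borel_measurable (lebesgue_on {0<..<T})" "\<And>t. \<bar>h t\<bar> \<le> C"
  shows "integrable (lebesgue_on {0<..<T}) h"
proof -
  interpret finite_measure "lebesgue_on {0<..<T}" by (rule finite_measure_lebesgue_on) simp
  show ?thesis by (rule integrable_const_bound[of _ C]) (use assms in auto)
qed

text \<open>The closure of the smooth solenoidal fields in \<open>L2\<close>, described by sequences.\<close>

definition L2_closure :: "(real^3 \<Rightarrow> real^3) \<Rightarrow> bool" where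
  "L2_closure f \<longleftrightarrow> (\<exists>F. L2_lim F f \<and> (\<forall>n. F n \<in> smooth_solenoidal))"

lemma L2_closure_L2: "L2_closure f \<Longrightarrow> f \<in> L2"
  by (auto simp: L2_closure_def L2_lim_def)

lemma space_H_L2_closure: "f \<in> space_H \<Longrightarrow> L2_closure f"
  unfolding L2_closure_def
  by (rule L2_limI_approx[OF space_H_approx smooth_solenoidal_L2])

lemma ip_self_zero_imp_AE_zero:
  assumes "f \<in> L2" "ip f f = 0" shows "AE x in torus. f x = 0"
proof -
  have "AE x in torus. (norm (f x))\<^sup>2 = 0"
    using assms(2) integral_nonneg_eq_0_iff_AE[OF L2D(3)[OF assms(1)]] by (simp add: ip_self_eq)
  then show ?thesis by simp
qed

lemma ip_cong_AE:
  assumes "f \<in> L2" "f' \<in> L2" "g \<in> L2" "AE x in torus. f x = f' x"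
  shows "ip f g = ip f' g"
  unfolding ip_def
  by (rule integral_cong_AE[OF borel_measurable_integrable[OF L2_inner_integrable]
        borel_measurable_integrable[OF L2_inner_integrable]])
     (use assms in \<open>auto elim: eventually_mono\<close>)

lemma mol_cong_AE:
  fixes f g :: "real^3 \<Rightarrow> real^3"
  assumes "integrable torus f" "integrable torus g" "AE x in torus. f x = g x"
  shows "mol n f = mol n g"
proof
  fix x
  show "mol n f x = mol n g x"
    unfolding mol_def
    by (rule integral_cong_AE[OF borel_measurable_integrable[OF mol_integrand[OF assms(1)]]
          borel_measurable_integrable[OF mol_integrand[OF assms(2)]]])
       (use assms(3) in \<open>auto elim: eventually_mono\<close>)
qed

lemma L2_lim_unique:
  fixes f g :: "real^3 \<Rightarrow> real^3"
  assumes F: "L2_lim F f" and G: "L2_lim F g"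
  shows "AE x in torus. f x = g x"
proof -
  have L: "f \<in> L2" "g \<in> L2" using F G by (auto simp: L2_lim_def)
  note d = L2_diff[OF L]
  have "(\<lambda>n. ip (F n) (\<lambda>x. f x - g x)) \<longlonglongrightarrow> ip f (\<lambda>x. f x - g x)"
    "(\<lambda>n. ip (F n) (\<lambda>x. f x - g x)) \<longlonglongrightarrow> ip g (\<lambda>x. f x - g x)"
    by (rule L2_lim_ip[OF F d] L2_lim_ip[OF G d])+
  then have "ip f (\<lambda>x. f x - g x) = ip g (\<lambda>x. f x - g x)" by (rule LIMSEQ_unique)
  then have "ip (\<lambda>x. f x - g x) (\<lambda>x. f x - g x) = 0" using ip_diff_left[OF L d] by simp
  from ip_self_zero_imp_AE_zero[OF d this] show ?thesis by simp
qed

lemma L2_closure_unique: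
  assumes f: "L2_closure f" and g: "L2_closure g"
    and eq: "\<And>h. h \<in> smooth_solenoidal \<Longrightarrow> ip f h = ip g h"
  shows "AE x in torus. f x = g x"
proof -
  note L = L2_closure_L2[OF f] L2_closure_L2[OF g]
  note d = L2_diff[OF L]
  have z: "ip h (\<lambda>x. f x - g x) = 0" if h: "L2_closure h" for h
  proof -
    obtain F where F: "L2_lim F h" "\<And>n. F n \<in> smooth_solenoidal" using h by (auto simp: L2_closure_def)
    have "ip (F n) (\<lambda>x. f x - g x) = 0" for n
      using eq[OF F(2)[of n]] ip_diff_right[OF L, of "F n"] F smooth_solenoidal_L2
      by (auto simp: ip_commute[of "F n"])
    with L2_lim_ip[OF F(1) d] show ?thesis by (simp add: LIMSEQ_const_iff)
  qed
  have "ip (\<lambda>x. f x - g x) (\<lambda>x. f x - g x) = 0" using ip_diff_left[OF L d] z[OF f] z[OF g] by simp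
  from ip_self_zero_imp_AE_zero[OF d this] show ?thesis by simp
qed

lemma L2_closure_mol_lim:
  assumes "L2_closure f" shows "L2_lim (\<lambda>n. mol n f) f"
proof (rule mol_L2_lim[OF L2_closure_L2[OF assms]])
  fix e :: real assume "e > 0"
  obtain F where F: "L2_lim F f" "\<And>n. F n \<in> smooth_solenoidal" using assms by (auto simp: L2_closure_def)
  from LIMSEQ_D[OF L2_lim_diff[OF F(1)] \<open>e > 0\<close>]
  obtain n where "\<forall>k\<ge>n. norm (Lp_norm 2 (\<lambda>x. F k x - f x) - 0) < e" by blast
  then have "Lp_norm 2 (\<lambda>x. F n x - f x) < e" by auto
  then have "Lp_norm 2 (\<lambda>x. f x - F n x) < e" by (subst Lp_norm_minus_commute)
  then show "\<exists>g. smooth_periodic g \<and> Lp_norm 2 (\<lambda>x. f x - g x) < e"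
    using F(2)[of n] by (auto simp: smooth_solenoidal_def)
qed

lemma zero_smooth_solenoidal: "(\<lambda>x. 0) \<in> smooth_solenoidal"
  by (simp add: smooth_solenoidal_def smooth_periodic_const divergence_def partial_d_simps(5))

lemma zero_space_H: "(\<lambda>x. 0) \<in> space_H"
proof -
  have "Lp_norm 2 (\<lambda>x::real^3. (0::real^3) - 0) = 0" by (simp add: Lp_norm_2 ip_def)
  then show ?thesis
    using zero_smooth_solenoidal smooth_solenoidal_L2
    by (auto simp: space_H_def smooth_solenoidal_def smooth_periodic_def intro!: exI[of _ "\<lambda>x. 0"])
qed

text \<open>
  The field \<open>p\<close> is the orthogonal projection of \<open>\<psi>\<close>.  It transfers statements on pairings with smooth
  solenoidal fields to pairings with arbitrary elements of \<open>L2\<close>.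
\<close>

lemma solenoidal_projection:
  assumes \<psi>: "\<psi> \<in> L2"
  shows "\<exists>p P. L2_lim P p \<and> (\<forall>n. P n \<in> smooth_solenoidal) \<and> (\<forall>g. L2_closure g \<longrightarrow> ip g \<psi> = ip g p)"
proof -
  have "\<exists>p P. L2_lim P p \<and> (\<forall>n. P n \<in> smooth_solenoidal) \<and> (\<forall>f\<in>smooth_solenoidal. ip p f = ip \<psi> f)"
  proof (rule Riesz_representation[OF smooth_solenoidal_L2 _ smooth_solenoidal_linear])
    show "smooth_solenoidal \<noteq> {}" using zero_smooth_solenoidal by blast
    show "ip \<psi> (\<lambda>x. a *\<^sub>R f x + b *\<^sub>R g x) = a * ip \<psi> f + b * ip \<psi> g"
      if "f \<in> smooth_solenoidal" "g \<in> smooth_solenoidal" for f g a b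
      by (rule ip_linear_right) (use that smooth_solenoidal_L2 \<psi> in auto)
    show "\<bar>ip \<psi> f\<bar> \<le> Lp_norm 2 \<psi> * Lp_norm 2 f" if "f \<in> smooth_solenoidal" for f
      by (rule ip_Cauchy_Schwarz) (use that smooth_solenoidal_L2 \<psi> in auto)
  qed
  then obtain p P where p: "L2_lim P p" "\<And>n. P n \<in> smooth_solenoidal"
    "\<And>f. f \<in> smooth_solenoidal \<Longrightarrow> ip p f = ip \<psi> f" by blast
  have "ip g \<psi> = ip g p" if g: "L2_closure g" for g
  proof -
    obtain G where G: "L2_lim G g" "\<And>n. G n \<in> smooth_solenoidal" using g by (auto simp: L2_closure_def)
    have "ip (G n) \<psi> = ip (G n) p" for n using p(3)[OF G(2)] by (simp add: ip_commute)
    moreover have "p \<in> L2" using p(1) by (simp add: L2_lim_def)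
    ultimately show ?thesis
      using L2_lim_ip[OF G(1) \<psi>] L2_lim_ip[OF G(1), of p] LIMSEQ_unique by simp
  qed
  with p(1,2) show ?thesis by blast
qed

text \<open>
  A solenoidal path is an Euler solution with its values on a null set of times replaced by zero,
  tested against one smooth solenoidal field at a time.  Strong measurability in time enters as the
  measurability of all continuous functionals of the path.
\<close>

locale solenoidal_path =
  fixes T M :: real and v0 :: "real^3 \<Rightarrow> real^3" and u :: "real \<Rightarrow> real^3 \<Rightarrow> real^3"
  assumes T: "T > 0" and v0: "v0 \<in> space_H" and uH: "\<And>t. u t \<in> space_H" and uM: "\<And>t. Lp_norm 2 (u t) \<le> M"
    and meas: "\<And>\<Phi>. (\<And>F f. L2_lim F f \<Longrightarrow> (\<lambda>k. \<Phi> (F k)) \<longlonglongrightarrow> (\<Phi> f :: real)) \<Longrightarrow>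
      (\<lambda>t. \<Phi> (u t)) \<in> borel_measurable (lebesgue_on {0<..<T})"
    and weak: "\<And>\<psi>. \<psi> \<in> smooth_solenoidal \<Longrightarrow> AE t in lebesgue_on {0<..<T}.
      ip (u t) \<psi> = ip v0 \<psi> + integral {0..t} (\<lambda>s. flux_form (u s) \<psi>)"
begin

lemma uL: "u t \<in> L2" by (rule space_H_approx(1)[OF uH])

lemma M: "M \<ge> 0" using uM[of 0] Lp_norm_2_nonneg[of "u 0"] by linarith

lemma flux_form_bound:
  assumes "smooth_periodic \<psi>" "\<And>x. norm (grad \<psi> x) \<le> K"
  shows "\<bar>flux_form (u t) \<psi>\<bar> \<le> K * M\<^sup>2"
proof -
  have "K \<ge> 0" using assms(2)[of 0] norm_ge_zero order_trans by blast
  then have "K * (Lp_norm 2 (u t))\<^sup>2 \<le> K * M\<^sup>2"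
    by (intro mult_left_mono power_mono uM Lp_norm_2_nonneg)
  with flux_form_le[OF uL assms] show ?thesis by (rule order_trans)
qed

lemma flux_integrable_on:
  assumes \<psi>: "smooth_periodic \<psi>" and st: "0 \<le> s" "t \<le> T"
  shows "(\<lambda>\<tau>. flux_form (u \<tau>) \<psi>) integrable_on {s..t}"
proof -
  obtain K where K: "\<And>x. norm (grad \<psi> x) \<le> K" using grad_bounded[OF \<psi>] by blast
  have "(\<lambda>\<tau>. flux_form (u \<tau>) \<psi>) \<in> borel_measurable (lebesgue_on {0<..<T})"
    by (rule meas) (rule flux_form_tendsto[OF _ \<psi>])
  from LINT_time_eq_integral(2)[OF bounded_time_integrable[OF this flux_form_bound[OF \<psi> K]]] show ?thesis
    by (rule integrable_on_subinterval) (use st in auto)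
qed

text \<open>
  The equation prescribes \<open>functional t \<psi>\<close> as the pairing of the solution with \<open>\<psi>\<close> at time \<open>t\<close>.  It is continuous in
  \<open>t\<close>, so that the bound by the energy, valid at almost every time, holds always.
\<close>

definition functional :: "real \<Rightarrow> (real^3 \<Rightarrow> real^3) \<Rightarrow> real" where
  "functional t \<psi> = ip v0 \<psi> + integral {0..t} (\<lambda>s. flux_form (u s) \<psi>)"

lemma functional_continuous:
  "smooth_periodic \<psi> \<Longrightarrow> continuous_on {0..T} (\<lambda>t. functional t \<psi>)"
  unfolding functional_def
  by (intro continuous_intros indefinite_integral_continuous_1 flux_integrable_on) auto

lemma functional_diff:
  assumes "smooth_periodic \<psi>" "0 \<le> s" "s \<le> t" "t \<le> T"
  shows "functional t \<psi> - functional s \<psi> = integral {s..t} (\<lambda>\<tau>. flux_form (u \<tau>) \<psi>)"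
  using Henstock_Kurzweil_Integration.integral_combine[OF assms(2,3) flux_integrable_on[OF assms(1) order_refl assms(4)]]
  by (simp add: functional_def)

lemma functional_bound:
  assumes \<psi>: "\<psi> \<in> smooth_solenoidal" and t: "t \<in> {0..T}"
  shows "\<bar>functional t \<psi>\<bar> \<le> M * Lp_norm 2 \<psi>"
proof (rule continuous_AE_le[OF T _ _ t, of "\<lambda>t. \<bar>functional t \<psi>\<bar>"])
  show "continuous_on {0..T} (\<lambda>t. \<bar>functional t \<psi>\<bar>)"
    using \<psi> by (intro continuous_intros functional_continuous) (simp add: smooth_solenoidal_def)
  have \<psi>L: "\<psi> \<in> L2" using \<psi> smooth_solenoidal_L2 by blast
  have b: "\<bar>ip (u t) \<psi>\<bar> \<le> M * Lp_norm 2 \<psi>" for t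
    by (rule order_trans[OF ip_Cauchy_Schwarz[OF uL \<psi>L] mult_right_mono[OF uM Lp_norm_2_nonneg]])
  show "AE t in lebesgue_on {0<..<T}. \<bar>functional t \<psi>\<bar> \<le> M * Lp_norm 2 \<psi>"
    using weak[OF \<psi>]
  proof eventually_elim
    case (elim t)
    then show ?case using b[of t] by (simp add: functional_def)
  qed
qed

lemma functional_linear:
  assumes f: "f \<in> smooth_solenoidal" and g: "g \<in> smooth_solenoidal" and t: "t \<in> {0..T}"
  shows "functional t (\<lambda>x. a *\<^sub>R f x + b *\<^sub>R g x) = a * functional t f + b * functional t g"
proof -
  have s: "smooth_periodic f" "smooth_periodic g" using f g by (auto simp: smooth_solenoidal_def)
  have i: "(\<lambda>s. flux_form (u s) f) integrable_on {0..t}" "(\<lambda>s. flux_form (u s) g) integrable_on {0..t}"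
    by (rule flux_integrable_on; use s t in auto)+
  have "integral {0..t} (\<lambda>s. a * flux_form (u s) f + b * flux_form (u s) g) =
      a * integral {0..t} (\<lambda>s. flux_form (u s) f) + b * integral {0..t} (\<lambda>s. flux_form (u s) g)"
    using i by (subst Henstock_Kurzweil_Integration.integral_add) (auto intro: integrable_on_mult_right)
  moreover have "ip v0 (\<lambda>x. a *\<^sub>R f x + b *\<^sub>R g x) = a * ip v0 f + b * ip v0 g"
    by (rule ip_linear_right) (use f g v0 smooth_solenoidal_L2 space_H_approx(1) in auto)
  ultimately show ?thesis
    by (simp add: functional_def flux_form_linear[OF uL s] algebra_simps)
qed

lemma representative_functional:
  assumes t: "t \<in> {0..T}"
  shows "\<exists>w. L2_closure w \<and> (\<forall>\<psi>\<in>smooth_solenoidal. ip w \<psi> = functional t \<psi>)"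
proof -
  have "\<exists>w F. L2_lim F w \<and> (\<forall>n. F n \<in> smooth_solenoidal) \<and> (\<forall>f\<in>smooth_solenoidal. ip w f = functional t f)"
  proof (rule Riesz_representation[OF smooth_solenoidal_L2 _ smooth_solenoidal_linear])
    show "smooth_solenoidal \<noteq> {}" using zero_smooth_solenoidal by blast
  qed (use functional_linear[OF _ _ t] functional_bound[OF _ t] in auto)
  then show ?thesis unfolding L2_closure_def by blast
qed

text \<open>
  Testing with the finitely many components of the kernel shows that a field whose pairings vanish at
  almost every time is mollified to zero at almost every time.
\<close>

lemma AE_kernel_zero:
  assumes k: "finite_rank k" and d: "\<And>t. 0 < t \<Longrightarrow> t < T \<Longrightarrow> d t \<in> L2"
    and z: "\<And>\<psi>. \<psi> \<in> L2 \<Longrightarrow> AE t in lebesgue_on {0<..<T}. ip (d t) \<psi> = 0"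
  shows "AE t in lebesgue_on {0<..<T}. \<forall>x. (LINT y|torus. k x y *\<^sub>R (d t y :: real^3)) = 0"
  using k
proof induction
  case (finite_rank_product a b)
  have "AE t in lebesgue_on {0<..<T}. \<forall>i. ip (d t) (\<lambda>y. b y *\<^sub>R axis i 1) = 0"
    by (subst AE_all_countable)
       (intro allI z smooth_periodic_L2 smooth_periodic_scaleR finite_rank_product smooth_periodic_const)
  then show ?case
    unfolding AE_time_iff
  proof (eventually_elim, intro impI allI)
    fix t x
    assume z: "0 < t \<and> t < T \<longrightarrow> (\<forall>i. ip (d t) (\<lambda>y. b y *\<^sub>R axis i 1) = 0)" and t: "0 < t \<and> t < T"
    have bd: "integrable torus (\<lambda>y. b y *\<^sub>R d t y)"
      by (rule smooth_periodic_times_integrable[OF finite_rank_product(2) L2_integrable[OF d]]) (use t in auto)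
    have "(LINT y|torus. b y *\<^sub>R d t y) $ i = 0" for i
    proof -
      have "(LINT y|torus. b y *\<^sub>R d t y) $ i = (LINT y|torus. (b y *\<^sub>R d t y) $ i)"
        by (rule integral_bounded_linear[OF bounded_linear_vec_nth bd, symmetric])
      also have "\<dots> = ip (d t) (\<lambda>y. b y *\<^sub>R axis i 1)"
        by (simp add: ip_def inner_axis)
      finally show ?thesis using z t by simp
    qed
    then have "(LINT y|torus. b y *\<^sub>R d t y) = 0" by (simp add: vec_eq_iff)
    then show "(LINT y|torus. (a x * b y) *\<^sub>R d t y) = 0" by (simp flip: scaleR_scaleR)
  qed
next
  case (finite_rank_add k l)
  show ?case
    using finite_rank_add.IH unfolding AE_time_iff
  proof (eventually_elim, intro impI allI)
    fix t x
    assume z: "0 < t \<and> t < T \<longrightarrow> (\<forall>x. (LINT y|torus. k x y *\<^sub>R d t y) = 0)"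
      "0 < t \<and> t < T \<longrightarrow> (\<forall>x. (LINT y|torus. l x y *\<^sub>R d t y) = 0)" and t: "0 < t \<and> t < T"
    have di: "integrable torus (d t)" by (rule L2_integrable[OF d]) (use t in auto)
    show "(LINT y|torus. (k x y + l x y) *\<^sub>R d t y) = 0"
      unfolding scaleR_add_left
      using z t finite_rank_integrable[OF finite_rank_add.hyps(1) di] finite_rank_integrable[OF finite_rank_add.hyps(2) di]
      by simp
  qed
qed

text \<open>
  Riesz' theorem gives a value at every time.  It agrees with the path at almost every time because
  countably many pairings, those with the components of the mollification kernels, determine an
  element of the closure.
\<close>

lemma weakly_continuous_representative: "\<exists>w. weakly_cont_rep T v0 u w"
proof -
  have "\<exists>w. \<forall>t\<in>{0..T}. L2_closure (w t) \<and> (\<forall>\<psi>\<in>smooth_solenoidal. ip (w t) \<psi> = functional t \<psi>)"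
    by (rule bchoice) (use representative_functional in blast)
  then obtain w where w: "\<And>t. t \<in> {0..T} \<Longrightarrow> L2_closure (w t)"
    "\<And>t \<psi>. t \<in> {0..T} \<Longrightarrow> \<psi> \<in> smooth_solenoidal \<Longrightarrow> ip (w t) \<psi> = functional t \<psi>" by blast
  have wL: "w t \<in> L2" if "t \<in> {0..T}" for t by (rule L2_closure_L2[OF w(1)[OF that]])
  have wM: "Lp_norm 2 (w t) \<le> M" if t: "t \<in> {0..T}" for t
  proof -
    obtain F where F: "L2_lim F (w t)" "\<And>n. F n \<in> smooth_solenoidal" using w(1)[OF t] by (auto simp: L2_closure_def)
    have "ip (F n) (w t) \<le> M * Lp_norm 2 (F n)" for n
      using functional_bound[OF F(2) t, of n] w(2)[OF t F(2), of n] by (simp add: ip_commute)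
    then have "ip (w t) (w t) \<le> M * Lp_norm 2 (w t)"
      by (intro LIMSEQ_le[OF L2_lim_ip[OF F(1) wL[OF t]] tendsto_mult[OF tendsto_const L2_lim_norm[OF F(1)]]]) auto
    then have "Lp_norm 2 (w t) * Lp_norm 2 (w t) \<le> M * Lp_norm 2 (w t)"
      by (simp flip: Lp_norm_2_squared power2_eq_square)
    then show ?thesis
      using M Lp_norm_2_nonneg[of "w t"] by (cases "Lp_norm 2 (w t) = 0") (auto simp: mult_le_cancel_right)
  qed
  have cont: "continuous_on {0..T} (\<lambda>t. ip (w t) \<psi>)" if \<psi>: "\<psi> \<in> L2" for \<psi>
  proof -
    obtain p P where p: "L2_lim P p" "\<And>n. P n \<in> smooth_solenoidal" "\<And>g. L2_closure g \<Longrightarrow> ip g \<psi> = ip g p"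
      using solenoidal_projection[OF \<psi>] by blast
    have pL: "p \<in> L2" "P n \<in> L2" for n using p(1) by (auto simp: L2_lim_def)
    have "uniform_limit {0..T} (\<lambda>n t. functional t (P n)) (\<lambda>t. ip (w t) \<psi>) sequentially"
    proof (rule uniform_limitI)
      fix e :: real assume "e > 0"
      have "(\<lambda>n. M * Lp_norm 2 (\<lambda>x. P n x - p x)) \<longlonglongrightarrow> M * 0"
        by (rule tendsto_mult[OF tendsto_const L2_lim_diff[OF p(1)]])
      then have "\<forall>\<^sub>F n in sequentially. M * Lp_norm 2 (\<lambda>x. P n x - p x) < e"
        using \<open>e > 0\<close> by (intro order_tendstoD) auto
      then show "\<forall>\<^sub>F n in sequentially. \<forall>t\<in>{0..T}. dist (functional t (P n)) (ip (w t) \<psi>) < e"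
      proof (eventually_elim, intro ballI)
        fix n t assume n: "M * Lp_norm 2 (\<lambda>x. P n x - p x) < e" and t: "t \<in> {0..T}"
        have "functional t (P n) - ip (w t) \<psi> = ip (w t) (\<lambda>x. P n x - p x)"
          using w(2)[OF t p(2)] p(3)[OF w(1)[OF t]] ip_diff_right[OF pL(2) pL(1) wL[OF t]] by simp
        moreover have "\<bar>ip (w t) (\<lambda>x. P n x - p x)\<bar> \<le> M * Lp_norm 2 (\<lambda>x. P n x - p x)"
          by (rule order_trans[OF ip_Cauchy_Schwarz[OF wL[OF t] L2_diff[OF pL(2) pL(1)]]
                mult_right_mono[OF wM[OF t] Lp_norm_2_nonneg]])
        ultimately show "dist (functional t (P n)) (ip (w t) \<psi>) < e" using n by (simp add: dist_real_def)
      qed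
    qed
    then show ?thesis
      by (rule uniform_limit_theorem[rotated])
         (use p(2) in \<open>auto intro!: always_eventually functional_continuous simp: smooth_solenoidal_def\<close>)
  qed
  have ae: "AE t in lebesgue_on {0<..<T}. ip (\<lambda>x. w t x - u t x) \<psi> = 0" if \<psi>: "\<psi> \<in> L2" for \<psi>
  proof -
    obtain p P where p: "L2_lim P p" "\<And>n. P n \<in> smooth_solenoidal" "\<And>g. L2_closure g \<Longrightarrow> ip g \<psi> = ip g p"
      using solenoidal_projection[OF \<psi>] by blast
    have "AE t in lebesgue_on {0<..<T}. \<forall>n. ip (u t) (P n) = functional t (P n)"
      by (subst AE_all_countable) (use weak[OF p(2)] in \<open>simp add: functional_def\<close>)
    then show ?thesis
      unfolding AE_time_iff
    proof (eventually_elim, intro impI)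
      fix t assume eq: "0 < t \<and> t < T \<longrightarrow> (\<forall>n. ip (u t) (P n) = functional t (P n))" and t: "0 < t \<and> t < T"
      then have t': "t \<in> {0..T}" by simp
      have "ip (P n) (u t) = ip (P n) (w t)" for n
        using eq t w(2)[OF t' p(2), of n] by (simp add: ip_commute)
      with L2_lim_ip[OF p(1) uL[of t]] L2_lim_ip[OF p(1) wL[OF t']]
      have "ip p (u t) = ip p (w t)" using LIMSEQ_unique by simp
      then have "ip (w t) \<psi> = ip (u t) \<psi>"
        using p(3)[OF w(1)[OF t']] p(3)[OF space_H_L2_closure[OF uH]] by (simp add: ip_commute)
      then show "ip (\<lambda>x. w t x - u t x) \<psi> = 0" using ip_diff_left[OF wL[OF t'] uL \<psi>] by simp
    qed
  qed
  have "AE t in lebesgue_on {0<..<T}. \<forall>n x. mol n (\<lambda>x. w t x - u t x) x = 0"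
  proof (subst AE_all_countable, intro allI)
    fix n
    show "AE t in lebesgue_on {0<..<T}. \<forall>x. mol n (\<lambda>x. w t x - u t x) x = 0"
      unfolding mol_def
      by (rule AE_kernel_zero[OF eta_finite_rank _ ae]) (rule L2_diff[OF wL uL], simp)
  qed
  then have eq: "AE t in lebesgue_on {0<..<T}. AE x in torus. w t x = u t x"
    unfolding AE_time_iff
  proof (eventually_elim, intro impI)
    fix t assume z: "0 < t \<and> t < T \<longrightarrow> (\<forall>n x. mol n (\<lambda>x. w t x - u t x) x = 0)" and t: "0 < t \<and> t < T"
    then have t': "t \<in> {0..T}" by simp
    have "mol n (w t) = mol n (u t)" for n
    proof
      fix x
      show "mol n (w t) x = mol n (u t) x"
        using z t mol_diff[OF L2_integrable[OF wL[OF t']] L2_integrable[OF uL], of n t x] by simp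
    qed
    then have "L2_lim (\<lambda>n. mol n (u t)) (w t)" using L2_closure_mol_lim[OF w(1)[OF t']] by simp
    then show "AE x in torus. w t x = u t x" by (rule L2_lim_unique[OF _ space_H_mol_lim[OF uH]])
  qed
  have "AE x in torus. w 0 x = v0 x"
    by (rule L2_closure_unique[OF w(1) space_H_L2_closure[OF v0]]) (use T w(2)[of 0] in \<open>simp_all add: functional_def\<close>)
  then have "weakly_cont_rep T v0 u w"
    unfolding weakly_cont_rep_def using wL cont eq by (simp add: ip_def)
  then show ?thesis by blast
qed

end

section \<open>The energy balance of the mollified field\<close>

text \<open>The difference quotients tend to zero.\<close>

lemma constant_if_increments_superlinear:
  fixes G :: "real \<Rightarrow> real"
  assumes G: "\<And>s t. 0 \<le> s \<Longrightarrow> s \<le> t \<Longrightarrow> t \<le> T \<Longrightarrow> \<bar>G t - G s\<bar> \<le> C * (sqrt (t - s) * (t - s))"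
    and t: "t \<in> {0..T}"
  shows "G t = G 0"
proof -
  have C: "\<bar>G y - G x\<bar> \<le> \<bar>C\<bar> * sqrt \<bar>y - x\<bar> * \<bar>y - x\<bar>" if "x \<in> {0..T}" "y \<in> {0..T}" for x y
  proof -
    have "\<bar>G y - G x\<bar> \<le> C * (sqrt \<bar>y - x\<bar> * \<bar>y - x\<bar>)"
      using G[of x y] G[of y x] that by (cases "x \<le> y") (auto simp: abs_minus_commute)
    also have "\<dots> \<le> \<bar>C\<bar> * (sqrt \<bar>y - x\<bar> * \<bar>y - x\<bar>)" by (intro mult_right_mono) auto
    finally show ?thesis by (simp add: mult.assoc)
  qed
  have "(G has_derivative (\<lambda>h. 0)) (at x within {0..T})" if x: "x \<in> {0..T}" for x
  proof (rule has_derivativeI_sandwich[of 1 _ _ _ _ "\<lambda>y. \<bar>C\<bar> * sqrt \<bar>y - x\<bar>"])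
    have "((\<lambda>y. \<bar>C\<bar> * sqrt \<bar>y - x\<bar>) \<longlongrightarrow> \<bar>C\<bar> * sqrt \<bar>x - x\<bar>) (at x within {0..T})" by (intro tendsto_intros)
    then show "((\<lambda>y. \<bar>C\<bar> * sqrt \<bar>y - x\<bar>) \<longlongrightarrow> 0) (at x within {0..T})" by simp
    fix y assume y: "y \<in> {0..T}" "y \<noteq> x" "dist y x < 1"
    have "norm (G y - G x - 0) \<le> (\<bar>C\<bar> * sqrt \<bar>y - x\<bar>) * \<bar>y - x\<bar>" using C[OF x y(1)] by simp
    then show "norm (G y - G x - 0) / norm (y - x) \<le> \<bar>C\<bar> * sqrt \<bar>y - x\<bar>"
      using y by (simp add: divide_le_eq)
  qed auto
  then have "\<exists>c. \<forall>x\<in>{0..T}. G x = c"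
    by (intro has_derivative_zero_constant[of "{0..T}"]) auto
  then show ?thesis using t by auto
qed

lemma solenoidal_linear:
  assumes "solenoidal f" "solenoidal g" shows "solenoidal (\<lambda>x. a *\<^sub>R f x + b *\<^sub>R g x)"
  using assms
  by (simp add: solenoidal_def L2_linear ip_linear_left smooth_periodic_L2 gradient_smooth)

lemma mol_mol_smooth_solenoidal:
  assumes "solenoidal f" shows "mol n (mol n f) \<in> smooth_solenoidal"
proof -
  have fL: "f \<in> L2" using assms by (simp add: solenoidal_def)
  have "solenoidal (mol n f)"
    by (rule solenoidal_smooth[OF mol_smooth[OF L2_integrable[OF fL]] solenoidal_mol[OF assms]])
  then show ?thesis by (simp add: smooth_solenoidal_def mol_mol_smooth[OF fL] solenoidal_mol)
qed

lemma mol_mol_linear: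
  assumes "f \<in> L2" "g \<in> L2"
  shows "mol n (mol n (\<lambda>x. a *\<^sub>R f x + b *\<^sub>R g x)) =
    (\<lambda>x. a *\<^sub>R mol n (mol n f) x + b *\<^sub>R mol n (mol n g) x)"
proof -
  have 1: "mol n (\<lambda>x. a *\<^sub>R f x + b *\<^sub>R g x) = (\<lambda>x. a *\<^sub>R mol n f x + b *\<^sub>R mol n g x)"
    by (simp add: fun_eq_iff mol_linear L2_integrable assms)
  show ?thesis
    unfolding 1 by (simp add: fun_eq_iff mol_linear[OF L2_integrable[OF mol_L2[OF assms(1)]] L2_integrable[OF mol_L2[OF assms(2)]]])
qed

locale solenoidal_path_rep = solenoidal_path +
  fixes w :: "real \<Rightarrow> real^3 \<Rightarrow> real^3"
  assumes rep: "weakly_cont_rep T v0 u w"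
begin

lemma wL: "t \<in> {0..T} \<Longrightarrow> w t \<in> L2"
  using rep by (simp add: weakly_cont_rep_def)

lemma w_continuous: "\<psi> \<in> L2 \<Longrightarrow> continuous_on {0..T} (\<lambda>t. ip (w t) \<psi>)"
  using rep unfolding weakly_cont_rep_def ip_def by blast

lemma w_AE: "AE t in lebesgue_on {0<..<T}. AE x in torus. w t x = u t x"
  using rep by (simp add: weakly_cont_rep_def)

lemma w_zero: "AE x in torus. w 0 x = v0 x"
  using rep by (simp add: weakly_cont_rep_def)

lemma w_ip_AE: assumes \<psi>: "\<psi> \<in> L2" shows "AE t in lebesgue_on {0<..<T}. ip (w t) \<psi> = ip (u t) \<psi>"
  using w_AE unfolding AE_time_iff
  by eventually_elim (use ip_cong_AE[OF wL uL \<psi>] in auto)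

lemma w_solenoidal: assumes t: "t \<in> {0..T}" shows "solenoidal (w t)"
  unfolding solenoidal_def
proof (intro conjI allI impI wL[OF t])
  fix \<psi> :: "real^3 \<Rightarrow> real" assume \<psi>: "smooth_periodic \<psi>"
  note g = smooth_periodic_L2[OF gradient_smooth[OF \<psi>]]
  have "AE t in lebesgue_on {0<..<T}. ip (w t) (gradient \<psi>) = 0"
    using w_ip_AE[OF g]
  proof eventually_elim
    case (elim t)
    then show ?case using space_H_solenoidal[OF uH, of t] \<psi> by (simp add: solenoidal_def)
  qed
  then show "ip (w t) (gradient \<psi>) = 0"
    by (rule continuous_AE_eq[OF T w_continuous[OF g] continuous_on_const _ t])
qed

text \<open>The pairing of \<open>w s\<close> with \<open>w t\<close> is continuous in \<open>s\<close> and bounded by \<open>c\<close> times the norm of \<open>w t\<close>; put \<open>s = t\<close>.\<close>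

lemma w_norm_le:
  assumes ae: "AE t in lebesgue_on {0<..<T}. Lp_norm 2 (u t) \<le> c" and c: "c \<ge> 0" and t: "t \<in> {0..T}"
  shows "Lp_norm 2 (w t) \<le> c"
proof -
  have "AE s in lebesgue_on {0<..<T}. ip (w s) (w t) \<le> c * Lp_norm 2 (w t)"
    using w_ip_AE[OF wL[OF t]] ae
  proof eventually_elim
    case (elim s)
    have "ip (u s) (w t) \<le> Lp_norm 2 (u s) * Lp_norm 2 (w t)"
      using ip_Cauchy_Schwarz[OF uL wL[OF t], of s] by linarith
    also have "\<dots> \<le> c * Lp_norm 2 (w t)" by (rule mult_right_mono[OF elim(2) Lp_norm_2_nonneg])
    finally show ?case by (simp add: elim(1))
  qed
  from continuous_AE_le[OF T w_continuous[OF wL[OF t]] this t]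
  have "Lp_norm 2 (w t) * Lp_norm 2 (w t) \<le> c * Lp_norm 2 (w t)"
    by (simp flip: Lp_norm_2_squared power2_eq_square)
  then show ?thesis
    using c Lp_norm_2_nonneg[of "w t"] by (cases "Lp_norm 2 (w t) = 0") (auto simp: mult_le_cancel_right)
qed

lemma wM: "t \<in> {0..T} \<Longrightarrow> Lp_norm 2 (w t) \<le> M"
  by (rule w_norm_le[OF _ M]) (simp add: uM)

lemma w_increment:
  assumes \<psi>: "\<psi> \<in> smooth_solenoidal" and st: "0 \<le> s" "s \<le> t" "t \<le> T"
  shows "ip (w t) \<psi> - ip (w s) \<psi> = integral {s..t} (\<lambda>\<tau>. flux_form (u \<tau>) \<psi>)"
proof -
  have s: "smooth_periodic \<psi>" and \<psi>L: "\<psi> \<in> L2" using \<psi> smooth_solenoidal_L2 by (auto simp: smooth_solenoidal_def)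
  have "AE t in lebesgue_on {0<..<T}. ip (w t) \<psi> = functional t \<psi>"
    using w_ip_AE[OF \<psi>L] weak[OF \<psi>] by eventually_elim (simp add: functional_def)
  then have "ip (w t) \<psi> = functional t \<psi>" if "t \<in> {0..T}" for t
    by (rule continuous_AE_eq[OF T w_continuous[OF \<psi>L] functional_continuous[OF s] _ that])
  then show ?thesis using functional_diff[OF s st] st by simp
qed

lemma w_increment_le:
  assumes \<psi>: "\<psi> \<in> smooth_solenoidal" and K: "\<And>x. norm (grad \<psi> x) \<le> K" and st: "0 \<le> s" "s \<le> t" "t \<le> T"
  shows "\<bar>ip (w t) \<psi> - ip (w s) \<psi>\<bar> \<le> K * M\<^sup>2 * (t - s)"
proof -
  have s: "smooth_periodic \<psi>" using \<psi> by (auto simp: smooth_solenoidal_def)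
  have "norm (integral {s..t} (\<lambda>\<tau>. flux_form (u \<tau>) \<psi>)) \<le> integral {s..t} (\<lambda>\<tau>. K * M\<^sup>2)"
    by (rule Henstock_Kurzweil_Integration.integral_norm_bound_integral[OF flux_integrable_on[OF s st(1,3)]])
       (use flux_form_bound[OF s K] in \<open>auto simp: integrable_const_ivl\<close>)
  then show ?thesis unfolding w_increment[OF \<psi> st] using st by (simp add: mult_ac)
qed

lemma flux_time_integrable:
  assumes D: "D \<ge> 0" "\<And>g x. g \<in> L2 \<Longrightarrow> norm (grad (mol n g) x) \<le> D * Lp_norm 2 g"
  shows "integrable (lebesgue_on {0<..<T}) (\<lambda>\<tau>. flux_form (u \<tau>) (mol n (mol n (u \<tau>))))"
proof (rule bounded_time_integrable[OF meas])
  show "(\<lambda>k. flux_form (F k) (mol n (mol n (F k)))) \<longlonglongrightarrow> flux_form f (mol n (mol n f))" if "L2_lim F f" for F f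
    by (rule flux_tendsto[OF that])
  fix t
  have "Lp_norm 2 (mol n (u t)) \<le> M" using mol_Lp_norm_2_le[OF uL, of n t] uM[of t] by linarith
  then have "norm (grad (mol n (mol n (u t))) x) \<le> D * M" for x
    using order_trans[OF D(2)[OF mol_L2[OF uL]] mult_left_mono[OF _ D(1)]] by blast
  then show "\<bar>flux_form (u t) (mol n (mol n (u t)))\<bar> \<le> D * M * M\<^sup>2"
    by (rule flux_form_bound[OF mol_mol_smooth[OF uL]])
qed

text \<open>
  Testing the equation with \<open>mol n (mol n (w t - w s))\<close> shows that the mollified path is Hoelder
  continuous with exponent one half in \<open>L2\<close>.  The energy increment over \<open>[s, t]\<close> thus differs from
  the time integral of the flux by at most a multiple of \<open>(t - s) powr (3 / 2)\<close>, and the difference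
  of the two is constant in time.
\<close>

lemma mollified_energy_balance:
  assumes t: "t \<in> {0..T}"
  shows "ip (mol n (w t)) (mol n (w t)) - ip (mol n (w 0)) (mol n (w 0)) =
    2 * integral {0..t} (\<lambda>\<tau>. flux_form (u \<tau>) (mol n (mol n (u \<tau>))))"
proof -
  obtain D where D: "D \<ge> 0" "\<And>g x. g \<in> L2 \<Longrightarrow> norm (grad (mol n g) x) \<le> D * Lp_norm 2 g"
    using grad_mol_bound[of n] by blast
  define mm where "mm f = mol n (mol n f)" for f :: "real^3 \<Rightarrow> real^3"
  define F where "F t = ip (mol n (w t)) (mol n (w t))" for t
  define fl where "fl \<tau> = flux_form (u \<tau>) (mm (u \<tau>))" for \<tau>
  have fli: "fl integrable_on {s..t}" if "0 \<le> s" "t \<le> T" for s t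
    unfolding fl_def mm_def
    by (rule integrable_on_subinterval[OF LINT_time_eq_integral(2)[OF flux_time_integrable[OF D]]]) (use that in auto)
  define C where "C = sqrt (2 * D * M * M\<^sup>2)"
  have mml: "mm (\<lambda>x. a *\<^sub>R f x + b *\<^sub>R g x) = (\<lambda>x. a *\<^sub>R mm f x + b *\<^sub>R mm g x)" if "f \<in> L2" "g \<in> L2" for f g a b
    unfolding mm_def by (rule mol_mol_linear[OF that])
  have mms: "smooth_periodic (mm f)" if "f \<in> L2" for f unfolding mm_def by (rule mol_mol_smooth[OF that])
  have mmL: "mm f \<in> L2" if "f \<in> L2" for f by (rule smooth_periodic_L2[OF mms[OF that]])
  have gm: "norm (grad (mm f) x) \<le> D * Lp_norm 2 (mol n f)" if "f \<in> L2" for f x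
    unfolding mm_def by (rule D(2)[OF mol_L2[OF that]])
  have ipm: "ip f (mm g) = ip (mol n f) (mol n g)" if "f \<in> L2" "g \<in> L2" for f g
    unfolding mm_def by (rule mol_ip[OF that(1) mol_L2[OF that(2)], symmetric])
  have half: "Lp_norm 2 (mol n (\<lambda>x. w t x - w s x)) \<le> C * sqrt (t - s)" if st: "0 \<le> s" "s \<le> t" "t \<le> T" for s t
  proof -
    have W: "w s \<in> L2" "w t \<in> L2" using st by (auto intro: wL)
    define d where "d = (\<lambda>x. w t x - w s x)"
    have d: "d \<in> L2" unfolding d_def by (rule L2_diff[OF W(2,1)])
    have "solenoidal d"
      using solenoidal_linear[OF w_solenoidal w_solenoidal, of t s 1 "-1"] st by (simp add: d_def)
    then have V: "mm d \<in> smooth_solenoidal" unfolding mm_def by (rule mol_mol_smooth_solenoidal)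
    have "Lp_norm 2 d \<le> 2 * M"
      using Lp_norm_2_triangle[OF W(2), of "\<lambda>x. - w s x"] L2_linear[OF W(1) W(1), of "-1" 0] wM[of s] wM[of t] st
      by (simp add: d_def Lp_norm_def)
    then have "D * Lp_norm 2 (mol n d) \<le> D * (2 * M)"
      using mol_Lp_norm_2_le[OF d, of n] by (intro mult_left_mono D(1)) linarith
    then have K: "norm (grad (mm d) x) \<le> D * (2 * M)" for x using gm[OF d, of x] by linarith
    have "(Lp_norm 2 (mol n d))\<^sup>2 = ip d (mm d)" by (simp add: ipm[OF d d] Lp_norm_2_squared)
    also have "\<dots> = ip (w t) (mm d) - ip (w s) (mm d)"
      unfolding d_def[symmetric] using ip_diff_left[OF W(2,1) mmL[OF d]] by (simp add: d_def)
    also have "\<dots> \<le> D * (2 * M) * M\<^sup>2 * (t - s)" using w_increment_le[OF V K st] by linarith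
    also have "\<dots> = (C * sqrt (t - s))\<^sup>2"
      using D(1) M st by (simp add: C_def power_mult_distrib)
    finally have "Lp_norm 2 (mol n d) \<le> C * sqrt (t - s)"
      by (rule power2_le_imp_le) (use D(1) M st in \<open>simp add: C_def\<close>)
    then show ?thesis by (simp only: d_def)
  qed
  have C0: "C \<ge> 0" using D(1) M by (simp add: C_def)
  have diff_flux: "\<bar>flux_form (u \<tau>) (mm (w t')) - flux_form (u \<tau>) (mm (w \<tau>))\<bar> \<le> D * (C * sqrt (t - s)) * M\<^sup>2"
    if st: "0 \<le> s" "t \<le> T" and \<tau>: "\<tau> \<in> {s..t}" "t' \<in> {s..t}" for s t \<tau> t'
  proof -
    have W: "w t' \<in> L2" "w \<tau> \<in> L2" using st \<tau> by (auto intro: wL)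
    define d where "d = (\<lambda>x. w t' x - w \<tau> x)"
    have d: "d \<in> L2" unfolding d_def by (rule L2_diff[OF W])
    have h: "Lp_norm 2 (mol n d) \<le> C * sqrt (t - s)"
    proof (cases "\<tau> \<le> t'")
      case True
      have "Lp_norm 2 (mol n d) \<le> C * sqrt (t' - \<tau>)" unfolding d_def by (rule half) (use True st \<tau> in auto)
      also have "\<dots> \<le> C * sqrt (t - s)" using \<tau> by (intro mult_left_mono C0) simp
      finally show ?thesis .
    next
      case False
      have "mol n d = (\<lambda>x. - mol n (\<lambda>x. w \<tau> x - w t' x) x)"
        by (simp add: d_def fun_eq_iff mol_diff L2_integrable W)
      then have "Lp_norm 2 (mol n d) = Lp_norm 2 (mol n (\<lambda>x. w \<tau> x - w t' x))" by (simp add: Lp_norm_def)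
      also have "\<dots> \<le> C * sqrt (\<tau> - t')" by (rule half) (use False st \<tau> in auto)
      also have "\<dots> \<le> C * sqrt (t - s)" using \<tau> by (intro mult_left_mono C0) simp
      finally show ?thesis .
    qed
    have "flux_form (u \<tau>) (mm (w t')) - flux_form (u \<tau>) (mm (w \<tau>)) = flux_form (u \<tau>) (mm d)"
      using flux_form_linear[OF uL mms[OF W(1)] mms[OF W(2)], of \<tau> 1 "-1"] mml[OF W, of 1 "-1"]
      by (simp add: d_def)
    moreover have "norm (grad (mm d) x) \<le> D * (C * sqrt (t - s))" for x
      using gm[OF d, of x] mult_left_mono[OF h D(1)] by linarith
    ultimately show ?thesis using flux_form_bound[OF mms[OF d]] by simp
  qed
  have incr: "\<bar>(F t - 2 * integral {0..t} fl) - (F s - 2 * integral {0..s} fl)\<bar> \<le>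
      (2 * D * C * M\<^sup>2) * (sqrt (t - s) * (t - s))" if st: "0 \<le> s" "s \<le> t" "t \<le> T" for s t
  proof -
    have W: "w s \<in> L2" "w t \<in> L2" using st by (auto intro: wL)
    \<comment> \<open>By symmetry of mollification, the increment of the energy is the pairing of \<open>w t - w s\<close> with the mollified sum.\<close>
    define \<psi> where "\<psi> = mm (\<lambda>x. 1 *\<^sub>R w t x + 1 *\<^sub>R w s x)"
    have \<psi>V: "\<psi> \<in> smooth_solenoidal"
      unfolding \<psi>_def mm_def using st
      by (intro mol_mol_smooth_solenoidal solenoidal_linear w_solenoidal) auto
    have \<psi>: "\<psi> = (\<lambda>x. 1 *\<^sub>R mm (w t) x + 1 *\<^sub>R mm (w s) x)" unfolding \<psi>_def by (rule mml[OF W(2,1)])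
    have ip\<psi>: "ip f \<psi> = ip f (mm (w t)) + ip f (mm (w s))" if "f \<in> L2" for f
      unfolding \<psi> ip_linear_right[OF mmL[OF W(2)] mmL[OF W(1)] that] by simp
    have "F t - F s = ip (w t) \<psi> - ip (w s) \<psi>"
      using ip\<psi>[OF W(1)] ip\<psi>[OF W(2)] ipm[OF W(1) W(1)] ipm[OF W(2) W(2)] ipm[OF W(1) W(2)] ipm[OF W(2) W(1)]
        ip_commute[of "mol n (w s)" "mol n (w t)"]
      by (simp add: F_def)
    also have "\<dots> = integral {s..t} (\<lambda>\<tau>. flux_form (u \<tau>) \<psi>)" by (rule w_increment[OF \<psi>V st])
    finally have "(F t - 2 * integral {0..t} fl) - (F s - 2 * integral {0..s} fl) =
        integral {s..t} (\<lambda>\<tau>. flux_form (u \<tau>) \<psi>) - 2 * integral {s..t} fl"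
      using Henstock_Kurzweil_Integration.integral_combine[OF st(1,2) fli[OF order_refl st(3)]] by simp
    also have "\<dots> = integral {s..t} (\<lambda>\<tau>. flux_form (u \<tau>) \<psi> - 2 * fl \<tau>)"
      using flux_integrable_on[of \<psi> s t] fli[OF st(1,3)] \<psi>V st
      by (simp add: Henstock_Kurzweil_Integration.integral_diff smooth_solenoidal_def)
    finally have eq: "(F t - 2 * integral {0..t} fl) - (F s - 2 * integral {0..s} fl) =
        integral {s..t} (\<lambda>\<tau>. flux_form (u \<tau>) \<psi> - 2 * fl \<tau>)" .
    define B where "B = 2 * (D * (C * sqrt (t - s)) * M\<^sup>2)"
    have good: "\<bar>flux_form (u \<tau>) \<psi> - 2 * fl \<tau>\<bar> \<le> B"
      if \<tau>: "\<tau> \<in> {s..t}" and ae: "AE x in torus. w \<tau> x = u \<tau> x" for \<tau>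
    proof -
      have "w \<tau> \<in> L2" using \<tau> st by (auto intro: wL)
      then have "mol n (w \<tau>) = mol n (u \<tau>)" by (intro mol_cong_AE L2_integrable uL ae)
      then have "fl \<tau> = flux_form (u \<tau>) (mm (w \<tau>))" by (simp add: fl_def mm_def)
      moreover have "flux_form (u \<tau>) \<psi> = flux_form (u \<tau>) (mm (w t)) + flux_form (u \<tau>) (mm (w s))"
        unfolding \<psi> flux_form_linear[OF uL mms[OF W(2)] mms[OF W(1)]] by simp
      ultimately show ?thesis
        using diff_flux[OF st(1,3) \<tau>, of t] diff_flux[OF st(1,3) \<tau>, of s] st unfolding B_def by auto
    qed
    obtain N where N: "negligible N" "\<And>\<tau>. \<tau> \<in> {s<..<t} - N \<Longrightarrow> \<bar>flux_form (u \<tau>) \<psi> - 2 * fl \<tau>\<bar> \<le> B"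
    proof
      let ?N = "{\<tau>. \<not> (0 < \<tau> \<and> \<tau> < T \<longrightarrow> (AE x in torus. w \<tau> x = u \<tau> x))}"
      show "negligible ?N"
        using w_AE unfolding AE_time_iff negligible_iff_null_sets
        by (subst (asm) completion.AE_iff_null_sets) simp
      show "\<bar>flux_form (u \<tau>) \<psi> - 2 * fl \<tau>\<bar> \<le> B" if "\<tau> \<in> {s<..<t} - ?N" for \<tau>
        using that st by (intro good) auto
    qed
    define h where "h \<tau> = (if \<tau> \<in> {s<..<t} - N then flux_form (u \<tau>) \<psi> - 2 * fl \<tau> else 0)" for \<tau>
    have "negligible (N \<union> {s, t})" using N(1) by simp
    then have hN: "integral {s..t} (\<lambda>\<tau>. flux_form (u \<tau>) \<psi> - 2 * fl \<tau>) = integral {s..t} h"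
      by (rule integral_spike) (auto simp: h_def)
    have hi: "h integrable_on {s..t}"
    proof (rule integrable_spike[OF _ \<open>negligible (N \<union> {s, t})\<close>])
      show "(\<lambda>\<tau>. flux_form (u \<tau>) \<psi> - 2 * fl \<tau>) integrable_on {s..t}"
        using flux_integrable_on[of \<psi> s t] fli[OF st(1,3)] \<psi>V st
        by (intro Henstock_Kurzweil_Integration.integrable_diff integrable_on_mult_right)
           (auto simp: smooth_solenoidal_def)
    qed (auto simp: h_def)
    have B0: "B \<ge> 0" using D(1) C0 st by (simp add: B_def)
    have "norm (integral {s..t} h) \<le> integral {s..t} (\<lambda>\<tau>. B)"
      by (rule Henstock_Kurzweil_Integration.integral_norm_bound_integral[OF hi])
         (use N(2) B0 in \<open>auto simp: h_def integrable_const_ivl\<close>)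
    also have "\<dots> = (2 * D * C * M\<^sup>2) * (sqrt (t - s) * (t - s))"
      using st by (simp add: B_def mult_ac)
    finally show ?thesis unfolding eq hN by simp
  qed
  from constant_if_increments_superlinear[of T "\<lambda>t. F t - 2 * integral {0..t} fl", OF incr t]
  show ?thesis by (simp add: F_def fl_def[abs_def] mm_def)
qed

text \<open>
  The upper bound comes from the times at which \<open>w t\<close> is the limit of its mollifications, and weak
  continuity; the lower bound from the contraction property of mollification.
\<close>

lemma energy_constant:
  assumes flux: "\<And>n t. 0 < t \<Longrightarrow> t < T \<Longrightarrow> \<bar>flux_form (u t) (mol n (mol n (u t)))\<bar> \<le> \<delta> n * R t"
    and R: "integrable (lebesgue_on {0<..<T}) R" and \<delta>: "\<delta> \<longlonglongrightarrow> 0" and t: "t \<in> {0..T}"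
  shows "ip (w t) (w t) = ip v0 v0"
proof -
  define F where "F n t = ip (mol n (w t)) (mol n (w t))" for n t
  have z: "0 \<in> {0..T}" using T by simp
  have v0L: "v0 \<in> L2" by (rule space_H_approx(1)[OF v0])
  have conv: "(\<lambda>n. ip (mol n f) (mol n f)) \<longlonglongrightarrow> ip f f" if "f \<in> space_H" for f
    using tendsto_power[OF L2_lim_norm[OF space_H_mol_lim[OF that]], of 2] by (simp add: Lp_norm_2_squared)
  have lim: "(\<lambda>n. F n t) \<longlonglongrightarrow> ip v0 v0" if t: "t \<in> {0..T}" for t
  proof -
    have "\<bar>F n t - F n 0\<bar> \<le> \<delta> n * (2 * integral {0..t} R)" for n
    proof -
      obtain D where D: "D \<ge> 0" "\<And>g x. g \<in> L2 \<Longrightarrow> norm (grad (mol n g) x) \<le> D * Lp_norm 2 g"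
        using grad_mol_bound[of n] by blast
      define fl where "fl \<tau> = flux_form (u \<tau>) (mol n (mol n (u \<tau>)))" for \<tau>
      have "fl integrable_on {0..t}"
        unfolding fl_def
        by (rule integrable_on_subinterval[OF LINT_time_eq_integral(2)[OF flux_time_integrable[OF D]]]) (use t in auto)
      then have 1: "fl integrable_on {0<..<t}" by (simp add: integrable_on_open_interval_real)
      have R0: "R integrable_on {0..t}"
        by (rule integrable_on_subinterval[OF LINT_time_eq_integral(2)[OF R]]) (use t in auto)
      then have 2: "(\<lambda>\<tau>. \<delta> n * R \<tau>) integrable_on {0<..<t}"
        by (intro integrable_on_mult_right) (simp add: integrable_on_open_interval_real)
      have "norm (integral {0<..<t} fl) \<le> integral {0<..<t} (\<lambda>\<tau>. \<delta> n * R \<tau>)"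
        by (rule Henstock_Kurzweil_Integration.integral_norm_bound_integral[OF 1 2])
           (use flux t in \<open>auto simp: fl_def\<close>)
      then have "\<bar>integral {0..t} fl\<bar> \<le> \<delta> n * integral {0..t} R" by (simp add: integral_open_interval_real)
      then show ?thesis using mollified_energy_balance[OF t, of n] by (simp add: F_def fl_def[abs_def])
    qed
    moreover have "(\<lambda>n. \<delta> n * (2 * integral {0..t} R)) \<longlonglongrightarrow> 0 * (2 * integral {0..t} R)"
      by (rule tendsto_mult[OF \<delta> tendsto_const])
    ultimately have "(\<lambda>n. F n t - F n 0) \<longlonglongrightarrow> 0" by (rule null_dominated) simp
    moreover have "F n 0 = ip (mol n v0) (mol n v0)" for n
      unfolding F_def using mol_cong_AE[OF L2_integrable[OF wL[OF z]] L2_integrable[OF v0L] w_zero] by simp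
    ultimately show ?thesis using tendsto_add[of "\<lambda>n. F n t - F n 0" 0 _ "\<lambda>n. F n 0"] conv[OF v0] by simp
  qed
  have "AE t in lebesgue_on {0<..<T}. Lp_norm 2 (u t) \<le> Lp_norm 2 v0"
    using w_AE unfolding AE_time_iff
  proof (eventually_elim, intro impI)
    fix s assume ae: "0 < s \<and> s < T \<longrightarrow> (AE x in torus. w s x = u s x)" and s: "0 < s \<and> s < T"
    then have s': "s \<in> {0..T}" by simp
    have "mol n (w s) = mol n (u s)" for n
      by (rule mol_cong_AE[OF L2_integrable[OF wL[OF s']] L2_integrable[OF uL]]) (use ae s in simp)
    then have "(\<lambda>n. ip (mol n (u s)) (mol n (u s))) \<longlonglongrightarrow> ip v0 v0" using lim[OF s'] by (simp add: F_def)
    then have "ip (u s) (u s) = ip v0 v0" using conv[OF uH] LIMSEQ_unique by blast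
    then show "Lp_norm 2 (u s) \<le> Lp_norm 2 v0" by (simp add: Lp_norm_2)
  qed
  from w_norm_le[OF this Lp_norm_2_nonneg t] have "(Lp_norm 2 (w t))\<^sup>2 \<le> (Lp_norm 2 v0)\<^sup>2"
    by (intro power_mono Lp_norm_2_nonneg)
  moreover have "ip v0 v0 \<le> ip (w t) (w t)"
  proof (rule LIMSEQ_le_const2[OF lim[OF t]], intro exI allI impI)
    fix n
    have "(Lp_norm 2 (mol n (w t)))\<^sup>2 \<le> (Lp_norm 2 (w t))\<^sup>2"
      by (intro power_mono mol_Lp_norm_2_le[OF wL[OF t]] Lp_norm_2_nonneg)
    then show "F n t \<le> ip (w t) (w t)" by (simp add: F_def Lp_norm_2_squared)
  qed
  ultimately show ?thesis by (simp add: Lp_norm_2_squared)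
qed

end

section \<open>Energy conservation\<close>

lemma borel_measurable_continuous_functional:
  fixes s :: "nat \<Rightarrow> real \<Rightarrow> real^3 \<Rightarrow> real^3" and \<Phi> :: "(real^3 \<Rightarrow> real^3) \<Rightarrow> real"
  assumes s: "\<And>n. simple_function (lebesgue_on {0<..<T}) (s n)"
    and \<Phi>: "AE t in lebesgue_on {0<..<T}. (\<lambda>n. \<Phi> (s n t)) \<longlonglongrightarrow> \<Phi> (u t)"
  shows "(\<lambda>t. \<Phi> (u t)) \<in> borel_measurable (lebesgue_on {0<..<T})"
proof (rule borel_measurable_time_AE)
  have "simple_function (lebesgue_on {0<..<T}) (\<lambda>t. \<Phi> (s n t))" for n
    using simple_function_compose[OF s, of \<Phi> n] by (simp add: comp_def)
  then show "(\<lambda>t. lim (\<lambda>n. \<Phi> (s n t))) \<in> borel_measurable (lebesgue_on {0<..<T})"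
    by (intro borel_measurable_lim_metric borel_measurable_simple_function)
  show "AE t in lebesgue_on {0<..<T}. lim (\<lambda>n. \<Phi> (s n t)) = \<Phi> (u t)"
    using \<Phi> by eventually_elim (rule limI)
qed

text \<open>
  The lower bound \<open>3 / (5 * q - 6)\<close> for \<open>\<theta>\<close> is below each of the upper bounds \<open>1\<close>, \<open>1 / (q - 2)\<close> and
  \<open>(r - 1) / 2\<close>, the last one by the assumption on \<open>r\<close>.
\<close>

lemma exponent_choice:
  fixes q r :: real
  assumes q: "q > 2" and r: "r > 5 * q / (5 * q - 6)"
  obtains \<theta> where "0 \<le> \<theta>" "\<theta> \<le> 1" "\<theta> * (q - 2) \<le> 1" "1 + 2 * \<theta> \<le> r"
    "0 < \<theta> - 3 * (1 - \<theta> * (q - 2)) / (2 * q)"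
proof -
  define a where "a = 3 / (5 * q - 6)"
  have p: "5 * q - 6 > 0" using q by simp
  have "a < 1" "a < 1 / (q - 2)" using q p by (auto simp: a_def field_simps)
  moreover have "5 * q / (5 * q - 6) = 1 + 2 * a" using p by (simp add: a_def field_simps)
  then have "a < (r - 1) / 2" using r by simp
  ultimately have "a < min 1 (min (1 / (q - 2)) ((r - 1) / 2))" by simp
  then obtain \<theta> where "a < \<theta>" "\<theta> < min 1 (min (1 / (q - 2)) ((r - 1) / 2))" using dense by blast
  then have \<theta>: "a < \<theta>" "\<theta> < 1" "\<theta> < 1 / (q - 2)" "\<theta> < (r - 1) / 2" by auto
  have a0: "a > 0" using p by (simp add: a_def)
  have "3 < \<theta> * (5 * q - 6)" using \<theta>(1) p by (simp add: a_def divide_less_eq)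
  then have "3 * (1 - \<theta> * (q - 2)) < \<theta> * (2 * q)" by (simp add: algebra_simps)
  then have "3 * (1 - \<theta> * (q - 2)) / (2 * q) < \<theta>" using q by (simp add: divide_less_eq)
  moreover have "\<theta> * (q - 2) \<le> 1" using \<theta>(3) q by (simp add: less_divide_eq)
  ultimately show ?thesis using that[of \<theta>] \<theta> a0 by simp
qed

lemma one_plus_powr_le:
  fixes W r :: real
  assumes "W \<ge> 0" "r \<ge> 0"
  shows "(1 + W) powr r \<le> 2 powr r * (1 + W powr r)"
proof -
  have "(1 + W) powr r \<le> (2 * max 1 W) powr r" using assms by (intro powr_mono2) auto
  also have "\<dots> = 2 powr r * max 1 W powr r" using assms by (simp add: powr_mult)
  also have "\<dots> \<le> 2 powr r * (1 + W powr r)"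
    by (intro mult_left_mono) (auto simp: max_def)
  finally show ?thesis .
qed

theorem theorem2:
  fixes T q :: real
    and v0 :: "real^3 \<Rightarrow> real^3"
    and v :: "real \<Rightarrow> real^3 \<Rightarrow> real^3"
  assumes "T > 0"
    and "v0 \<in> space_H"
    and "euler_weak_solution T v0 v"
    and "q > 2"
    and "\<exists>r. r > 5 * q / (5 * q - 6) \<and> v \<in> bochner_Lp r T (W1_torus q) (W1_norm q)"
  shows "conserves_energy T v0 v"
proof -
  obtain r where r: "r > 5 * q / (5 * q - 6)" "v \<in> bochner_Lp r T (W1_torus q) (W1_norm q)"
    using assms(5) by blast
  obtain \<theta> where \<theta>: "0 \<le> \<theta>" "\<theta> \<le> 1" "\<theta> * (q - 2) \<le> 1" and \<theta>r: "1 + 2 * \<theta> \<le> r"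
    and c: "0 < \<theta> - 3 * (1 - \<theta> * (q - 2)) / (2 * q)"
    using exponent_choice[OF assms(4) r(1)] by blast
  have "v \<in> bochner_Linf T space_H (Lp_norm 2)" using assms(3) by (simp add: euler_weak_solution_def)
  then obtain M s where vH: "AE t in lebesgue_on {0<..<T}. v t \<in> space_H"
    and vM: "AE t in lebesgue_on {0<..<T}. Lp_norm 2 (v t) \<le> M"
    and s: "\<And>n. simple_function (lebesgue_on {0<..<T}) (s n)" "\<And>n t. t \<in> {0<..<T} \<Longrightarrow> s n t \<in> space_H"
    and sv: "AE t in lebesgue_on {0<..<T}. (\<lambda>n. Lp_norm 2 (\<lambda>x. s n t x - v t x)) \<longlonglongrightarrow> 0"
    unfolding bochner_Linf_def bochner_measurable_def by blast
  have vW: "AE t in lebesgue_on {0<..<T}. v t \<in> W1_torus q"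
    and Wr: "integrable (lebesgue_on {0<..<T}) (\<lambda>t. W1_norm q (v t) powr r)"
    using r(2) by (auto simp: bochner_Lp_def bochner_measurable_def)
  define M' where "M' = max M 0"
  define good where "good t \<longleftrightarrow> 0 < t \<and> t < T \<and> v t \<in> space_H \<and> Lp_norm 2 (v t) \<le> M \<and> v t \<in> W1_torus q" for t
  \<comment> \<open>Zero satisfies all bounds, and a null set of times does not affect the equation.\<close>
  define u where "u t = (if good t then v t else (\<lambda>x. 0))" for t
  have uv: "AE t in lebesgue_on {0<..<T}. u t = v t"
    using vH vM vW unfolding AE_time_iff by eventually_elim (simp add: u_def good_def)
  have uH: "u t \<in> space_H" for t by (simp add: u_def good_def zero_space_H)
  have uL: "u t \<in> L2" for t by (rule space_H_approx(1)[OF uH])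
  have uM: "Lp_norm 2 (u t) \<le> M'" for t
    by (auto simp: u_def good_def M'_def Lp_norm_2 ip_def)
  have meas: "(\<lambda>t. \<Phi> (u t)) \<in> borel_measurable (lebesgue_on {0<..<T})"
    if \<Phi>: "\<And>F f. L2_lim F f \<Longrightarrow> (\<lambda>k. \<Phi> (F k)) \<longlonglongrightarrow> (\<Phi> f :: real)" for \<Phi>
  proof (rule borel_measurable_continuous_functional[OF s(1)])
    show "AE t in lebesgue_on {0<..<T}. (\<lambda>n. \<Phi> (s n t)) \<longlonglongrightarrow> \<Phi> (u t)"
      using uv sv unfolding AE_time_iff
    proof (eventually_elim, intro impI)
      fix t
      assume uv: "0 < t \<and> t < T \<longrightarrow> u t = v t" and t: "0 < t \<and> t < T"
        and sv: "0 < t \<and> t < T \<longrightarrow> (\<lambda>n. Lp_norm 2 (\<lambda>x. s n t x - v t x)) \<longlonglongrightarrow> 0"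
      have "s n t \<in> L2" for n using space_H_approx(1)[OF s(2)] t by simp
      then have "L2_lim (\<lambda>n. s n t) (u t)" using uv sv t uL[of t] by (simp add: L2_lim_def)
      then show "(\<lambda>n. \<Phi> (s n t)) \<longlonglongrightarrow> \<Phi> (u t)" by (rule \<Phi>)
    qed
  qed
  have weak: "AE t in lebesgue_on {0<..<T}. ip (u t) \<psi> = ip v0 \<psi> + integral {0..t} (\<lambda>s. flux_form (u s) \<psi>)"
    if \<psi>: "\<psi> \<in> smooth_solenoidal" for \<psi>
  proof -
    have sm: "smooth_periodic \<psi>" and \<psi>L: "\<psi> \<in> L2" using \<psi> smooth_solenoidal_L2 by (auto simp: smooth_solenoidal_def)
    obtain K where K: "K \<ge> 0" "\<And>x. norm (grad \<psi> x) \<le> K" using grad_bounded[OF sm] by blast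
    have m1: "(\<lambda>t. ip (u t) \<psi>) \<in> borel_measurable (lebesgue_on {0<..<T})"
      by (rule meas) (rule L2_lim_ip[OF _ \<psi>L])
    have m2: "(\<lambda>t. flux_form (u t) \<psi>) \<in> borel_measurable (lebesgue_on {0<..<T})"
      by (rule meas) (rule flux_form_tendsto[OF _ sm])
    have b1: "\<bar>ip (u t) \<psi>\<bar> \<le> M' * Lp_norm 2 \<psi>" for t
      by (rule order_trans[OF ip_Cauchy_Schwarz[OF uL \<psi>L] mult_right_mono[OF uM Lp_norm_2_nonneg]])
    have b2: "\<bar>flux_form (u t) \<psi>\<bar> \<le> K * M'\<^sup>2" for t
      by (rule order_trans[OF flux_form_le[OF uL sm K(2)]])
         (intro mult_left_mono power_mono uM Lp_norm_2_nonneg K(1))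
    show ?thesis
      by (rule weak_time_equation[OF bounded_time_integrable[OF m1 b1] bounded_time_integrable[OF m2 b2] b2])
         (rule weak_form_product[OF assms(3) _ \<psi> uv uL m1 m2])
  qed
  interpret solenoidal_path T M' v0 u
    by unfold_locales (use assms(1,2) uH uM meas weak in auto)
  define R where "R t = 582 * (4 * M'\<^sup>2 + 2) * (2 powr r * (1 + W1_norm q (v t) powr r))" for t
  define \<delta> where "\<delta> n = (1 / real (Suc n)) powr (\<theta> - 3 * (1 - \<theta> * (q - 2)) / (2 * q))" for n
  have R: "integrable (lebesgue_on {0<..<T}) R"
  proof -
    interpret finite_measure "lebesgue_on {0<..<T}" by (rule finite_measure_lebesgue_on) simp
    show ?thesis
      unfolding R_def by (intro integrable_mult_right Bochner_Integration.integrable_add Wr) simp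
  qed
  have \<delta>: "\<delta> \<longlonglongrightarrow> 0"
  proof -
    have "(\<lambda>n. inverse (real (Suc n)) powr (\<theta> - 3 * (1 - \<theta> * (q - 2)) / (2 * q))) \<longlonglongrightarrow>
        0 powr (\<theta> - 3 * (1 - \<theta> * (q - 2)) / (2 * q))"
      by (rule tendsto_powr'[OF LIMSEQ_inverse_real_of_nat tendsto_const]) (use c in auto)
    then show ?thesis by (simp add: \<delta>_def[abs_def] inverse_eq_divide)
  qed
  have r0: "r \<ge> 0" using \<theta>r \<theta> by simp
  have flux: "\<bar>flux_form (u t) (mol n (mol n (u t)))\<bar> \<le> \<delta> n * R t" for n t
  proof (cases "good t")
    case True
    then have ut: "u t = v t" by (simp add: u_def)
    define A where "A = 1 + W1_norm q (v t)"
    have W0: "W1_norm q (v t) \<ge> 0" by (simp add: W1_norm_def)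
    have "(Lp_norm 2 (u t))\<^sup>2 \<le> M'\<^sup>2" by (intro power_mono uM Lp_norm_2_nonneg)
    then have E: "ip (u t) (u t) \<le> M'\<^sup>2" by (simp add: Lp_norm_2_squared)
    have "\<bar>flux_form (u t) (mol n (mol n (u t)))\<bar> \<le> 582 * (4 * M'\<^sup>2 + 2) * \<delta> n * A powr (1 + 2 * \<theta>)"
      unfolding \<delta>_def
      by (rule flux_estimate[OF uH _ assms(4) _ _ E \<theta>]) (use True W0 in \<open>auto simp: ut A_def good_def\<close>)
    also have "\<dots> \<le> 582 * (4 * M'\<^sup>2 + 2) * \<delta> n * (2 powr r * (1 + W1_norm q (v t) powr r))"
    proof (intro mult_left_mono)
      have "A powr (1 + 2 * \<theta>) \<le> A powr r" using \<theta>r W0 by (intro powr_mono) (auto simp: A_def)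
      also have "\<dots> \<le> 2 powr r * (1 + W1_norm q (v t) powr r)"
        unfolding A_def by (rule one_plus_powr_le[OF W0 r0])
      finally show "A powr (1 + 2 * \<theta>) \<le> 2 powr r * (1 + W1_norm q (v t) powr r)" .
    qed (simp add: \<delta>_def)
    also have "\<dots> = \<delta> n * R t" by (simp add: R_def)
    finally show ?thesis .
  next
    case False
    then have "flux_form (u t) (mol n (mol n (u t))) = 0" by (simp add: u_def flux_form_def)
    moreover have "0 \<le> \<delta> n * R t" by (simp add: \<delta>_def R_def)
    ultimately show ?thesis by simp
  qed
  have rep_iff: "weakly_cont_rep T v0 v w \<longleftrightarrow> weakly_cont_rep T v0 u w" for w
  proof -
    have "(AE t in lebesgue_on {0<..<T}. AE x in torus. w t x = v t x) \<longleftrightarrow>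
        (AE t in lebesgue_on {0<..<T}. AE x in torus. w t x = u t x)"
      by (rule eventually_subst) (use uv in \<open>auto elim: eventually_mono\<close>)
    then show ?thesis by (simp add: weakly_cont_rep_def)
  qed
  show ?thesis
    unfolding conserves_energy_def rep_iff
  proof (intro conjI allI impI ballI)
    show "\<exists>w. weakly_cont_rep T v0 u w" by (rule weakly_continuous_representative)
    fix w t assume w: "weakly_cont_rep T v0 u w" and t: "t \<in> {0..T}"
    interpret solenoidal_path_rep T M' v0 u w by unfold_locales (rule w)
    have "ip (w t) (w t) = ip v0 v0" by (rule energy_constant[OF flux R \<delta> t])
    then show "energy (w t) = energy v0" by (simp add: energy_def Lp_norm_2_squared)
  qed
qed

end
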